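(* Let $\sigma$ be a full-dimensional pointed polyhedral cone in a finite-dimensional real vector space $V$, let $\Delta=[\sigma]$, and fix $v\in V$. If $\mathcal F$ is a pure $\mathcal A_\Delta$-module, then its $v$-localization $\mathcal F^v$ is also a pure $\mathcal A_\Delta$-module.
   Context: Fans and sheaves. A fan $\Delta$ in $V$ is a finite set of pointed polyhedral cones closed under taking faces and such that any two cones meet in a common face; $\tau\prec\sigma$ means $\tau$ is a face of $\sigma$; $[\sigma]$ is the fan of all faces of $\sigma$ and $\partial\sigma=[\sigma]\setminus\{\sigma\}$; for a subset $\Sigma\subset\Delta$, $[\Sigma]=\bigcup_{\tau\in\Sigma}[\tau]$. A subfan is a subset that is itself a fan. $\Delta$ is a topological space whose open sets are the subfans. A sheaf $\mathcal F$ on $\Delta$ assigns a vector space $\mathcal F(\Sigma)$ to each subfan with restriction maps $\mathcal F(\Sigma)\to\mathcal F(\Sigma')$ for $\Sigma'\subset\Sigma$, compatible with composition and satisfying gluing: for subfans $\Sigma,\Sigma'$, the image of $\mathcal F(\Sigma\cup\Sigma')$ in $\mathcal F(\Sigma)\oplus\mathcal F(\Sigma')$ consists of the pairs agreeing on $\Sigma\cap\Sigma'$. Write $\mathcal F(\tau)=\mathcal F([\tau])$, and for subfans $\Sigma\subset\Sigma'$, $\mathcal F(\Sigma',\Sigma)=\ker(\mathcal F(\Sigma')\to\mathcal F(\Sigma))$. The sheaf $\mathcal A_\Delta$ sends $\Sigma$ to the graded ring $\mathcal A(\Sigma)$ of functions $|\Sigma|\to\mathbb R$ whose restriction to each cone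 is polynomial (linear functions in degree $1$); its stalk $\mathcal A(\tau)=A_\tau$ is the ring of polynomial functions on $\mathrm{span}(\tau)$. An $\mathcal A_\Delta$-module is a sheaf $\mathcal F$ with a graded $\mathcal A(\Sigma)$-module structure on each $\mathcal F(\Sigma)$ compatible with restrictions. $\mathcal F$ is pure if it is locally free ($\mathcal F(\tau)$ is a free $A_\tau$-module for all $\tau\in\Delta$) and flabby ($\mathcal F(\Delta)\to\mathcal F(\Sigma)$ is surjective for every subfan $\Sigma$). $v$-localization. For $\Delta=[\sigma]$ with $\sigma$ full-dimensional and $v\in V$: a face $\tau$ of $\sigma$ is a back face if for every $x$ in the relative interior of $\tau$ the set $\{t\in\mathbb R: x+tv\in\sigma\}$ contains an interval $[0,\epsilon_x)$ with $\epsilon_x>0$; $\Delta_{\le0}$ is the set of back faces; front faces and $\Delta_{\ge0}$ are defined the same way with $v$ replaced by $-v$. Put $\Delta_0=\Delta_{\le0}\cap\Delta_{\ge0}$ and $\Delta_+=\Delta_{\ge0}\setminus\Delta_0$. For a subset $\Sigma\subset\Delta$ put $\Sigma_{\ge0}=\Sigma\cap\Delta_{\ge0}$ and $\Sigma_+=\Sigma\cap\Delta_+$. The $v$-localization of an $\mathcal A_\Delta$-module $\mathcal F$ is the sheaf $\mathcal F^v(\Sigma)=\mathcal F([\Sigma_{\ge0}],[\Sigma_+])$ for subfans $\Sigma\subset\Delta$, with the induced restriction maps and module structures. *)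

theory Defs
  imports "HOL-Analysis.Analysis" "HOL-Algebra.Module" "HOL-Algebra.AbelCoset"
begin

section \<open>Cones and fans\<close>

text \<open>\<^const>\<open>face_of\<close> admits the empty set as a face, whereas a face of a cone is nonempty.\<close>

definition pointed_polyhedral_cone :: "'a::euclidean_space set \<Rightarrow> bool" where
  "pointed_polyhedral_cone \<sigma> \<longleftrightarrow>
     polyhedron \<sigma> \<and> cone \<sigma> \<and> \<sigma> \<noteq> {} \<and> (\<forall>x. x \<in> \<sigma> \<and> - x \<in> \<sigma> \<longrightarrow> x = 0)"

definition cone_faces :: "'a::euclidean_space set \<Rightarrow> 'a set set" where
  "cone_faces \<sigma> = {\<tau>. \<tau> face_of \<sigma> \<and> \<tau> \<noteq> {}}"

definition face_closure :: "'a::euclidean_space set set \<Rightarrow> 'a set set" where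
  "face_closure \<Sigma> = (\<Union>\<tau>\<in>\<Sigma>. cone_faces \<tau>)"

text \<open>The empty fan is allowed: it is the empty open set of the fan topology.\<close>

definition fan :: "'a::euclidean_space set set \<Rightarrow> bool" where
  "fan \<Delta> \<longleftrightarrow>
     finite \<Delta> \<and>
     (\<forall>\<sigma>\<in>\<Delta>. pointed_polyhedral_cone \<sigma>) \<and>
     (\<forall>\<sigma>\<in>\<Delta>. cone_faces \<sigma> \<subseteq> \<Delta>) \<and>
     (\<forall>\<sigma>\<in>\<Delta>. \<forall>\<tau>\<in>\<Delta>. \<sigma> \<inter> \<tau> \<in> cone_faces \<sigma> \<and> \<sigma> \<inter> \<tau> \<in> cone_faces \<tau>)"

definition subfan :: "'a::euclidean_space set set \<Rightarrow> 'a set set \<Rightarrow> bool" where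
  "subfan \<Sigma> \<Delta> \<longleftrightarrow> \<Sigma> \<subseteq> \<Delta> \<and> fan \<Sigma>"


section \<open>Conewise polynomial functions\<close>

text \<open>
  A function on the support \<open>\<Union>\<Sigma>\<close> is represented by its extension with value
  \<^const>\<open>undefined\<close>. For \<open>\<Sigma> = {}\<close> this gives the zero ring.
\<close>

definition conewise_poly :: "'a::euclidean_space set set \<Rightarrow> ('a \<Rightarrow> real) set" where
  "conewise_poly \<Sigma> =
     {f \<in> extensional (\<Union>\<Sigma>).
        \<forall>\<tau>\<in>\<Sigma>. \<exists>p. real_polynomial_function p \<and> (\<forall>x\<in>\<tau>. f x = p x)}"

definition conewise_ring :: "'a::euclidean_space set set \<Rightarrow> ('a \<Rightarrow> real) ring" where
  "conewise_ring \<Sigma> =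
     \<lparr>carrier = conewise_poly \<Sigma>,
      mult = (\<lambda>f g. restrict (\<lambda>x. f x * g x) (\<Union>\<Sigma>)),
      one = restrict (\<lambda>x. 1) (\<Union>\<Sigma>),
      zero = restrict (\<lambda>x. 0) (\<Union>\<Sigma>),
      add = (\<lambda>f g. restrict (\<lambda>x. f x + g x) (\<Union>\<Sigma>))\<rparr>"

definition conewise_homogeneous ::
  "'a::euclidean_space set set \<Rightarrow> nat \<Rightarrow> ('a \<Rightarrow> real) set" where
  "conewise_homogeneous \<Sigma> d =
     {f \<in> extensional (\<Union>\<Sigma>).
        \<forall>\<tau>\<in>\<Sigma>. \<exists>p. real_polynomial_function p \<and> (\<forall>c x. p (c *\<^sub>R x) = c ^ d * p x) \<and>
                 (\<forall>x\<in>\<tau>. f x = p x)}"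


section \<open>Graded modules\<close>

text \<open>
  The ring is graded by natural numbers, modules by integers; \<open>G d\<close> is the component of
  degree \<open>d\<close>.
\<close>

definition graded_module ::
  "('r, 'x) ring_scheme \<Rightarrow> (nat \<Rightarrow> 'r set) \<Rightarrow> ('r, 'm, 'y) module_scheme \<Rightarrow>
   (int \<Rightarrow> 'm set) \<Rightarrow> bool" where
  "graded_module R H M G \<longleftrightarrow>
     Module.module R M \<and>
     (\<forall>d. additive_subgroup (G d) M) \<and>
     (\<forall>x\<in>carrier M. \<exists>!c. (\<forall>d. c d \<in> G d) \<and> finite {d. c d \<noteq> \<zero>\<^bsub>M\<^esub>} \<and>
        x = finsum M c {d. c d \<noteq> \<zero>\<^bsub>M\<^esub>}) \<and>
     (\<forall>i j. \<forall>a\<in>H i. \<forall>x\<in>G j. a \<odot>\<^bsub>M\<^esub> x \<in> G (int i + j))"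

text \<open>
  Freeness is meant in the category of graded modules: there is a basis consisting of
  homogeneous elements, of arbitrary cardinality and in arbitrary degrees.
\<close>

definition graded_free ::
  "('r, 'x) ring_scheme \<Rightarrow> ('r, 'm, 'y) module_scheme \<Rightarrow> (int \<Rightarrow> 'm set) \<Rightarrow> bool" where
  "graded_free R M G \<longleftrightarrow>
     (\<exists>B \<subseteq> (\<Union>d. G d). \<forall>x\<in>carrier M. \<exists>!c. c \<in> B \<rightarrow>\<^sub>E carrier R \<and>
        finite {b \<in> B. c b \<noteq> \<zero>\<^bsub>R\<^esub>} \<and>
        x = finsum M (\<lambda>b. c b \<odot>\<^bsub>M\<^esub> b) {b \<in> B. c b \<noteq> \<zero>\<^bsub>R\<^esub>})"


section \<open>Sheaves of modules on a fan\<close>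

text \<open>
  \<open>res F \<Sigma> \<Sigma>'\<close> is the restriction map from \<open>\<Sigma>\<close> to \<open>\<Sigma>'\<close>, for \<open>\<Sigma>' \<subseteq> \<Sigma>\<close>. The
  ring structure fields \<^const>\<open>mult\<close> and \<^const>\<open>one\<close> of the module records are irrelevant, as are
  the values on sets of cones that are not subfans. Real scalars act on sections as constant
  functions.
\<close>

record ('a, 'm) fan_sheaf =
  sections :: "'a set set \<Rightarrow> ('a \<Rightarrow> real, 'm) module"
  degree_part :: "'a set set \<Rightarrow> int \<Rightarrow> 'm set"
  res :: "'a set set \<Rightarrow> 'a set set \<Rightarrow> 'm \<Rightarrow> 'm"

text \<open>
  In the gluing axiom, uniqueness is part of the sheaf condition. A sheaf on the empty fan is
  zero automatically, since \<open>conewise_ring {}\<close> is the zero ring and modules are unital.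
\<close>

definition conewise_module ::
  "'a::euclidean_space set set \<Rightarrow> ('a, 'm) fan_sheaf \<Rightarrow> bool" where
  "conewise_module \<Delta> F \<longleftrightarrow>
     (\<forall>\<Sigma>. subfan \<Sigma> \<Delta> \<longrightarrow>
        graded_module (conewise_ring \<Sigma>) (conewise_homogeneous \<Sigma>)
          (sections F \<Sigma>) (degree_part F \<Sigma>)) \<and>
     (\<forall>\<Sigma> \<Sigma>'. subfan \<Sigma> \<Delta> \<and> subfan \<Sigma>' \<Delta> \<and> \<Sigma>' \<subseteq> \<Sigma> \<longrightarrow>
        res F \<Sigma> \<Sigma>' \<in> carrier (sections F \<Sigma>) \<rightarrow> carrier (sections F \<Sigma>') \<and>
        (\<forall>s\<in>carrier (sections F \<Sigma>). \<forall>t\<in>carrier (sections F \<Sigma>).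
           res F \<Sigma> \<Sigma>' (s \<oplus>\<^bsub>sections F \<Sigma>\<^esub> t) =
             res F \<Sigma> \<Sigma>' s \<oplus>\<^bsub>sections F \<Sigma>'\<^esub> res F \<Sigma> \<Sigma>' t) \<and>
        (\<forall>a\<in>carrier (conewise_ring \<Sigma>). \<forall>s\<in>carrier (sections F \<Sigma>).
           res F \<Sigma> \<Sigma>' (a \<odot>\<^bsub>sections F \<Sigma>\<^esub> s) =
             restrict a (\<Union>\<Sigma>') \<odot>\<^bsub>sections F \<Sigma>'\<^esub> res F \<Sigma> \<Sigma>' s) \<and>
        (\<forall>d. res F \<Sigma> \<Sigma>' ` degree_part F \<Sigma> d \<subseteq> degree_part F \<Sigma>' d)) \<and>
     (\<forall>\<Sigma>. subfan \<Sigma> \<Delta> \<longrightarrow> (\<forall>s\<in>carrier (sections F \<Sigma>). res F \<Sigma> \<Sigma> s = s)) \<and>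
     (\<forall>\<Sigma> \<Sigma>' \<Sigma>''. subfan \<Sigma> \<Delta> \<and> subfan \<Sigma>' \<Delta> \<and> subfan \<Sigma>'' \<Delta> \<and> \<Sigma>'' \<subseteq> \<Sigma>' \<and> \<Sigma>' \<subseteq> \<Sigma> \<longrightarrow>
        (\<forall>s\<in>carrier (sections F \<Sigma>). res F \<Sigma>' \<Sigma>'' (res F \<Sigma> \<Sigma>' s) = res F \<Sigma> \<Sigma>'' s)) \<and>
     (\<forall>\<Sigma> \<Sigma>'. subfan \<Sigma> \<Delta> \<and> subfan \<Sigma>' \<Delta> \<longrightarrow>
        (\<forall>s\<in>carrier (sections F \<Sigma>). \<forall>s'\<in>carrier (sections F \<Sigma>').
           res F \<Sigma> (\<Sigma> \<inter> \<Sigma>') s = res F \<Sigma>' (\<Sigma> \<inter> \<Sigma>') s' \<longrightarrow>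
           (\<exists>!t. t \<in> carrier (sections F (\<Sigma> \<union> \<Sigma>')) \<and>
                 res F (\<Sigma> \<union> \<Sigma>') \<Sigma> t = s \<and> res F (\<Sigma> \<union> \<Sigma>') \<Sigma>' t = s')))"

text \<open>The stalk at \<open>\<tau>\<close> is the module of sections over the fan \<open>cone_faces \<tau>\<close>.\<close>

definition locally_free :: "'a::euclidean_space set set \<Rightarrow> ('a, 'm) fan_sheaf \<Rightarrow> bool" where
  "locally_free \<Delta> F \<longleftrightarrow>
     (\<forall>\<tau>\<in>\<Delta>. graded_free (conewise_ring (cone_faces \<tau>)) (sections F (cone_faces \<tau>))
                (degree_part F (cone_faces \<tau>)))"

definition flabby :: "'a::euclidean_space set set \<Rightarrow> ('a, 'm) fan_sheaf \<Rightarrow> bool" where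
  "flabby \<Delta> F \<longleftrightarrow>
     (\<forall>\<Sigma>. subfan \<Sigma> \<Delta> \<longrightarrow>
        res F \<Delta> \<Sigma> ` carrier (sections F \<Delta>) = carrier (sections F \<Sigma>))"

definition pure_module :: "'a::euclidean_space set set \<Rightarrow> ('a, 'm) fan_sheaf \<Rightarrow> bool" where
  "pure_module \<Delta> F \<longleftrightarrow> conewise_module \<Delta> F \<and> locally_free \<Delta> F \<and> flabby \<Delta> F"

definition relative_sections ::
  "('a, 'm) fan_sheaf \<Rightarrow> 'a set set \<Rightarrow> 'a set set \<Rightarrow> 'm set" where
  "relative_sections F \<Sigma>' \<Sigma> =
     {s \<in> carrier (sections F \<Sigma>'). res F \<Sigma>' \<Sigma> s = \<zero>\<^bsub>sections F \<Sigma>\<^esub>}"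


section \<open>Localization in a direction\<close>

definition back_faces :: "'a::euclidean_space set \<Rightarrow> 'a \<Rightarrow> 'a set set" where
  "back_faces \<sigma> v =
     {\<tau> \<in> cone_faces \<sigma>. \<forall>x\<in>rel_interior \<tau>. \<exists>\<epsilon>>0. {0..<\<epsilon>} \<subseteq> {t. x + t *\<^sub>R v \<in> \<sigma>}}"

definition front_faces :: "'a::euclidean_space set \<Rightarrow> 'a \<Rightarrow> 'a set set" where
  "front_faces \<sigma> v = back_faces \<sigma> (- v)"

text \<open>The front faces outside \<open>\<Delta>\<^sub>0\<close>, the set of faces that are both back and front.\<close>

definition strict_front_faces :: "'a::euclidean_space set \<Rightarrow> 'a \<Rightarrow> 'a set set" where
  "strict_front_faces \<sigma> v = front_faces \<sigma> v - (back_faces \<sigma> v \<inter> front_faces \<sigma> v)"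

definition front_part :: "'a::euclidean_space set \<Rightarrow> 'a \<Rightarrow> 'a set set \<Rightarrow> 'a set set" where
  "front_part \<sigma> v \<Sigma> = face_closure (\<Sigma> \<inter> front_faces \<sigma> v)"

definition strict_front_part ::
  "'a::euclidean_space set \<Rightarrow> 'a \<Rightarrow> 'a set set \<Rightarrow> 'a set set" where
  "strict_front_part \<sigma> v \<Sigma> = face_closure (\<Sigma> \<inter> strict_front_faces \<sigma> v)"

text \<open>
  Functions on \<open>\<Sigma>\<close> act through their restriction to \<open>front_part \<sigma> v \<Sigma>\<close>, which is contained
  in \<open>\<Sigma>\<close> whenever \<open>\<Sigma>\<close> is a subfan.
\<close>

definition v_localization ::
  "'a::euclidean_space set \<Rightarrow> 'a \<Rightarrow> ('a, 'm) fan_sheaf \<Rightarrow> ('a, 'm) fan_sheaf" where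
  "v_localization \<sigma> v F =
     \<lparr>sections = (\<lambda>\<Sigma>. (sections F (front_part \<sigma> v \<Sigma>))
        \<lparr>carrier := relative_sections F (front_part \<sigma> v \<Sigma>) (strict_front_part \<sigma> v \<Sigma>),
         smult := (\<lambda>a s. restrict a (\<Union>(front_part \<sigma> v \<Sigma>))
                           \<odot>\<^bsub>sections F (front_part \<sigma> v \<Sigma>)\<^esub> s)\<rparr>),
      degree_part = (\<lambda>\<Sigma> d. degree_part F (front_part \<sigma> v \<Sigma>) d \<inter>
         relative_sections F (front_part \<sigma> v \<Sigma>) (strict_front_part \<sigma> v \<Sigma>)),
      res = (\<lambda>\<Sigma> \<Sigma>'. res F (front_part \<sigma> v \<Sigma>) (front_part \<sigma> v \<Sigma>'))\<rparr>"

end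

theory Submission
  imports Defs "HOL-Library.Function_Algebras"
begin

text \<open>
  The combinatorial part rests on one fact: \<open>[\<Sigma>\<^sub>+]\<close> consists of the cones of
  \<open>[\<Sigma>\<^sub>\<ge>\<^sub>0]\<close> that are not back faces. So \<open>F\<^sup>v(\<Sigma>)\<close> is the space of sections
  of \<open>F\<close> on \<open>[\<Sigma>\<^sub>\<ge>\<^sub>0]\<close> vanishing on all non-back faces. Gluing and flabbiness follow,
  since a section that vanishes there can be glued with zero.

  The stalk of \<open>F\<^sup>v\<close> at \<open>\<tau>\<close> is zero unless \<open>v\<close> lies in the span of \<open>\<tau>\<close>. In that case
  its freeness is proved by induction on the dimension. Move a generic interior point \<open>p\<close>
  of the cone in direction \<open>v\<close> and order the facets \<open>\<rho>\<^sub>1, \<rho>\<^sub>2, \<dots>\<close> that are not back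
  faces by the time at which their hyperplanes are crossed. If \<open>q\<^sub>i\<close> is the crossing point for \<open>\<rho>\<^sub>i\<close>,
  then \<open>\<rho>\<^sub>i\<close> meets the earlier facets exactly in the faces of \<open>\<rho>\<^sub>i\<close> that are not back faces for
  the direction \<open>q\<^sub>i\<close>. Hence the sections vanishing on the first \<open>i\<close> facets form the kernel of a
  surjection from those vanishing on the first \<open>i - 1\<close> facets onto a module that is free over the
  polynomial ring modulo one linear form. Such a kernel is graded projective, and therefore
  free. As ranks may be infinite and degrees unbounded in both directions, the last step needs
  a graded version of Kaplansky's theorem.
\<close>

section \<open>Graded projective modules over connected graded rings\<close>

text \<open>Why crossing points serve as directions: a face is a back face for a direction
  \<open>w\<close> exactly when every normal of a facet containing it is nonnegative on
  \<open>w\<close>. The crossing point of \<rho> lies on the hyperplane of \<rho>, hence in its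
  span, and the normals negative at it are those of the hyperplanes already crossed. So the earlier
  facets meet \<rho> in its non-back faces for a new direction, unrelated to \<open>v\<close>; this
  is why the induction runs over all cones, full-dimensional or not, and all directions in their
  spans. Surjectivity onto the sections over \<rho> is flabbiness.

  Why the kernel is projective: the target is free over the quotient of the polynomial ring by a
  linear form \<open>l\<close>, so its kernel of relations is again free, generated by the multiples
  of \<open>l\<close>. Comparing two presentations makes the kernel a direct summand of a free
  module.

  Why projective implies free needs work: with degrees bounded below one would lift a basis modulo
  the irrelevant ideal by Nakayama's lemma. Here only two facts are available, that elements of
  negative degree vanish and that nonzero elements of degree 0 are invertible. They suffice to
  enlarge finite free summands one generator at a time.\<close>

text \<open>
  The unit \<open>u\<close> need not be a unit of the type: below, functions on a cone are extended by zero,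
  and then \<open>u\<close> is an indicator function.
\<close>

locale connected_graded_ring =
  fixes R :: "'r::comm_ring set" and A :: "int \<Rightarrow> 'r set" and u :: 'r
  assumes A_R: "a \<in> A d \<Longrightarrow> a \<in> R"
    and R_add: "a \<in> R \<Longrightarrow> b \<in> R \<Longrightarrow> a + b \<in> R"
    and R_mult: "a \<in> R \<Longrightarrow> b \<in> R \<Longrightarrow> a * b \<in> R"
    and A_0: "0 \<in> A d"
    and A_add: "a \<in> A d \<Longrightarrow> b \<in> A d \<Longrightarrow> a + b \<in> A d"
    and A_mult: "a \<in> A d \<Longrightarrow> b \<in> A e \<Longrightarrow> a * b \<in> A (d + e)"
    and A_minus: "a \<in> A d \<Longrightarrow> - a \<in> A d"
    and u_A: "u \<in> A 0"
    and u_neutral: "a \<in> R \<Longrightarrow> u * a = a"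
    and u_nz: "u \<noteq> 0"
    and A_neg: "d < 0 \<Longrightarrow> a \<in> A d \<Longrightarrow> a = 0"
    and A_unit: "a \<in> A 0 \<Longrightarrow> a \<noteq> 0 \<Longrightarrow> \<exists>b\<in>A 0. b * a = u"
begin

lemma R_0: "0 \<in> R" using A_0 A_R by blast
lemma u_R: "u \<in> R" using u_A A_R by blast
lemma R_minus: "a \<in> R \<Longrightarrow> - a \<in> R"
  using R_mult[OF A_R[OF A_minus[OF u_A]], of a] u_neutral[of a] by (metis mult_minus_left)
lemma R_diff: "a \<in> R \<Longrightarrow> b \<in> R \<Longrightarrow> a - b \<in> R"
  using R_add[of a "- b"] R_minus by simp
lemma A_diff: "a \<in> A d \<Longrightarrow> b \<in> A d \<Longrightarrow> a - b \<in> A d"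
  using A_add[of a d "- b"] A_minus by simp
lemma R_sum: "(\<And>i. i \<in> T \<Longrightarrow> f i \<in> R) \<Longrightarrow> sum f T \<in> R"
  by (induct T rule: infinite_finite_induct) (auto simp: R_0 R_add)
lemma A_sum: "(\<And>i. i \<in> T \<Longrightarrow> f i \<in> A d) \<Longrightarrow> sum f T \<in> A d"
  by (induct T rule: infinite_finite_induct) (auto simp: A_0 A_add)

end

section \<open>Graded modules and their homogeneous functionals\<close>

locale connected_graded_module = connected_graded_ring R A u
  for R :: "'r::comm_ring set" and A u +
  fixes s :: "'r \<Rightarrow> 'b::ab_group_add \<Rightarrow> 'b" and G :: "int \<Rightarrow> 'b set"
  assumes s_add: "s a (x + y) = s a x + s a y"
    and s_add_left: "s (a + b) x = s a x + s b x"
    and s_mult: "s (a * b) x = s a (s b x)"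
    and G_0: "0 \<in> G d"
    and G_add: "x \<in> G d \<Longrightarrow> y \<in> G d \<Longrightarrow> x + y \<in> G d"
    and G_minus: "x \<in> G d \<Longrightarrow> - x \<in> G d"
    and G_s: "a \<in> A d \<Longrightarrow> x \<in> G e \<Longrightarrow> s a x \<in> G (d + e)"
begin

lemma s_0 [simp]: "s 0 x = 0" "s a 0 = 0"
  using s_add_left[of 0 0 x] s_add[of a 0 0] by simp_all
lemma s_minus: "s (- a) x = - s a x" "s a (- x) = - s a x"
  using s_add_left[of a "- a" x] s_add[of a x "- x"] by (simp_all add: eq_neg_iff_add_eq_0 add.commute)
lemma s_diff: "s (a - b) x = s a x - s b x" "s a (x - y) = s a x - s a y"
  using s_add_left[of a "- b" x] s_add[of a x "- y"] by (simp_all add: s_minus)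
lemma s_sum: "s a (sum f T) = (\<Sum>i\<in>T. s a (f i))"
  by (induct T rule: infinite_finite_induct) (auto simp: s_add)
lemma s_sum_left: "s (sum f T) x = (\<Sum>i\<in>T. s (f i) x)"
  by (induct T rule: infinite_finite_induct) (auto simp: s_add_left)
lemma G_diff: "x \<in> G d \<Longrightarrow> y \<in> G d \<Longrightarrow> x - y \<in> G d"
  using G_add[of x d "- y"] G_minus by simp
lemma G_sum: "(\<And>i. i \<in> T \<Longrightarrow> f i \<in> G d) \<Longrightarrow> sum f T \<in> G d"
  by (induct T rule: infinite_finite_induct) (auto simp: G_0 G_add)

text \<open>The unit law belongs here because \<open>s u\<close> need not be the identity on the
  ambient type: on vectors of functions it multiplies by an indicator function.\<close>

definition submod :: "'b set \<Rightarrow> bool" where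
  "submod P \<longleftrightarrow> 0 \<in> P \<and> (\<forall>x\<in>P. \<forall>y\<in>P. x + y \<in> P) \<and> (\<forall>a\<in>R. \<forall>x\<in>P. s a x \<in> P) \<and> (\<forall>x\<in>P. s u x = x)"

lemma submodD:
  assumes "submod P"
  shows "0 \<in> P" "x \<in> P \<Longrightarrow> y \<in> P \<Longrightarrow> x + y \<in> P" "a \<in> R \<Longrightarrow> x \<in> P \<Longrightarrow> s a x \<in> P" "x \<in> P \<Longrightarrow> s u x = x"
  using assms unfolding submod_def by auto

lemma submod_minus: "submod P \<Longrightarrow> x \<in> P \<Longrightarrow> - x \<in> P"
  using submodD(3)[of P "- u" x] submodD(4)[of P x] R_minus[OF u_R] by (simp add: s_minus)
lemma submod_diff: "submod P \<Longrightarrow> x \<in> P \<Longrightarrow> y \<in> P \<Longrightarrow> x - y \<in> P"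
  using submodD(2)[of P x "- y"] submod_minus[of P y] by simp
lemma submod_sum: "submod P \<Longrightarrow> (\<And>i. i \<in> T \<Longrightarrow> f i \<in> P) \<Longrightarrow> sum f T \<in> P"
  by (induct T rule: infinite_finite_induct) (auto simp: submodD)

text \<open>The part of degree \<open>-e\<close> of the graded dual, indexed so that the functional
  dual to a basis element of degree \<open>e\<close> lies in \<open>Fun P e\<close>.\<close>

definition Fun :: "'b set \<Rightarrow> int \<Rightarrow> ('b \<Rightarrow> 'r) set" where
  "Fun P e = {f. (\<forall>x\<in>P. f x \<in> R) \<and> (\<forall>x\<in>P. \<forall>y\<in>P. f (x + y) = f x + f y) \<and>
     (\<forall>a\<in>R. \<forall>x\<in>P. f (s a x) = a * f x) \<and> (\<forall>d. \<forall>x\<in>P \<inter> G d. f x \<in> A (d - e))}"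

lemma FunD:
  assumes "f \<in> Fun P e"
  shows "x \<in> P \<Longrightarrow> f x \<in> R" "x \<in> P \<Longrightarrow> y \<in> P \<Longrightarrow> f (x + y) = f x + f y"
    "a \<in> R \<Longrightarrow> x \<in> P \<Longrightarrow> f (s a x) = a * f x" "x \<in> P \<Longrightarrow> x \<in> G d \<Longrightarrow> f x \<in> A (d - e)"
  using assms unfolding Fun_def by auto

lemma Fun_0: "submod P \<Longrightarrow> f \<in> Fun P e \<Longrightarrow> f 0 = 0"
  using FunD(2)[of f P e 0 0] submodD(1)[of P] by simp

lemma Fun_diff: "submod P \<Longrightarrow> f \<in> Fun P e \<Longrightarrow> x \<in> P \<Longrightarrow> y \<in> P \<Longrightarrow> f (x - y) = f x - f y"
  using FunD(2)[of f P e "x - y" y] submod_diff[of P x y] by simp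

lemma Fun_sum: "submod P \<Longrightarrow> f \<in> Fun P e \<Longrightarrow> (\<And>i. i \<in> T \<Longrightarrow> g i \<in> P) \<Longrightarrow> f (sum g T) = (\<Sum>i\<in>T. f (g i))"
proof (induct T rule: infinite_finite_induct)
  case (insert i T)
  then show ?case using FunD(2)[of f P e "g i" "sum g T"] submod_sum[of P T g] by simp
qed (auto simp: Fun_0)

lemma Fun_mono: "P' \<subseteq> P \<Longrightarrow> Fun P e \<subseteq> Fun P' e"
  unfolding Fun_def by blast

text \<open>Both the elementary change of a frame and the Gram-Schmidt step have this form; the
  degree of \<open>b i\<close> compensates the difference between the degrees of \<open>g i\<close>
  and \<open>f\<close>.\<close>

lemma Fun_lincomb:
  assumes f: "f \<in> Fun P e" and g: "\<And>i. i \<in> T \<Longrightarrow> g i \<in> Fun P (d i) \<and> b i \<in> A (d i - e)"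
  shows "(\<lambda>x. f x - (\<Sum>i\<in>T. b i * g i x)) \<in> Fun P e"
  unfolding Fun_def
proof (intro CollectI conjI ballI allI)
  fix x assume x: "x \<in> P"
  show "f x - (\<Sum>i\<in>T. b i * g i x) \<in> R"
    by (intro R_diff R_sum R_mult) (use x f g FunD(1) A_R in blast)+
  fix y assume y: "y \<in> P"
  have "b i * g i (x + y) = b i * g i x + b i * g i y" if "i \<in> T" for i
    using FunD(2)[of "g i" P "d i" x y] g[OF that] x y by (simp add: distrib_left)
  then have "(\<Sum>i\<in>T. b i * g i (x + y)) = (\<Sum>i\<in>T. b i * g i x) + (\<Sum>i\<in>T. b i * g i y)"
    by (simp add: sum.distrib)
  then show "f (x + y) - (\<Sum>i\<in>T. b i * g i (x + y)) = f x - (\<Sum>i\<in>T. b i * g i x) + (f y - (\<Sum>i\<in>T. b i * g i y))"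
    using FunD(2)[OF f x y] by simp
next
  fix a x assume a: "a \<in> R" and x: "x \<in> P"
  have "(\<Sum>i\<in>T. b i * g i (s a x)) = (\<Sum>i\<in>T. a * (b i * g i x))"
    by (intro sum.cong refl) (metis g FunD(3) a x mult.left_commute)
  then show "f (s a x) - (\<Sum>i\<in>T. b i * g i (s a x)) = a * (f x - (\<Sum>i\<in>T. b i * g i x))"
    using FunD(3)[OF f a x] by (simp add: right_diff_distrib sum_distrib_left)
next
  fix \<delta> x assume x: "x \<in> P \<inter> G \<delta>"
  show "f x - (\<Sum>i\<in>T. b i * g i x) \<in> A (\<delta> - e)"
  proof (intro A_diff A_sum)
    show "f x \<in> A (\<delta> - e)" using FunD(4)[OF f] x by blast
    fix i assume "i \<in> T"
    then have "b i * g i x \<in> A ((d i - e) + (\<delta> - d i))"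
      using A_mult g FunD(4) x by blast
    then show "b i * g i x \<in> A (\<delta> - e)" by simp
  qed
qed

text \<open>A frame is a homogeneous dual basis, so its existence says that \<open>P\<close> is graded projective.\<close>

definition frame :: "'b set \<Rightarrow> 'i set \<Rightarrow> ('i \<Rightarrow> int) \<Rightarrow> ('i \<Rightarrow> 'b) \<Rightarrow> ('i \<Rightarrow> 'b \<Rightarrow> 'r) \<Rightarrow> bool" where
  "frame P I d x f \<longleftrightarrow> submod P \<and> (\<forall>i\<in>I. x i \<in> P \<and> x i \<in> G (d i) \<and> f i \<in> Fun P (d i)) \<and>
     (\<forall>p\<in>P. finite {i\<in>I. f i p \<noteq> 0} \<and> p = (\<Sum>i\<in>{i\<in>I. f i p \<noteq> 0}. s (f i p) (x i)))"

lemma frameD: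
  assumes "frame P I d x f"
  shows "submod P" "i \<in> I \<Longrightarrow> x i \<in> P" "i \<in> I \<Longrightarrow> x i \<in> G (d i)" "i \<in> I \<Longrightarrow> f i \<in> Fun P (d i)"
    "p \<in> P \<Longrightarrow> finite {i\<in>I. f i p \<noteq> 0}"
  using assms unfolding frame_def by auto

lemma frame_sum:
  assumes "frame P I d x f" "p \<in> P" "finite T" "{i\<in>I. f i p \<noteq> 0} \<subseteq> T" "T \<subseteq> I"
  shows "p = (\<Sum>i\<in>T. s (f i p) (x i))"
proof -
  have "p = (\<Sum>i\<in>{i\<in>I. f i p \<noteq> 0}. s (f i p) (x i))" using assms unfolding frame_def by blast
  also have "\<dots> = (\<Sum>i\<in>T. s (f i p) (x i))"
    by (rule sum.mono_neutral_left) (use assms in auto)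
  finally show ?thesis .
qed

section \<open>Homogeneous bases, and bases from countable frames\<close>

definition spn :: "'b set \<Rightarrow> 'b set" where
  "spn U = {p. \<exists>T c. finite T \<and> T \<subseteq> U \<and> (\<forall>b\<in>T. c b \<in> R) \<and> p = (\<Sum>b\<in>T. s (c b) b)}"

definition indep :: "'b set \<Rightarrow> bool" where
  "indep U \<longleftrightarrow> (\<forall>T c. finite T \<longrightarrow> T \<subseteq> U \<longrightarrow> (\<forall>b\<in>T. c b \<in> R) \<longrightarrow> (\<Sum>b\<in>T. s (c b) b) = 0 \<longrightarrow> (\<forall>b\<in>T. c b = 0))"

definition basis :: "'b set \<Rightarrow> 'b set \<Rightarrow> bool" where
  "basis U P \<longleftrightarrow> U \<subseteq> P \<and> (\<forall>b\<in>U. \<exists>e. b \<in> G e) \<and> P \<subseteq> spn U \<and> indep U"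

lemma spnI: "finite T \<Longrightarrow> T \<subseteq> U \<Longrightarrow> (\<And>b. b \<in> T \<Longrightarrow> c b \<in> R) \<Longrightarrow> (\<Sum>b\<in>T. s (c b) b) \<in> spn U"
  unfolding spn_def by blast

lemma spn_mono: "U \<subseteq> U' \<Longrightarrow> spn U \<subseteq> spn U'"
  unfolding spn_def by blast

lemma spn_0: "0 \<in> spn U"
  using spnI[of "{}" U] by simp

lemma spn_add:
  assumes "p \<in> spn U" "q \<in> spn U"
  shows "p + q \<in> spn U"
proof -
  obtain T c where 1: "finite T" "T \<subseteq> U" "\<forall>b\<in>T. c b \<in> R" "p = (\<Sum>b\<in>T. s (c b) b)"
    using assms(1) unfolding spn_def by blast
  obtain T' c' where 2: "finite T'" "T' \<subseteq> U" "\<forall>b\<in>T'. c' b \<in> R" "q = (\<Sum>b\<in>T'. s (c' b) b)"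
    using assms(2) unfolding spn_def by blast
  let ?c = "\<lambda>b. if b \<in> T then c b else 0" and ?c' = "\<lambda>b. if b \<in> T' then c' b else 0"
  have "p = (\<Sum>b\<in>T \<union> T'. s (?c b) b)" unfolding 1(4)
    by (rule sum.mono_neutral_cong_left) (use 1 2 in auto)
  moreover have "q = (\<Sum>b\<in>T \<union> T'. s (?c' b) b)" unfolding 2(4)
    by (rule sum.mono_neutral_cong_left) (use 1 2 in auto)
  ultimately have "p + q = (\<Sum>b\<in>T \<union> T'. s (?c b + ?c' b) b)"
    by (simp only: s_add_left sum.distrib)
  also have "\<dots> \<in> spn U"
    by (rule spnI) (use 1 2 R_0 in \<open>auto intro!: R_add\<close>)
  finally show ?thesis .
qed

lemma spn_s: assumes "p \<in> spn U" "a \<in> R" shows "s a p \<in> spn U"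
proof -
  obtain T c where 1: "finite T" "T \<subseteq> U" "\<forall>b\<in>T. c b \<in> R" "p = (\<Sum>b\<in>T. s (c b) b)"
    using assms(1) unfolding spn_def by blast
  have "s a p = (\<Sum>b\<in>T. s (a * c b) b)" unfolding 1(4) by (simp add: s_sum s_mult)
  then show ?thesis using spnI[of T U "\<lambda>b. a * c b"] 1 R_mult[OF assms(2)] by simp
qed

lemma spn_sum: "(\<And>i. i \<in> T \<Longrightarrow> f i \<in> spn U) \<Longrightarrow> sum f T \<in> spn U"
  by (induct T rule: infinite_finite_induct) (auto simp: spn_0 spn_add)

lemma spn_base: "submod P \<Longrightarrow> b \<in> P \<Longrightarrow> b \<in> U \<Longrightarrow> b \<in> spn U"
  using spnI[of "{b}" U "\<lambda>_. u"] u_R submodD(4)[of P b] by simp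

text \<open>Subtracting the relation from \<open>f k\<close> kills the \<open>k\<close>-th
  coordinate of \<open>p\<close>. Adding \<open>b l\<close> times \<open>x k\<close> to each
  \<open>x l\<close> compensates for this, so every expansion keeps its value.\<close>

lemma frame_change:
  fixes b :: "'i \<Rightarrow> 'r"
  assumes fr: "frame P I d x f" and p: "p \<in> P"
    and S: "S = {i\<in>I. f i p \<noteq> 0}" and k: "k \<in> S"
    and b: "\<And>l. l \<in> S - {k} \<Longrightarrow> b l \<in> A (d l - d k)"
    and eq: "f k p = (\<Sum>l\<in>S - {k}. b l * f l p)"
  obtains x' f' where "frame P I d x' f'" "{i\<in>I. f' i p \<noteq> 0} \<subset> S"
proof -
  let ?x = "\<lambda>l. if l \<in> S - {k} then x l + s (b l) (x k) else x l"
  let ?f = "f(k := (\<lambda>z. f k z - (\<Sum>l\<in>S - {k}. b l * f l z)))"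
  have SI: "S \<subseteq> I" and kI: "k \<in> I" using S k by auto
  have finS: "finite S" using frameD(5)[OF fr p] S by simp
  have f: "i \<in> I \<Longrightarrow> f i \<in> Fun P (d i)" for i using frameD(4)[OF fr] .
  have f': "?f i \<in> Fun P (d i)" if "i \<in> I" for i
    using that Fun_lincomb[OF f[OF kI], of "S - {k}" f d b] f b SI by auto
  have x': "?x i \<in> P \<and> ?x i \<in> G (d i)" if "i \<in> I" for i
  proof (cases "i \<in> S - {k}")
    case True
    have "s (b i) (x k) \<in> G ((d i - d k) + d k)" using G_s[OF b[OF True] frameD(3)[OF fr kI]] .
    moreover have "s (b i) (x k) \<in> P" using submodD(3)[OF frameD(1)[OF fr] A_R[OF b[OF True]] frameD(2)[OF fr kI]] .
    ultimately show ?thesis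
      using True frameD[OF fr] submodD(2)[OF frameD(1)[OF fr]] that G_add by simp
  next
    case False then show ?thesis using frameD(2,3)[OF fr that] by (simp only: if_False simp_thms)
  qed
  have "finite {i\<in>I. ?f i z \<noteq> 0} \<and> z = (\<Sum>i\<in>{i\<in>I. ?f i z \<noteq> 0}. s (?f i z) (?x i))" if z: "z \<in> P" for z
  proof -
    \<comment> \<open>The new \<open>k\<close>-th functional may be nonzero at \<open>z\<close>
      where the old one vanishes, so the two expansions are compared on the old support enlarged by
      \<open>S\<close>.\<close>
    let ?T = "{i\<in>I. f i z \<noteq> 0} \<union> S"
    have finT: "finite ?T" using frameD(5)[OF fr z] finS by simp
    have sub: "{i\<in>I. ?f i z \<noteq> 0} \<subseteq> ?T" using k by auto
    have split: "(\<Sum>i\<in>?T. h i) = h k + (\<Sum>i\<in>?T - {k}. h i)" for h :: "'i \<Rightarrow> 'b"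
      using sum.remove[OF finT, of k h] k by blast
    have "(\<Sum>i\<in>?T - {k}. s (?f i z) (?x i)) = (\<Sum>i\<in>?T - {k}. s (f i z) (x i)) + (\<Sum>i\<in>?T - {k}. if i \<in> S - {k} then s (f i z) (s (b i) (x k)) else 0)"
      unfolding sum.distrib[symmetric] by (rule sum.cong) (auto simp: s_add)
    also have "(\<Sum>i\<in>?T - {k}. if i \<in> S - {k} then s (f i z) (s (b i) (x k)) else 0) = (\<Sum>i\<in>S - {k}. s (f i z) (s (b i) (x k)))"
      by (rule sum.mono_neutral_cong_right) (use finT in auto)
    also have "\<dots> = s (\<Sum>i\<in>S - {k}. b i * f i z) (x k)"
      by (simp add: s_sum_left s_mult[symmetric] mult.commute)
    finally have "(\<Sum>i\<in>?T. s (?f i z) (?x i)) = (\<Sum>i\<in>?T. s (f i z) (x i))"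
      unfolding split by (simp add: s_diff)
    moreover have "(\<Sum>i\<in>?T. s (?f i z) (?x i)) = (\<Sum>i\<in>{i\<in>I. ?f i z \<noteq> 0}. s (?f i z) (?x i))"
      by (rule sum.mono_neutral_right) (use finT SI sub in auto)
    moreover have "z = (\<Sum>i\<in>?T. s (f i z) (x i))"
      by (rule frame_sum[OF fr z finT]) (use SI in auto)
    ultimately show ?thesis using finite_subset[OF sub finT] by simp
  qed
  then have "frame P I d ?x ?f" unfolding frame_def using frameD(1)[OF fr] x' f' by blast
  moreover have "{i\<in>I. ?f i p \<noteq> 0} \<subseteq> S - {k}"
  proof
    fix i assume i: "i \<in> {i\<in>I. ?f i p \<noteq> 0}"
    then have "i \<noteq> k" using eq by auto
    with i show "i \<in> S - {k}" unfolding S by simp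
  qed
  then have "{i\<in>I. ?f i p \<noteq> 0} \<subset> S" using k by blast
  ultimately show ?thesis using that by blast
qed

text \<open>Gram-Schmidt, taking the indices in order of decreasing degree. Functionals treated
  earlier have degree at least that of the new index \<open>m\<close>, so all the old
  \<open>f i\<close> vanish at \<open>x m\<close>. The last clause of the conclusion strengthens the
  induction: it passes this vanishing on to the corrected \<open>g i\<close>.\<close>

lemma biorthogonal_of_unitriangular:
  assumes "finite S" and P: "submod P"
    and "\<And>i. i \<in> S \<Longrightarrow> x i \<in> P \<and> x i \<in> G (d i) \<and> f i \<in> Fun P (d i) \<and> f i (x i) = u"
    and "\<And>i j. i \<in> S \<Longrightarrow> j \<in> S \<Longrightarrow> i \<noteq> j \<Longrightarrow> d i \<le> d j \<Longrightarrow> f j (x i) = 0"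
  shows "\<exists>g. (\<forall>i\<in>S. g i \<in> Fun P (d i) \<and> (\<forall>j\<in>S. g i (x j) = (if i = j then u else 0))) \<and>
    (\<forall>z\<in>P. (\<forall>i\<in>S. f i z = 0) \<longrightarrow> (\<forall>i\<in>S. g i z = 0))"
  using assms(1,3,4)
proof (induct S rule: finite_ranking_induct[where f = "\<lambda>i. - d i"])
  case (insert m S)
  show ?case
  proof (cases "m \<in> S")
    case True then show ?thesis using insert by (simp add: insert_absorb)
  next
    case m: False
    obtain g where g: "\<And>i. i \<in> S \<Longrightarrow> g i \<in> Fun P (d i)" "\<And>i j. i \<in> S \<Longrightarrow> j \<in> S \<Longrightarrow> g i (x j) = (if i = j then u else 0)"
      "\<And>z. z \<in> P \<Longrightarrow> (\<forall>i\<in>S. f i z = 0) \<Longrightarrow> (\<forall>i\<in>S. g i z = 0)"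
    proof -
      have "\<exists>g. (\<forall>i\<in>S. g i \<in> Fun P (d i) \<and> (\<forall>j\<in>S. g i (x j) = (if i = j then u else 0))) \<and>
        (\<forall>z\<in>P. (\<forall>i\<in>S. f i z = 0) \<longrightarrow> (\<forall>i\<in>S. g i z = 0))"
        by (rule insert(3)) (use insert(4,5) in auto)
      then show ?thesis using that by blast
    qed
    have xm: "x m \<in> P" "x m \<in> G (d m)" "f m \<in> Fun P (d m)" "f m (x m) = u" using insert(4)[of m] by auto
    have gm: "g i (x m) = 0" if "i \<in> S" for i
      using g(3)[OF xm(1)] insert(5)[of m] insert(2) m that by (metis insertCI neg_le_iff_le)
    let ?g = "\<lambda>z. f m z - (\<Sum>j\<in>S. f m (x j) * g j z)"
    have "?g \<in> Fun P (d m)"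
      by (rule Fun_lincomb[OF xm(3), where d = d]) (use g insert(4) FunD(4)[OF xm(3)] in blast)
    moreover have "?g (x m) = u" using gm xm by simp
    moreover have "?g (x j) = 0" if j: "j \<in> S" for j
    proof -
      have "(\<Sum>i\<in>S. f m (x i) * g i (x j)) = (\<Sum>i\<in>{j}. f m (x i) * g i (x j))"
        by (rule sum.mono_neutral_right) (use insert(1) j g(2) in auto)
      also have "\<dots> = f m (x j)"
        using g(2)[OF j j] u_neutral[of "f m (x j)"] FunD(1)[OF xm(3)] insert(4)[of j] j by (simp add: mult.commute)
      finally show ?thesis by simp
    qed
    moreover have "?g z = 0" if "z \<in> P" "\<forall>i\<in>insert m S. f i z = 0" for z
      using g(3)[OF that(1)] that(2) by simp
    ultimately show ?thesis
      using g gm m by (intro exI[of _ "g(m := ?g)"]) auto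
  qed
qed simp

text \<open>As the dual functionals are defined on all of \<open>P\<close>, this says that
  \<open>Y\<close> is a homogeneous basis of a finitely generated free direct summand of
  \<open>P\<close>.\<close>

definition good :: "'b set \<Rightarrow> 'b set \<Rightarrow> bool" where
  "good P Y \<longleftrightarrow> finite Y \<and> Y \<subseteq> P \<and> (\<exists>g. \<forall>y\<in>Y. (\<exists>e. y \<in> G e \<and> g y \<in> Fun P e) \<and>
     (\<forall>y'\<in>Y. g y y' = (if y = y' then u else 0)))"

text \<open>
  Among all frames obtained by elementary changes take one in which \<open>p\<close> has the fewest nonzero
  coordinates. None of these coordinates is then a combination of the others, which makes the
  matrix \<open>f\<^sub>j(x\<^sub>i)\<close> on the support of \<open>p\<close> unitriangular with respect to the degree.
\<close>

lemma finite_step: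
  assumes "frame P I d x f" "p \<in> P"
  shows "\<exists>Y. good P Y \<and> p \<in> spn Y"
  using assms(1)
proof (induct "card {i\<in>I. f i p \<noteq> 0}" arbitrary: x f rule: less_induct)
  case (less f x)
  note fr = less(2)
  define S where "S = {i\<in>I. f i p \<noteq> 0}"
  have SI: "S \<subseteq> I" and finS: "finite S" unfolding S_def using frameD(5)[OF fr assms(2)] by auto
  define c where "c i j = f j (x i)" for i j
  have P: "submod P" using frameD(1)[OF fr] .
  have c: "c i j \<in> A (d i - d j)" if "i \<in> S" "j \<in> S" for i j
    unfolding c_def by (intro FunD(4)[OF frameD(4)[OF fr]] frameD(2,3)[OF fr] subsetD[OF SI] that)
  have fp: "f i p \<in> R" if "i \<in> S" for i using FunD(1)[OF frameD(4)[OF fr] assms(2)] that SI by blast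
  have rel: "f j p = (\<Sum>i\<in>S. f i p * c i j)" if j: "j \<in> S" for j
  proof -
    have "p = (\<Sum>i\<in>S. s (f i p) (x i))"
      by (rule frame_sum[OF fr assms(2) finS _ SI]) (simp add: S_def)
    then have "f j p = f j (\<Sum>i\<in>S. s (f i p) (x i))" by simp
    also have "\<dots> = (\<Sum>i\<in>S. f j (s (f i p) (x i)))"
      by (rule Fun_sum[OF P frameD(4)[OF fr]]) (use j SI submodD(3)[OF P] frameD(2)[OF fr] fp in auto)
    also have "\<dots> = (\<Sum>i\<in>S. f i p * c i j)"
      unfolding c_def by (intro sum.cong refl FunD(3)[OF frameD(4)[OF fr]]) (use j SI frameD(2)[OF fr] fp in auto)
    finally show ?thesis .
  qed
  have no_rel: False if k: "k \<in> S" and b: "\<And>l. l \<in> S - {k} \<Longrightarrow> b l \<in> A (d l - d k)" and eq: "f k p = (\<Sum>l\<in>S - {k}. b l * f l p)"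
    and nogood: "\<nexists>Y. good P Y \<and> p \<in> spn Y" for k b
  proof -
    obtain x' f' where *: "frame P I d x' f'" "{i\<in>I. f' i p \<noteq> 0} \<subset> S"
      using frame_change[OF fr assms(2) S_def k b eq] by blast
    then have "card {i\<in>I. f' i p \<noteq> 0} < card {i\<in>I. f i p \<noteq> 0}"
      using psubset_card_mono[OF finS] unfolding S_def by blast
    from less(1)[OF this *(1)] nogood show False by blast
  qed
  show ?case
  proof (rule ccontr)
    assume nogood: "\<nexists>Y. good P Y \<and> p \<in> spn Y"
    \<comment> \<open>Otherwise \<open>u - c j j\<close> is a nonzero element of degree 0, hence
      invertible, and the relation at \<open>j\<close> can be solved for
      \<open>f j p\<close>.\<close>
    have diag: "c j j = u" if j: "j \<in> S" for j
    proof (rule ccontr)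
      assume "c j j \<noteq> u"
      moreover have "u - c j j \<in> A 0" using A_diff[OF u_A] c[OF j j] by simp
      ultimately obtain w where w: "w \<in> A 0" "w * (u - c j j) = u" using A_unit[of "u - c j j"] by auto
      have "f j p = f j p * c j j + (\<Sum>i\<in>S - {j}. f i p * c i j)"
        using rel[OF j] sum.remove[OF finS j, of "\<lambda>i. f i p * c i j"] by argo
      then have "(u - c j j) * f j p = (\<Sum>i\<in>S - {j}. f i p * c i j)"
        using u_neutral[OF fp[OF j]] by (simp add: algebra_simps)
      then have "w * (u - c j j) * f j p = (\<Sum>i\<in>S - {j}. (w * c i j) * f i p)"
        by (simp add: mult.assoc sum_distrib_left mult.commute mult.left_commute)
      then have "f j p = (\<Sum>i\<in>S - {j}. (w * c i j) * f i p)"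
        using w(2) u_neutral[OF fp[OF j]] by simp
      moreover have "w * c i j \<in> A (d i - d j)" if "i \<in> S - {j}" for i
        using A_mult[OF w(1) c[of i j]] that j by simp
      ultimately show False using no_rel[OF j, of "\<lambda>i. w * c i j"] nogood by blast
    qed
    \<comment> \<open>For \<open>d i < d j\<close> the entry has negative degree. For equal degrees
      a nonzero entry would be invertible; since \<open>c j j = u\<close>, the terms with
      \<open>f j p\<close> cancel in the relation at \<open>j\<close>, which can then be solved for
      \<open>f i p\<close>. The coefficient at \<open>j\<close> in the solution is 0.\<close>
    have off: "c i j = 0" if i: "i \<in> S" and j: "j \<in> S" and ij: "i \<noteq> j" and le: "d i \<le> d j" for i j
    proof (rule ccontr)
      assume nz: "c i j \<noteq> 0"
      then have dd: "d i = d j" using A_neg[OF _ c[OF i j]] le by linarith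
      then obtain w where w: "w \<in> A 0" "w * c i j = u" using A_unit[OF _ nz] c[OF i j] by auto
      have fj: "f j p * c j j = f j p" using diag[OF j] u_neutral[OF fp[OF j]] by (simp add: mult.commute)
      have "f j p = f i p * c i j + (\<Sum>l\<in>S - {i}. f l p * c l j)"
        using rel[OF j] sum.remove[OF finS i, of "\<lambda>l. f l p * c l j"] by argo
      also have "(\<Sum>l\<in>S - {i}. f l p * c l j) = f j p * c j j + (\<Sum>l\<in>S - {i} - {j}. f l p * c l j)"
        by (rule sum.remove) (use finS j ij in auto)
      finally have "f i p * c i j = - (\<Sum>l\<in>S - {i} - {j}. f l p * c l j)" using fj by (simp add: eq_neg_iff_add_eq_0 add.commute)
      then have "w * (f i p * c i j) = - (\<Sum>l\<in>S - {i} - {j}. w * (f l p * c l j))"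
        by (simp add: sum_distrib_left)
      moreover have "w * (f i p * c i j) = f i p"
        using w(2) u_neutral[OF fp[OF i]] by (metis mult.commute mult.left_commute)
      ultimately have "f i p = (\<Sum>l\<in>S - {i} - {j}. - (w * c l j) * f l p)"
        by (simp add: sum_negf[symmetric] mult.assoc mult.commute mult.left_commute)
      also have "\<dots> = (\<Sum>l\<in>S - {i}. (if l = j then 0 else - (w * c l j)) * f l p)"
        by (rule sum.mono_neutral_cong_left) (use finS in auto)
      finally have "f i p = (\<Sum>l\<in>S - {i}. (if l = j then 0 else - (w * c l j)) * f l p)" .
      moreover have "(if l = j then 0 else - (w * c l j)) \<in> A (d l - d i)" if "l \<in> S - {i}" for l
        using A_minus[OF A_mult[OF w(1) c[of l j]]] that j dd A_0 by simp
      ultimately show False using no_rel[OF i, of "\<lambda>l. if l = j then 0 else - (w * c l j)"] nogood by blast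
    qed
    obtain g where g: "\<And>i. i \<in> S \<Longrightarrow> g i \<in> Fun P (d i)" "\<And>i j. i \<in> S \<Longrightarrow> j \<in> S \<Longrightarrow> g i (x j) = (if i = j then u else 0)"
    proof -
      have "\<exists>g. (\<forall>i\<in>S. g i \<in> Fun P (d i) \<and> (\<forall>j\<in>S. g i (x j) = (if i = j then u else 0))) \<and>
        (\<forall>z\<in>P. (\<forall>i\<in>S. f i z = 0) \<longrightarrow> (\<forall>i\<in>S. g i z = 0))"
      proof (rule biorthogonal_of_unitriangular[OF finS P])
        fix i assume i: "i \<in> S"
        then have "i \<in> I" using SI by blast
        then show "x i \<in> P \<and> x i \<in> G (d i) \<and> f i \<in> Fun P (d i) \<and> f i (x i) = u"
          using frameD(2-4)[OF fr] diag[OF i] unfolding c_def by simp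
      qed (use off in \<open>simp add: c_def\<close>)
      then show ?thesis using that by blast
    qed
    have inj: "inj_on x S" by (rule inj_onI) (metis g(2) u_nz)
    let ?g = "\<lambda>y. g (the_inv_into S x y)"
    have "good P (x ` S)"
      unfolding good_def
    proof (intro conjI exI[of _ ?g] ballI)
      show "finite (x ` S)" "x ` S \<subseteq> P" using finS SI frameD(2)[OF fr] by auto
      fix y assume "y \<in> x ` S"
      then obtain i where i: "i \<in> S" "y = x i" by blast
      then have e: "the_inv_into S x y = i" using the_inv_into_f_f[OF inj] by blast
      show "\<exists>e. y \<in> G e \<and> ?g y \<in> Fun P e" unfolding e using i g(1) frameD(3)[OF fr] SI by blast
      fix y' assume "y' \<in> x ` S"
      then show "?g y y' = (if y = y' then u else 0)" unfolding e using g(2) i inj by (auto simp: inj_on_def)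
    qed
    moreover have "p \<in> spn (x ` S)"
    proof -
      have "p = (\<Sum>i\<in>S. s (f i p) (x i))"
        by (rule frame_sum[OF fr assms(2) finS _ SI]) (simp add: S_def)
      also have "\<dots> \<in> spn (x ` S)"
        by (rule spn_sum, rule spn_s) (use fp SI frameD(2)[OF fr] in \<open>auto intro: spn_base[OF P]\<close>)
      finally show ?thesis .
    qed
    ultimately show False using nogood by blast
  qed
qed

text \<open>The map \<open>r\<close> projects \<open>P\<close> onto the span of \<open>Y\<close>,
  with complement \<open>P'\<close>. This complement is graded projective too, so
  \<open>finite_step\<close> provides a free summand of it containing the component
  \<open>p - r p\<close>; joined with \<open>Y\<close> it captures \<open>p\<close>.\<close>

lemma good_extend:
  assumes fr: "frame P I d x f" and p: "p \<in> P" and Y: "good P Y"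
  shows "\<exists>Y'. Y \<subseteq> Y' \<and> good P Y' \<and> p \<in> spn Y'"
proof -
  have P: "submod P" using frameD(1)[OF fr] .
  obtain g where finY: "finite Y" and YP: "\<And>y. y \<in> Y \<Longrightarrow> y \<in> P"
    and g1: "\<And>y. y \<in> Y \<Longrightarrow> \<exists>e. y \<in> G e \<and> g y \<in> Fun P e"
    and g2: "\<And>y y'. y \<in> Y \<Longrightarrow> y' \<in> Y \<Longrightarrow> g y y' = (if y = y' then u else 0)"
    using Y unfolding good_def by blast
  define r where "r z = (\<Sum>y\<in>Y. s (g y z) y)" for z
  define P' where "P' = {z \<in> P. \<forall>y\<in>Y. g y z = 0}"
  have gR: "g y z \<in> R" if "y \<in> Y" "z \<in> P" for y z using g1[OF that(1)] FunD(1) that(2) by blast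
  have gadd: "g y (a + b) = g y a + g y b" if "y \<in> Y" "a \<in> P" "b \<in> P" for y a b
    using g1[OF that(1)] FunD(2) that by blast
  have gdiff: "g y (a - b) = g y a - g y b" if "y \<in> Y" "a \<in> P" "b \<in> P" for y a b
    using g1[OF that(1)] Fun_diff[OF P] that by blast
  have gs: "g y (s c a) = c * g y a" if "y \<in> Y" "c \<in> R" "a \<in> P" for y a c
    using g1[OF that(1)] FunD(3) that by blast
  have rP: "r z \<in> P" if "z \<in> P" for z
    unfolding r_def by (rule submod_sum[OF P]) (use submodD(3)[OF P] gR YP that in blast)
  have rG: "r z \<in> G e" if "z \<in> P" "z \<in> G e" for z e
    unfolding r_def
  proof (rule G_sum)
    fix y assume y: "y \<in> Y"
    then obtain e' where e': "y \<in> G e'" "g y \<in> Fun P e'" using g1 by blast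
    show "s (g y z) y \<in> G e" using G_s[OF FunD(4)[OF e'(2) that] e'(1)] by simp
  qed
  have gr: "g y (r z) = g y z" if y: "y \<in> Y" and z: "z \<in> P" for y z
  proof -
    obtain e' where e': "g y \<in> Fun P e'" using g1 y by blast
    have "g y (r z) = (\<Sum>y'\<in>Y. g y (s (g y' z) y'))"
      unfolding r_def by (rule Fun_sum[OF P e']) (use submodD(3)[OF P] gR YP z in blast)
    also have "\<dots> = (\<Sum>y'\<in>Y. g y' z * g y y')" by (intro sum.cong refl gs) (use y z gR YP in auto)
    also have "\<dots> = (\<Sum>y'\<in>{y}. g y' z * g y y')"
      by (rule sum.mono_neutral_right) (use y finY g2 in auto)
    also have "\<dots> = g y z" using g2[OF y y] u_neutral[OF gR[OF y z]] by (simp add: mult.commute)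
    finally show ?thesis .
  qed
  have P': "submod P'"
    unfolding submod_def P'_def using submodD[OF P] gadd gs R_0
    by (auto simp: gs[of _ 0 0, simplified])
  have P'P: "P' \<subseteq> P" unfolding P'_def by blast
  have qP': "z - r z \<in> P'" if "z \<in> P" for z
    unfolding P'_def using that rP gdiff gr submod_diff[OF P] by simp
  have r_diff: "(z + w) - r (z + w) = (z - r z) + (w - r w)" if "z \<in> P" "w \<in> P" for z w
    unfolding r_def using that by (simp add: gadd s_add_left sum.distrib)
  have r_s: "s a z - r (s a z) = s a (z - r z)" if "z \<in> P" "a \<in> R" for z a
    unfolding r_def using that by (simp add: gs s_diff s_sum s_mult)
  \<comment> \<open>Projecting the generators into \<open>P'\<close> suffices: the functionals are
    merely restricted, since \<open>z - r z = z\<close> for \<open>z\<close> in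
    \<open>P'\<close>.\<close>
  have fr': "frame P' I d (\<lambda>i. x i - r (x i)) f"
    unfolding frame_def
  proof (intro conjI ballI P')
    fix i assume i: "i \<in> I"
    show "x i - r (x i) \<in> P'" "x i - r (x i) \<in> G (d i)" "f i \<in> Fun P' (d i)"
      using qP' G_diff rG frameD(2-4)[OF fr i] Fun_mono[OF P'P] by blast+
  next
    fix z assume z: "z \<in> P'"
    then have zP: "z \<in> P" and gz: "\<forall>y\<in>Y. g y z = 0" unfolding P'_def by auto
    let ?S = "{i \<in> I. f i z \<noteq> 0}"
    show fin: "finite ?S" using frameD(5)[OF fr zP] .
    have 0: "z = (\<Sum>i\<in>?S. s (f i z) (x i))" by (rule frame_sum[OF fr zP fin]) auto
    have fR: "f i z \<in> R" if "i \<in> I" for i using FunD(1)[OF frameD(4)[OF fr that] zP] .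
    have rz: "r z = 0" unfolding r_def using gz by simp
    have "w - r w = (\<Sum>i\<in>T. s (f i z) (x i - r (x i)))" if "finite T" "T \<subseteq> I" "w = (\<Sum>i\<in>T. s (f i z) (x i))" for T w
      using that
    proof (induct T arbitrary: w rule: finite_induct)
      case empty then show ?case unfolding r_def by (simp add: gs[of _ 0 0, simplified] R_0 submodD(1)[OF P])
    next
      case (insert i T)
      then have iI: "i \<in> I" by blast
      have "(\<Sum>i\<in>T. s (f i z) (x i)) \<in> P"
        by (rule submod_sum[OF P]) (use insert(4) submodD(3)[OF P] fR frameD(2)[OF fr] in blast)
      moreover have "s (f i z) (x i) \<in> P" using submodD(3)[OF P] fR frameD(2)[OF fr] iI by blast
      ultimately show ?case using insert(1,2,3,4,5) r_diff[of "s (f i z) (x i)" "\<Sum>i\<in>T. s (f i z) (x i)"]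
          r_s[OF frameD(2)[OF fr iI] fR[OF iI]] by simp
    qed
    from this[OF fin _ 0] show "z = (\<Sum>i\<in>?S. s (f i z) (x i - r (x i)))" using rz by simp
  qed
  obtain Y' where Y': "good P' Y'" "p - r p \<in> spn Y'" using finite_step[OF fr' qP'[OF p]] by blast
  obtain g' where finY': "finite Y'" and YP': "\<And>y. y \<in> Y' \<Longrightarrow> y \<in> P'"
    and g1': "\<And>y. y \<in> Y' \<Longrightarrow> \<exists>e. y \<in> G e \<and> g' y \<in> Fun P' e"
    and g2': "\<And>y y'. y \<in> Y' \<Longrightarrow> y' \<in> Y' \<Longrightarrow> g' y y' = (if y = y' then u else 0)"
    using Y'(1) unfolding good_def by blast
  have disj: "y \<notin> Y" if "y \<in> Y'" for y using YP'[OF that] g2[of y y] u_nz unfolding P'_def by auto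
  have r_on: "r y = y" if y: "y \<in> Y" for y
  proof -
    have "r y = (\<Sum>y'\<in>{y}. s (g y' y) y')"
      unfolding r_def by (rule sum.mono_neutral_right) (use y finY g2 in auto)
    then show ?thesis using g2[OF y y] submodD(4)[OF P YP[OF y]] by simp
  qed
  have r_off: "r y = 0" if "y \<in> P'" for y using that unfolding r_def P'_def by simp
  \<comment> \<open>Functionals on \<open>P'\<close> are extended to \<open>P\<close> by composing
    with the projection that kills \<open>Y\<close>.\<close>
  let ?g = "\<lambda>y. if y \<in> Y then g y else (\<lambda>z. g' y (z - r z))"
  have "good P (Y \<union> Y')"
    unfolding good_def
  proof (intro conjI exI[of _ ?g] ballI)
    show "finite (Y \<union> Y')" "Y \<union> Y' \<subseteq> P" using finY finY' YP YP' P'P by auto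
    fix y assume y: "y \<in> Y \<union> Y'"
    show "\<exists>e. y \<in> G e \<and> ?g y \<in> Fun P e"
    proof (cases "y \<in> Y")
      case True then show ?thesis using g1 by simp
    next
      case False
      with y obtain e where e: "y \<in> G e" "g' y \<in> Fun P' e" using g1' by blast
      have "(\<lambda>z. g' y (z - r z)) \<in> Fun P e"
        unfolding Fun_def
      proof (intro CollectI conjI ballI allI)
        fix a b assume ab: "a \<in> P" "b \<in> P"
        show "g' y (a - r a) \<in> R" using FunD(1)[OF e(2)] qP' ab by blast
        show "g' y (a + b - r (a + b)) = g' y (a - r a) + g' y (b - r b)"
          unfolding r_diff[OF ab] using FunD(2)[OF e(2)] qP' ab by blast
      next
        fix c a assume "c \<in> R" "a \<in> P"
        then show "g' y (s c a - r (s c a)) = c * g' y (a - r a)"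
          using FunD(3)[OF e(2)] qP' by (simp only: r_s)
      next
        fix \<delta> a assume "a \<in> P \<inter> G \<delta>"
        then show "g' y (a - r a) \<in> A (\<delta> - e)" using FunD(4)[OF e(2)] qP' G_diff rG by blast
      qed
      then show ?thesis using False e by auto
    qed
    fix y' assume y': "y' \<in> Y \<union> Y'"
    show "?g y y' = (if y = y' then u else 0)"
    proof (cases "y \<in> Y")
      case True
      then show ?thesis using y' g2 YP'[of y'] disj unfolding P'_def by auto
    next
      case False
      then have yY: "y \<in> Y'" using y by blast
      obtain e where e: "g' y \<in> Fun P' e" using g1' yY by blast
      show ?thesis
      proof (cases "y' \<in> Y")
        case True then show ?thesis using False r_on Fun_0[OF P' e] by auto
      next
        case f: False then show ?thesis using False y' yY g2' r_off[OF YP'] by simp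
      qed
    qed
  qed
  moreover have "p \<in> spn (Y \<union> Y')"
  proof -
    have "r p \<in> spn (Y \<union> Y')" unfolding r_def
      by (rule spnI) (use finY gR p in auto)
    moreover have "p - r p \<in> spn (Y \<union> Y')" using Y'(2) spn_mono[of Y' "Y \<union> Y'"] by blast
    ultimately show ?thesis using spn_add by fastforce
  qed
  ultimately show ?thesis by blast
qed

lemma good_indep:
  assumes "good P Y" "submod P"
  shows "indep Y"
  unfolding indep_def
proof (intro allI impI ballI)
  fix T c b
  assume T: "finite T" "T \<subseteq> Y" "\<forall>b\<in>T. c b \<in> R" "(\<Sum>b\<in>T. s (c b) b) = 0" and b: "b \<in> T"
  obtain g where YP: "\<And>y. y \<in> Y \<Longrightarrow> y \<in> P"
    and g1: "\<And>y. y \<in> Y \<Longrightarrow> \<exists>e. y \<in> G e \<and> g y \<in> Fun P e"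
    and g2: "\<And>y y'. y \<in> Y \<Longrightarrow> y' \<in> Y \<Longrightarrow> g y y' = (if y = y' then u else 0)"
    using assms(1) unfolding good_def by blast
  obtain e where e: "g b \<in> Fun P e" using g1 b T by blast
  have "0 = g b (\<Sum>b\<in>T. s (c b) b)" using Fun_0[OF assms(2) e] T by simp
  also have "\<dots> = (\<Sum>b'\<in>T. g b (s (c b') b'))"
    by (rule Fun_sum[OF assms(2) e]) (use T YP submodD(3)[OF assms(2)] in blast)
  also have "\<dots> = (\<Sum>b'\<in>T. c b' * g b b')" by (intro sum.cong refl FunD(3)[OF e]) (use T YP in auto)
  also have "\<dots> = (\<Sum>b'\<in>{b}. c b' * g b b')"
    by (rule sum.mono_neutral_right) (use T b g2 in \<open>auto simp: subset_iff\<close>)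
  also have "\<dots> = c b" using g2[of b b] b T u_neutral[of "c b"] by (simp add: mult.commute subset_iff)
  finally show "c b = 0" by simp
qed

text \<open>The generators are absorbed one at a time into an increasing sequence of finite free
  summands. Only the finite sets need to be nested: the dual functionals may change from stage to
  stage, as they serve only to make each stage independent.\<close>

lemma basis_of_countable_frame:
  assumes fr: "frame P I d x f" and I: "countable I"
  shows "\<exists>U. basis U P"
proof (cases "I = {}")
  case True
  have "p = 0" if "p \<in> P" for p using frame_sum[OF fr that, of "{}"] True by simp
  then have "basis {} P" unfolding basis_def indep_def using spn_0 by auto
  then show ?thesis by blast
next
  case False
  have P: "submod P" using frameD(1)[OF fr] .
  have xP: "x (from_nat_into I n) \<in> P" for n using from_nat_into[OF False] frameD(2)[OF fr] by blast
  have "good P {}" unfolding good_def by simp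
  then obtain Y where Y: "\<And>n. good P (Y n)" "\<And>n. Y n \<subseteq> Y (Suc n) \<and> x (from_nat_into I n) \<in> spn (Y (Suc n))"
    using dependent_nat_choice[of "\<lambda>_. good P" "\<lambda>n Y Y'. Y \<subseteq> Y' \<and> x (from_nat_into I n) \<in> spn Y'"]
      good_extend[OF fr xP] by metis
  have mono: "Y m \<subseteq> Y n" if "m \<le> n" for m n using lift_Suc_mono_le[of Y m n] Y(2) that by blast
  let ?U = "\<Union>n. Y n"
  have "indep ?U"
    unfolding indep_def
  proof (intro allI impI)
    fix T c assume T: "finite T" "T \<subseteq> ?U" "\<forall>b\<in>T. c b \<in> R" "(\<Sum>b\<in>T. s (c b) b) = 0"
    from T(1,2) have "\<exists>n. T \<subseteq> Y n"
    proof induct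
      case (insert t T)
      then obtain m n where "T \<subseteq> Y m" "t \<in> Y n" by blast
      then have "insert t T \<subseteq> Y (max m n)" using mono[of m "max m n"] mono[of n "max m n"] by auto
      then show ?case by blast
    qed simp
    then show "\<forall>b\<in>T. c b = 0" using good_indep[OF Y(1) P] T unfolding indep_def by blast
  qed
  moreover have "P \<subseteq> spn ?U"
  proof
    fix p assume p: "p \<in> P"
    have xU: "x i \<in> spn ?U" if i: "i \<in> I" for i
    proof -
      obtain n where "i = from_nat_into I n" using from_nat_into_surj[OF I i] by metis
      then show ?thesis using Y(2)[of n] spn_mono[of "Y (Suc n)" ?U] by blast
    qed
    have "p = (\<Sum>i\<in>{i\<in>I. f i p \<noteq> 0}. s (f i p) (x i))" by (rule frame_sum[OF fr p frameD(5)[OF fr p]]) auto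
    also have "\<dots> \<in> spn ?U"
      by (intro spn_sum spn_s xU) (use FunD(1)[OF frameD(4)[OF fr] p] in auto)
    finally show "p \<in> spn ?U" .
  qed
  moreover have "?U \<subseteq> P" "\<forall>b\<in>?U. \<exists>e. b \<in> G e" using Y(1) unfolding good_def by blast+
  ultimately show ?thesis unfolding basis_def by blast
qed

end

section \<open>Kaplansky's passage from countable to arbitrary frames\<close>

context connected_graded_module
begin

lemma indepD:
  "indep U \<Longrightarrow> finite T \<Longrightarrow> T \<subseteq> U \<Longrightarrow> (\<And>b. b \<in> T \<Longrightarrow> c b \<in> R) \<Longrightarrow> (\<Sum>b\<in>T. s (c b) b) = 0 \<Longrightarrow> b \<in> T \<Longrightarrow> c b = 0"
  unfolding indep_def by blast

text \<open>Call \<open>S\<close> closed if this set contains \<open>x i\<close> for all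
  \<open>i\<close> in \<open>S\<close>. For closed \<open>S\<close> it is the span of these
  elements, and a direct summand of \<open>P\<close>, the projection keeping only the terms of the
  expansion with index in \<open>S\<close>.\<close>

definition supported :: "'b set \<Rightarrow> 'i set \<Rightarrow> ('i \<Rightarrow> 'b \<Rightarrow> 'r) \<Rightarrow> 'i set \<Rightarrow> 'b set" where
  "supported P I f S = {p \<in> P. \<forall>i\<in>I - S. f i p = 0}"

lemma supported_frame:
  assumes fr: "frame P I d x f" and S: "S \<subseteq> I" "x ` S \<subseteq> supported P I f S"
  shows "frame (supported P I f S) S d x f"
proof -
  have P: "submod P" using frameD(1)[OF fr] .
  have f0: "f i 0 = 0" if "i \<in> I" for i using Fun_0[OF P frameD(4)[OF fr that]] .
  have sub: "supported P I f S \<subseteq> P" unfolding supported_def by blast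
  have "submod (supported P I f S)"
    unfolding submod_def supported_def
    using submodD[OF P] f0 FunD(2,3)[OF frameD(4)[OF fr]] by auto
  moreover have "finite {i\<in>S. f i p \<noteq> 0} \<and> p = (\<Sum>i\<in>{i\<in>S. f i p \<noteq> 0}. s (f i p) (x i))"
    if p: "p \<in> supported P I f S" for p
  proof -
    have eq: "{i\<in>S. f i p \<noteq> 0} = {i\<in>I. f i p \<noteq> 0}" using p S unfolding supported_def by auto
    show ?thesis unfolding eq using frame_sum[OF fr _ frameD(5)[OF fr]] frameD(5)[OF fr] p sub by blast
  qed
  ultimately show ?thesis
    unfolding frame_def using frameD(3,4)[OF fr] S Fun_mono[OF sub] by blast
qed

text \<open>Every \<open>x i\<close> has only finitely many nonzero coordinates. Adding their
  indices repeatedly, starting from one index, therefore produces a countable set.\<close>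

lemma countable_closed_superset:
  assumes fr: "frame P I d x f" and i: "i0 \<in> I"
  obtains T where "countable T" "T \<subseteq> I" "i0 \<in> T" "x ` T \<subseteq> supported P I f T"
proof -
  define N where "N T = T \<union> (\<Union>i\<in>T. {j\<in>I. f j (x i) \<noteq> 0})" for T
  define T where "T = (\<Union>n. (N ^^ n) {i0})"
  have sub: "(N ^^ n) {i0} \<subseteq> I \<and> countable ((N ^^ n) {i0})" for n
  proof (induct n)
    case (Suc n)
    then have "countable {j\<in>I. f j (x i) \<noteq> 0}" if "i \<in> (N ^^ n) {i0}" for i
      using frameD(5)[OF fr] frameD(2)[OF fr] that countable_finite by blast
    then show ?case using Suc unfolding N_def by auto
  qed (use i in auto)
  have "x ` T \<subseteq> supported P I f T"
  proof
    fix y assume "y \<in> x ` T"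
    then obtain i n where n: "i \<in> (N ^^ n) {i0}" "y = x i" unfolding T_def by blast
    have "j \<in> T" if "j \<in> I" "f j (x i) \<noteq> 0" for j
    proof -
      have "j \<in> (N ^^ Suc n) {i0}" using that n(1) unfolding N_def by auto
      then show ?thesis unfolding T_def by blast
    qed
    then show "y \<in> supported P I f T" using frameD(2)[OF fr] n sub unfolding supported_def by blast
  qed
  moreover have "countable T" "T \<subseteq> I" unfolding T_def using sub by auto
  moreover have "i0 \<in> (N ^^ 0) {i0}" by simp
  then have "i0 \<in> T" unfolding T_def by blast
  ultimately show ?thesis using that by blast
qed

text \<open>The coordinates indexed by \<open>T - S\<close> present the quotient of the two supported submodules.\<close>

lemma basis_extend_countable:
  fixes f :: "'i \<Rightarrow> 'b \<Rightarrow> 'r"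
  assumes fr: "frame P I d x f"
    and S: "S \<subseteq> I" "x ` S \<subseteq> supported P I f S"
    and T: "countable T" "T \<subseteq> I" "x ` T \<subseteq> supported P I f T"
    and U: "basis U (supported P I f S)"
  shows "\<exists>U'. U \<subseteq> U' \<and> basis U' (supported P I f (S \<union> T))"
proof -
  let ?PS = "supported P I f S" and ?PT = "supported P I f (S \<union> T)"
  have closed: "S \<union> T \<subseteq> I" "x ` (S \<union> T) \<subseteq> ?PT" using S T unfolding supported_def by blast+
  have frT: "frame ?PT (S \<union> T) d x f" using supported_frame[OF fr closed] .
  have PT: "submod ?PT" using frameD(1)[OF frT] .
  have frS: "frame ?PS S d x f" using supported_frame[OF fr S] .
  have PS: "submod ?PS" using frameD(1)[OF frS] .
  have PSPT: "?PS \<subseteq> ?PT" unfolding supported_def by blast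
  define s' :: "'r \<Rightarrow> ('i \<Rightarrow> 'r) \<Rightarrow> 'i \<Rightarrow> 'r" where "s' a v = (\<lambda>j. a * v j)" for a v
  \<comment> \<open>The shift by \<open>d j\<close> makes the map taking an element of
    \<open>P\<close> to its coordinates preserve degrees.\<close>
  define G' where "G' e = {v :: 'i \<Rightarrow> 'r. \<forall>j. v j \<in> A (e - d j)}" for e
  interpret Q: connected_graded_module R A u s' G'
  proof unfold_locales
    fix a and v :: "'i \<Rightarrow> 'r" and d' e assume "a \<in> A d'" "v \<in> G' e"
    then have "a * v j \<in> A (d' + (e - d j))" for j unfolding G'_def using A_mult by blast
    then show "s' a v \<in> G' (d' + e)" unfolding G'_def s'_def by (simp add: add_diff_eq)
  qed (auto simp: s'_def G'_def fun_eq_iff algebra_simps A_0 A_add A_minus)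
  \<comment> \<open>On \<open>?PT\<close> the coordinates outside \<open>S \<union> T\<close> vanish
    already, so the kernel of \<open>k\<close> there is \<open>?PS\<close>. The image has a frame
    indexed by the countable set \<open>T - S\<close>.\<close>
  define k where "k p = (\<lambda>j. if j \<in> T - S then f j p else 0)" for p
  have fI: "i \<in> I \<Longrightarrow> f i \<in> Fun P (d i)" for i using frameD(4)[OF fr] .
  have sub: "?PT \<subseteq> P" unfolding supported_def by blast
  have fT: "f i \<in> Fun ?PT (d i)" if "i \<in> T - S" for i using fI Fun_mono[OF sub] that T(2) by blast
  have k_add: "k (p + q) = k p + k q" if "p \<in> ?PT" "q \<in> ?PT" for p q
    unfolding k_def using FunD(2)[OF fT that] by (auto simp: fun_eq_iff)
  have k_s: "k (s a p) = s' a (k p)" if "a \<in> R" "p \<in> ?PT" for a p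
    unfolding k_def s'_def using FunD(3)[OF fT that] by (auto simp: fun_eq_iff)
  have k_0: "k 0 = 0" using k_add[of 0 0] submodD(1)[OF PT] by simp
  have k_sum: "k (sum h J) = (\<Sum>i\<in>J. k (h i))" if "\<And>i. i \<in> J \<Longrightarrow> h i \<in> ?PT" for h and J :: "'j set"
    using that by (induct J rule: infinite_finite_induct) (auto simp: k_0 k_add submod_sum[OF PT])
  have k_ker: "p \<in> ?PS" if "p \<in> ?PT" "k p = 0" for p
  proof -
    have "f j p = 0" if "j \<in> I - S" for j
      using that \<open>p \<in> ?PT\<close> fun_cong[OF \<open>k p = 0\<close>, of j] unfolding k_def supported_def by (cases "j \<in> T") auto
    then show ?thesis using that sub unfolding supported_def by blast
  qed
  have k_PS: "k p = 0" if "p \<in> ?PS" for p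
    using that T(2) unfolding k_def supported_def by (auto simp: fun_eq_iff)
  let ?Q = "k ` ?PT"
  have fR: "f j p \<in> R" if "j \<in> T - S" "p \<in> ?PT" for j p using FunD(1)[OF fT that(2)] that(1) by blast
  have QR: "v j \<in> R" if "v \<in> ?Q" for v j using that R_0 fR unfolding k_def by auto
  have Qsub: "Q.submod ?Q"
    unfolding Q.submod_def
  proof (intro conjI ballI)
    show "0 \<in> ?Q" using k_0 submodD(1)[OF PT] by force
    fix v w assume "v \<in> ?Q" "w \<in> ?Q"
    then obtain p q where "p \<in> ?PT" "q \<in> ?PT" "v = k p" "w = k q" by blast
    then show "v + w \<in> ?Q" using imageI[OF submodD(2)[OF PT], of p q k] k_add by simp
  next
    fix a v assume a: "a \<in> R" and "v \<in> ?Q"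
    then obtain p where "p \<in> ?PT" "v = k p" by blast
    then show "s' a v \<in> ?Q" using imageI[OF submodD(3)[OF PT a], of p k] k_s[OF a] by simp
  next
    fix v assume "v \<in> ?Q"
    then show "s' u v = v" unfolding s'_def using QR[of v] u_neutral by (auto simp: fun_eq_iff)
  qed
  have frQ: "Q.frame ?Q (T - S) d (\<lambda>i. k (x i)) (\<lambda>j v. v j)"
    unfolding Q.frame_def
  proof (intro conjI ballI Qsub)
    fix i assume i: "i \<in> T - S"
    have xi: "x i \<in> ?PT" "x i \<in> G (d i)" using frameD(2,3)[OF frT] i by blast+
    show "k (x i) \<in> ?Q" using xi by blast
    show "k (x i) \<in> G' (d i)" unfolding G'_def k_def using FunD(4)[OF fT xi] A_0 by auto
    show "(\<lambda>v. v i) \<in> Q.Fun ?Q (d i)"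
      unfolding Q.Fun_def using QR by (auto simp: s'_def G'_def)
  next
    fix v assume "v \<in> ?Q"
    then obtain p where p: "p \<in> ?PT" and v: "v = k p" by blast
    let ?J = "{i\<in>S \<union> T. f i p \<noteq> 0}" and ?K = "{i\<in>T - S. v i \<noteq> 0}"
    have finJ: "finite ?J" using frameD(5)[OF frT p] .
    have KJ: "?K \<subseteq> ?J" unfolding v k_def by auto
    show "finite ?K" using finite_subset[OF KJ finJ] .
    have pR: "f i p \<in> R" if "i \<in> S \<union> T" for i using FunD(1)[OF frameD(4)[OF frT that] p] .
    have "p = (\<Sum>i\<in>?J. s (f i p) (x i))" by (rule frame_sum[OF frT p finJ]) auto
    then have "v = k (\<Sum>i\<in>?J. s (f i p) (x i))" unfolding v by (rule arg_cong)
    also have "\<dots> = (\<Sum>i\<in>?J. k (s (f i p) (x i)))"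
      by (rule k_sum) (use submodD(3)[OF PT] pR frameD(2)[OF frT] in blast)
    also have "\<dots> = (\<Sum>i\<in>?J. s' (f i p) (k (x i)))"
      by (intro sum.cong refl k_s) (use pR frameD(2)[OF frT] in auto)
    also have "\<dots> = (\<Sum>i\<in>?K. s' (f i p) (k (x i)))"
    proof (rule sum.mono_neutral_right[OF finJ KJ], intro ballI)
      fix i assume "i \<in> ?J - ?K"
      then have "i \<in> S" unfolding v k_def by (auto split: if_splits)
      then show "s' (f i p) (k (x i)) = 0" using k_PS[of "x i"] S(2) by auto
    qed
    also have "\<dots> = (\<Sum>i\<in>?K. s' (v i) (k (x i)))"
      by (rule sum.cong) (auto simp: v k_def)
    finally show "v = (\<Sum>i\<in>?K. s' (v i) (k (x i)))" .
  qed
  obtain W where W: "Q.basis W ?Q"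
    using Q.basis_of_countable_frame[OF frQ] T(1) by blast
  \<comment> \<open>The expansion formula of the frame gives a degree-preserving right inverse of
    \<open>k\<close>. It lifts the basis \<open>W\<close> of the quotient to homogeneous elements
    that complete \<open>U\<close>.\<close>
  define l where "l v = (\<Sum>i\<in>{i\<in>T - S. v i \<noteq> 0}. s (v i) (x i))" for v
  have l: "l v \<in> ?PT \<and> k (l v) = v" if v: "v \<in> ?Q" for v
  proof -
    have in_PT: "s (v i) (x i) \<in> ?PT" if "i \<in> T - S" for i
      using submodD(3)[OF PT QR[OF v]] frameD(2)[OF frT] that by blast
    have "k (l v) = (\<Sum>i\<in>{i\<in>T - S. v i \<noteq> 0}. k (s (v i) (x i)))"
      unfolding l_def by (rule k_sum) (use in_PT in blast)
    also have "\<dots> = (\<Sum>i\<in>{i\<in>T - S. v i \<noteq> 0}. s' (v i) (k (x i)))"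
      by (intro sum.cong refl k_s QR v) (use frameD(2)[OF frT] in auto)
    also have "\<dots> = v" by (rule Q.frame_sum[OF frQ v Q.frameD(5)[OF frQ v], symmetric]) auto
    finally have "k (l v) = v" .
    moreover have "l v \<in> ?PT" unfolding l_def by (rule submod_sum[OF PT]) (use in_PT in blast)
    ultimately show ?thesis by blast
  qed
  have lG: "l v \<in> G e" if "v \<in> G' e" for v e
    unfolding l_def
  proof (rule G_sum)
    fix i assume i: "i \<in> {i \<in> T - S. v i \<noteq> 0}"
    have "s (v i) (x i) \<in> G ((e - d i) + d i)"
      by (rule G_s) (use that i frameD(3)[OF frT] in \<open>auto simp: G'_def\<close>)
    then show "s (v i) (x i) \<in> G e" by simp
  qed
  have WQ: "W \<subseteq> ?Q" using W unfolding Q.basis_def by (elim conjE)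
  have WG: "\<forall>v\<in>W. \<exists>e. v \<in> G' e" using W unfolding Q.basis_def by (elim conjE)
  have Wspn: "?Q \<subseteq> Q.spn W" using W unfolding Q.basis_def by (elim conjE)
  have Wind: "Q.indep W" using W unfolding Q.basis_def by (elim conjE)
  have UP: "U \<subseteq> ?PS" using U unfolding basis_def by (elim conjE)
  have UG: "\<forall>v\<in>U. \<exists>e. v \<in> G e" using U unfolding basis_def by (elim conjE)
  have Uspn: "?PS \<subseteq> spn U" using U unfolding basis_def by (elim conjE)
  have Uind: "indep U" using U unfolding basis_def by (elim conjE)
  have linj: "inj_on l W" by (rule inj_on_inverseI[of _ k]) (use l WQ in blast)
  have W0: "0 \<notin> W"
  proof
    assume W: "0 \<in> W"
    show False using Q.indepD[OF Wind, of "{0}" "\<lambda>_. u" 0] W u_R u_nz by simp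
  qed
  let ?U = "U \<union> l ` W"
  have disj: "l w \<notin> U" if "w \<in> W" for w
  proof
    assume "l w \<in> U"
    then have "k (l w) = 0" using k_PS UP by blast
    then show False using l[of w] WQ W0 that by fastforce
  qed
  have lP: "l ` W \<subseteq> ?PT" using l WQ by blast
  have "indep ?U"
    unfolding indep_def
  proof (intro allI impI)
    fix Z c assume Z: "finite Z" "Z \<subseteq> ?U" "\<forall>b\<in>Z. c b \<in> R" "(\<Sum>b\<in>Z. s (c b) b) = 0"
    have "0 = k (\<Sum>b\<in>Z. s (c b) b)" using Z k_0 by simp
    also have "\<dots> = (\<Sum>b\<in>Z. k (s (c b) b))"
      by (rule k_sum) (use submodD(3)[OF PT] Z UP PSPT lP in blast)
    also have "\<dots> = (\<Sum>b\<in>Z. s' (c b) (k b))"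
      by (intro sum.cong refl k_s) (use Z UP PSPT lP in blast)+
    also have "\<dots> = (\<Sum>b\<in>Z \<inter> l ` W. s' (c b) (k b))"
      by (rule sum.mono_neutral_right) (use Z UP k_PS in auto)
    also have "Z \<inter> l ` W = l ` {w\<in>W. l w \<in> Z}" by blast
    also have "(\<Sum>b\<in>l ` {w\<in>W. l w \<in> Z}. s' (c b) (k b)) = (\<Sum>w\<in>{w\<in>W. l w \<in> Z}. s' (c (l w)) w)"
      by (subst sum.reindex) (use linj l WQ in \<open>auto simp: inj_on_def intro!: sum.cong\<close>)
    finally have "(\<Sum>w\<in>{w\<in>W. l w \<in> Z}. s' (c (l w)) w) = 0" by (rule sym)
    moreover have "finite {w\<in>W. l w \<in> Z}"
      using finite_vimage_IntI[OF Z(1) linj] by (simp add: vimage_def Collect_conj_eq Int_commute)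
    moreover have "\<forall>w\<in>{w\<in>W. l w \<in> Z}. c (l w) \<in> R" using Z by blast
    ultimately have cw: "c (l w) = 0" if "w \<in> W" "l w \<in> Z" for w
      using Q.indepD[OF Wind, of "{w\<in>W. l w \<in> Z}" "\<lambda>w. c (l w)" w] that by auto
    have cl: "c b = 0" if b: "b \<in> Z" "b \<notin> U" for b
    proof -
      obtain w where "w \<in> W" "b = l w" using b Z(2) by blast
      then show ?thesis using cw b(1) by simp
    qed
    then have "(\<Sum>b\<in>Z \<inter> U. s (c b) b) = (\<Sum>b\<in>Z. s (c b) b)"
      by (intro sum.mono_neutral_left) (use Z in auto)
    then have "c b = 0" if "b \<in> Z" "b \<in> U" for b
      using indepD[OF Uind, of "Z \<inter> U" c b] Z that by auto
    then show "\<forall>b\<in>Z. c b = 0" using cl by blast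
  qed
  moreover have "?PT \<subseteq> spn ?U"
  proof
    fix p assume p: "p \<in> ?PT"
    then have "k p \<in> Q.spn W" using Wspn by blast
    then obtain Z c where Z: "finite Z" "Z \<subseteq> W" "\<forall>b\<in>Z. c b \<in> R" "k p = (\<Sum>b\<in>Z. s' (c b) b)"
      unfolding Q.spn_def by blast
    define q where "q = (\<Sum>b\<in>Z. s (c b) (l b))"
    have cR: "c b \<in> R" "l b \<in> ?PT" if "b \<in> Z" for b using Z(2,3) lP that by auto
    have in_PT: "s (c b) (l b) \<in> ?PT" if "b \<in> Z" for b by (rule submodD(3)[OF PT cR[OF that]])
    have qPT: "q \<in> ?PT" unfolding q_def by (rule submod_sum[OF PT in_PT])
    have "k q = (\<Sum>b\<in>Z. k (s (c b) (l b)))" unfolding q_def by (rule k_sum) (use in_PT in blast)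
    also have "\<dots> = (\<Sum>b\<in>Z. s' (c b) b)"
      by (intro sum.cong refl) (use Z lP l WQ in \<open>auto simp: k_s subset_iff\<close>)
    finally have kq: "k q = k p" unfolding Z(4) .
    have "p - q \<in> ?PT" using submod_diff[OF PT p qPT] .
    moreover have "k (p - q) = 0" using k_add[OF calculation qPT] kq by simp
    ultimately have "p - q \<in> spn ?U" using k_ker Uspn spn_mono[of U ?U] by blast
    moreover have "q \<in> spn ?U"
      unfolding q_def by (intro spn_sum spn_s cR spn_base[OF PT]) (use Z(2) in auto)
    ultimately show "p \<in> spn ?U" using spn_add by fastforce
  qed
  moreover have "?U \<subseteq> ?PT" using UP PSPT lP by blast
  moreover have "\<forall>b\<in>?U. \<exists>e. b \<in> G e" using UG WG lG by blast
  ultimately have "basis ?U ?PT" unfolding basis_def by blast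
  then show ?thesis by blast
qed

text \<open>Zorn's lemma for pairs of a closed index set and a basis of the submodule supported on
  it. Countable closed sets allow every proper pair to be enlarged.\<close>

theorem basis_of_frame:
  fixes f :: "'i \<Rightarrow> 'b \<Rightarrow> 'r"
  assumes fr: "frame P I d x f"
  shows "\<exists>U. basis U P"
proof -
  define ok where "ok S U \<longleftrightarrow> S \<subseteq> I \<and> x ` S \<subseteq> supported P I f S \<and> basis U (supported P I f S)" for S U
  \<comment> \<open>A pair is encoded as one subset of a disjoint sum, so that the order on pairs
    becomes inclusion and unions of chains are taken in both components at once.\<close>
  define F where "F = {Z :: ('i + 'b) set. ok (Inl -` Z) (Inr -` Z)}"
  have ok0: "ok {} {}"
  proof -
    have "p = 0" if "p \<in> supported P I f {}" for p
      using frame_sum[OF supported_frame[OF fr, of "{}"] that, of "{}"] by simp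
    then have "basis {} (supported P I f {})" unfolding basis_def indep_def using spn_0 by auto
    then show ?thesis unfolding ok_def by simp
  qed
  have "\<exists>M\<in>F. \<forall>X\<in>F. M \<subseteq> X \<longrightarrow> X = M"
  proof (rule subset_Zorn_nonempty)
    show "F \<noteq> {}" unfolding F_def using ok0 by (auto intro!: exI[of _ "{}"])
    fix C assume C: "C \<noteq> {}" "subset.chain F C"
    have okC: "ok (Inl -` Z) (Inr -` Z)" if "Z \<in> C" for Z
      using C(2) that unfolding subset.chain_def F_def by blast
    let ?S = "Inl -` \<Union>C :: 'i set" and ?U = "Inr -` \<Union>C :: 'b set"
    have fin: "\<exists>Z\<in>C. J \<subseteq> Z" if "finite J" "J \<subseteq> \<Union>C" for J
      by (rule finite_subset_Union_chain[OF that C]) blast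
    have SI: "?S \<subseteq> I" using okC unfolding ok_def by blast
    have mono: "supported P I f (Inl -` Z) \<subseteq> supported P I f ?S" if "Z \<in> C" for Z
      using that unfolding supported_def by blast
    have xS: "x ` ?S \<subseteq> supported P I f ?S"
    proof
      fix y assume "y \<in> x ` ?S"
      then obtain i Z where "Inl i \<in> Z" "Z \<in> C" "y = x i" by blast
      then show "y \<in> supported P I f ?S" using okC[of Z] mono[of Z] unfolding ok_def by blast
    qed
    have "indep ?U"
      unfolding indep_def
    proof (intro allI impI)
      fix T c assume T: "finite T" "T \<subseteq> ?U" "\<forall>b\<in>T. c b \<in> R" "(\<Sum>b\<in>T. s (c b) b) = 0"
      then have "finite (Inr ` T :: ('i + 'b) set)" "(Inr ` T :: ('i + 'b) set) \<subseteq> \<Union>C" by auto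
      from fin[OF this] obtain Z where Z: "Z \<in> C" "Inr ` T \<subseteq> Z" by blast
      then have "T \<subseteq> Inr -` Z" by blast
      moreover have "indep (Inr -` Z)" using okC[OF Z(1)] unfolding ok_def basis_def by blast
      ultimately show "\<forall>b\<in>T. c b = 0" using T unfolding indep_def by blast
    qed
    moreover have "supported P I f ?S \<subseteq> spn ?U"
    proof
      fix p assume p: "p \<in> supported P I f ?S"
      then have pP: "p \<in> P" unfolding supported_def by blast
      have "finite (Inl ` {i\<in>I. f i p \<noteq> 0} :: ('i + 'b) set)" using frameD(5)[OF fr pP] by simp
      moreover have "(Inl ` {i\<in>I. f i p \<noteq> 0} :: ('i + 'b) set) \<subseteq> \<Union>C" using p unfolding supported_def by auto
      ultimately obtain Z where Z: "Z \<in> C" "Inl ` {i\<in>I. f i p \<noteq> 0} \<subseteq> Z"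
        using fin by blast
      then have "p \<in> supported P I f (Inl -` Z)" using pP unfolding supported_def by blast
      then have "p \<in> spn (Inr -` Z)" using okC[OF Z(1)] unfolding ok_def basis_def by blast
      then show "p \<in> spn ?U" using spn_mono[of "Inr -` Z" ?U] Z(1) by blast
    qed
    moreover have "?U \<subseteq> supported P I f ?S" "\<forall>b\<in>?U. \<exists>e. b \<in> G e"
    proof -
      show "?U \<subseteq> supported P I f ?S"
      proof
        fix b assume "b \<in> ?U"
        then obtain Z where "Z \<in> C" "b \<in> Inr -` Z" by blast
        then show "b \<in> supported P I f ?S" using okC[of Z] mono[of Z] unfolding ok_def basis_def by blast
      qed
      show "\<forall>b\<in>?U. \<exists>e. b \<in> G e"
      proof
        fix b assume "b \<in> ?U"
        then obtain Z where "Z \<in> C" "b \<in> Inr -` Z" by blast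
        then show "\<exists>e. b \<in> G e" using okC[of Z] unfolding ok_def basis_def by blast
      qed
    qed
    ultimately have "ok ?S ?U" unfolding ok_def basis_def using SI xS by blast
    then show "\<Union>C \<in> F" unfolding F_def by blast
  qed
  then obtain M where M: "M \<in> F" "\<And>X. X \<in> F \<Longrightarrow> M \<subseteq> X \<Longrightarrow> X = M" by blast
  define S U where "S = Inl -` M" and "U = Inr -` M"
  have ok: "ok S U" using M(1) unfolding F_def S_def U_def by blast
  then have ok1: "S \<subseteq> I" "x ` S \<subseteq> supported P I f S" "basis U (supported P I f S)"
    unfolding ok_def by simp_all
  \<comment> \<open>A union of closed sets is closed. So an index missing from \<open>S\<close>
    would yield, with a countable closed set around it, a larger admissible pair.\<close>
  have "I \<subseteq> S"
  proof
    fix i assume i: "i \<in> I"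
    obtain T where T: "countable T" "T \<subseteq> I" "i \<in> T" "x ` T \<subseteq> supported P I f T"
      using countable_closed_superset[OF fr i] by blast
    obtain U' where U': "U \<subseteq> U'" "basis U' (supported P I f (S \<union> T))"
      using basis_extend_countable[OF fr ok1(1,2) T(1,2,4) ok1(3)] by blast
    let ?M = "Inl ` (S \<union> T) \<union> Inr ` U'"
    have e: "Inl -` ?M = S \<union> T" "Inr -` ?M = U'" by auto
    have "x ` (S \<union> T) \<subseteq> supported P I f (S \<union> T)"
      using ok T(4) unfolding ok_def supported_def by blast
    then have "ok (S \<union> T) U'" using ok U'(2) T(2) unfolding ok_def by simp
    then have "?M \<in> F" unfolding F_def mem_Collect_eq e .
    moreover have "M \<subseteq> ?M"
    proof
      fix z assume "z \<in> M" then show "z \<in> ?M" using U'(1) unfolding S_def U_def by (cases z) auto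
    qed
    ultimately have "?M = M" by (rule M(2))
    then have "?M \<subseteq> M" by (rule equalityD1)
    then have "Inl i \<in> M" using T(3) by blast
    then show "i \<in> S" unfolding S_def by blast
  qed
  then have "supported P I f S = P" unfolding supported_def by blast
  then show ?thesis using ok unfolding ok_def by auto
qed

end

section \<open>Faces of polyhedral cones\<close>

lemma pointed_polyhedral_coneD:
  assumes "pointed_polyhedral_cone S"
  shows "polyhedron S" "convex S" "closed S" "0 \<in> S" "\<And>x c. x \<in> S \<Longrightarrow> 0 \<le> c \<Longrightarrow> c *\<^sub>R x \<in> S"
proof -
  show "polyhedron S" "convex S" "closed S"
    using assms polyhedron_imp_convex polyhedron_imp_closed unfolding pointed_polyhedral_cone_def by auto
  show c: "\<And>x c. x \<in> S \<Longrightarrow> 0 \<le> c \<Longrightarrow> c *\<^sub>R x \<in> S"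
    using assms unfolding pointed_polyhedral_cone_def cone_def by blast
  obtain x where "x \<in> S" using assms unfolding pointed_polyhedral_cone_def by blast
  then show "0 \<in> S" using c[of x 0] by simp
qed

lemma pointed_polyhedral_cone_face:
  assumes "pointed_polyhedral_cone S" "F \<in> cone_faces S"
  shows "pointed_polyhedral_cone F"
proof -
  note S = pointed_polyhedral_coneD[OF assms(1)]
  have F: "F face_of S" "F \<noteq> {}" using assms(2) unfolding cone_faces_def by auto
  have "conic S" using S(5) unfolding conic_def by blast
  then have "conic F" using face_of_conic F(1) by blast
  then have "cone F" unfolding conic_def cone_def by blast
  moreover have "polyhedron F" using face_of_polyhedron_polyhedron[OF S(1) F(1)] .
  ultimately show ?thesis using assms(1) F face_of_imp_subset[OF F(1)] unfolding pointed_polyhedral_cone_def by blast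
qed

lemma cone_faces_subset: "F \<in> cone_faces S \<Longrightarrow> F \<subseteq> S"
  unfolding cone_faces_def using face_of_imp_subset by blast

lemma cone_faces_face: "F \<in> cone_faces S \<Longrightarrow> cone_faces F = {F' \<in> cone_faces S. F' \<subseteq> F}"
  unfolding cone_faces_def using face_of_face by blast

lemma cone_faces_self: "pointed_polyhedral_cone S \<Longrightarrow> S \<in> cone_faces S"
  unfolding cone_faces_def using pointed_polyhedral_coneD(2,4) face_of_refl by blast

lemma Union_cone_faces: "pointed_polyhedral_cone S \<Longrightarrow> \<Union>(cone_faces S) = S"
  using cone_faces_self cone_faces_subset by blast

lemma zero_in_cone_face:
  assumes "pointed_polyhedral_cone S" "F \<in> cone_faces S"
  shows "0 \<in> F"
  using pointed_polyhedral_coneD(4) pointed_polyhedral_cone_face[OF assms] by blast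

lemma cone_faces_Int:
  assumes "pointed_polyhedral_cone S" "F \<in> cone_faces S" "F' \<in> cone_faces S"
  shows "F \<inter> F' \<in> cone_faces S"
  using zero_in_cone_face[OF assms(1)] assms(2,3) face_of_Int unfolding cone_faces_def by blast

section \<open>Subfans of the fan of faces, and facet normals\<close>

definition down_closed :: "'a::euclidean_space set \<Rightarrow> 'a set set \<Rightarrow> bool" where
  "down_closed S \<Sigma> \<longleftrightarrow> \<Sigma> \<subseteq> cone_faces S \<and> (\<forall>\<tau>\<in>\<Sigma>. \<forall>\<rho>\<in>cone_faces S. \<rho> \<subseteq> \<tau> \<longrightarrow> \<rho> \<in> \<Sigma>)"

text \<open>Among the faces of a single cone finiteness and the intersection property come for free;
  only closure under faces remains to be required.\<close>

lemma subfan_cone_faces: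
  assumes S: "pointed_polyhedral_cone S"
  shows "subfan \<Sigma> (cone_faces S) \<longleftrightarrow> down_closed S \<Sigma>"
proof
  assume "subfan \<Sigma> (cone_faces S)"
  then show "down_closed S \<Sigma>"
    unfolding subfan_def fan_def down_closed_def using cone_faces_face[of _ S] by blast
next
  assume d: "down_closed S \<Sigma>"
  then have sub: "\<Sigma> \<subseteq> cone_faces S" unfolding down_closed_def by blast
  have "finite (cone_faces S)"
    using finite_polyhedron_faces[OF pointed_polyhedral_coneD(1)[OF S]] unfolding cone_faces_def
    by (rule rev_finite_subset) auto
  then have "finite \<Sigma>" using sub finite_subset by blast
  moreover have "\<sigma> \<inter> \<tau> \<in> cone_faces \<sigma>" "\<sigma> \<inter> \<tau> \<in> cone_faces \<tau>" if "\<sigma> \<in> \<Sigma>" "\<tau> \<in> \<Sigma>" for \<sigma> \<tau>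
    using cone_faces_Int[OF S, of \<sigma> \<tau>] cone_faces_face[of \<sigma> S] cone_faces_face[of \<tau> S] that sub by auto
  moreover have "cone_faces \<sigma> \<subseteq> \<Sigma>" if "\<sigma> \<in> \<Sigma>" for \<sigma>
    using cone_faces_face[of \<sigma> S] d that unfolding down_closed_def by blast
  moreover have "pointed_polyhedral_cone \<sigma>" if "\<sigma> \<in> \<Sigma>" for \<sigma>
    using pointed_polyhedral_cone_face[OF S] that sub by blast
  ultimately show "subfan \<Sigma> (cone_faces S)" unfolding subfan_def fan_def using sub by blast
qed

text \<open>A system of inward normals, one for each facet. Facets are cones of smaller dimension in
  the same space, so the description is relative to \<open>span S\<close>. There normals are
  determined only modulo the orthogonal complement of the span, and up to scaling;
  \<open>inj\<close> expresses that one of them has been chosen.\<close>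

locale cone_normals =
  fixes S N :: "'a::euclidean_space set"
  assumes ppc: "pointed_polyhedral_cone S"
    and finN: "finite N"
    and S_eq: "S = {x \<in> span S. \<forall>n\<in>N. 0 \<le> n \<bullet> x}"
    and facet: "n \<in> N \<Longrightarrow> S \<inter> {x. n \<bullet> x = 0} facet_of S"
    and inj: "n \<in> N \<Longrightarrow> m \<in> N \<Longrightarrow> S \<inter> {x. n \<bullet> x = 0} = S \<inter> {x. m \<bullet> x = 0} \<Longrightarrow> n = m"
    and rel_int: "rel_interior S = {x \<in> S. \<forall>n\<in>N. 0 < n \<bullet> x}"
    and face_eq: "\<tau> \<in> cone_faces S \<Longrightarrow> \<tau> = {x \<in> S. \<forall>n\<in>N. (\<forall>y\<in>\<tau>. n \<bullet> y = 0) \<longrightarrow> n \<bullet> x = 0}"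

text \<open>Both sides have codimension one in \<open>span S\<close>: the left by the definition of
  a facet, the right because the hyperplane cannot contain \<open>S\<close>.\<close>

lemma span_facet:
  fixes S :: "'a::euclidean_space set"
  assumes 0: "0 \<in> S" "n \<bullet> 0 = 0" and f: "S \<inter> {x. n \<bullet> x = 0} facet_of S"
  shows "span (S \<inter> {x. n \<bullet> x = 0}) = span S \<inter> {x. n \<bullet> x = 0}"
proof -
  let ?C = "S \<inter> {x. n \<bullet> x = 0}" and ?H = "span S \<inter> {x. n \<bullet> x = 0}"
  have sH: "subspace ?H" by (intro subspace_inter subspace_span subspace_hyperplane)
  have "?C \<subseteq> ?H" using span_base by blast
  then have sub: "span ?C \<subseteq> ?H" using span_minimal sH by blast
  have a: "aff_dim ?C = aff_dim S - 1" using f unfolding facet_of_def by blast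
  have "0 \<in> affine hull S" "0 \<in> affine hull ?C" using 0 by (auto intro: hull_inc)
  then have "int (dim ?C) = int (dim S) - 1" using a aff_dim_zero by metis
  moreover have "dim ?H < dim S"
  proof -
    have "?H \<noteq> span S"
    proof
      assume "?H = span S"
      then have "?C = S" using span_base by blast
      then show False using a by simp
    qed
    then have "?H \<subset> span S" by blast
    then show ?thesis using dim_psubset[of ?H "span S"] sH by (simp add: span_eq_iff[THEN iffD2])
  qed
  ultimately have "dim ?H \<le> dim (span ?C)" by simp
  then show ?thesis using subspace_dim_equal[OF subspace_span sH sub] by blast
qed

text \<open>The normals come from an irredundant description by half-spaces. All bounds are 0, for a
  bounding hyperplane touches \<open>S\<close> at some \<open>x\<close> and the inequality must also
  hold at \<open>2 *\<^sub>R x\<close> and at 0.\<close>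

lemma obtain_cone_normals:
  fixes S :: "'a::euclidean_space set"
  assumes ppc: "pointed_polyhedral_cone S"
  obtains N where "cone_normals S N"
proof -
  note S = pointed_polyhedral_coneD[OF ppc]
  have aff: "affine hull S = span S" using affine_hull_span_0[of S] S(4) hull_inc by metis
  obtain F where F': "finite F \<and> S = affine hull S \<inter> \<Inter>F \<and> (\<forall>h\<in>F. \<exists>a b. a \<noteq> 0 \<and> h = {x. a \<bullet> x \<le> b}) \<and>
      (\<forall>F'. F' \<subset> F \<longrightarrow> S \<subset> affine hull S \<inter> \<Inter>F')"
    using iffD1[OF polyhedron_Int_affine_minimal S(1)] by (elim exE)
  note F = F'[THEN conjunct1] F'[THEN conjunct2, THEN conjunct1]
    F'[THEN conjunct2, THEN conjunct2, THEN conjunct1, rule_format]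
    F'[THEN conjunct2, THEN conjunct2, THEN conjunct2, rule_format]
  then obtain a b where ab: "\<And>h. h \<in> F \<Longrightarrow> a h \<noteq> 0 \<and> h = {x. a h \<bullet> x \<le> b h}" by metis
  have fac: "C facet_of S \<longleftrightarrow> (\<exists>h. h \<in> F \<and> C = S \<inter> {x. a h \<bullet> x = b h})" for C
    by (rule facet_of_polyhedron_explicit[OF F(1,2) ab F(4)])
  have b0: "b h = 0" if h: "h \<in> F" for h
  proof -
    have "S \<inter> {x. a h \<bullet> x = b h} \<noteq> {}" using fac h unfolding facet_of_def by blast
    then obtain x where x: "x \<in> S" "a h \<bullet> x = b h" by blast
    have Sh: "y \<in> S \<Longrightarrow> a h \<bullet> y \<le> b h" for y using F(2) ab[OF h] h by blast
    have "2 *\<^sub>R x \<in> S" using S(5)[OF x(1)] by simp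
    then have "2 * b h \<le> b h" using Sh x by fastforce
    moreover have "0 \<le> b h" using Sh[OF S(4)] by simp
    ultimately show ?thesis by simp
  qed
  define N where "N = (\<lambda>h. - a h) ` F"
  have h_eq: "h = {x. 0 \<le> (- a h) \<bullet> x}" if "h \<in> F" for h using ab[OF that] b0[OF that] by auto
  have S_eq: "S = {x \<in> span S. \<forall>n\<in>N. 0 \<le> n \<bullet> x}"
  proof -
    have "\<Inter>F = {x. \<forall>n\<in>N. 0 \<le> n \<bullet> x}" unfolding N_def using h_eq by auto
    then show ?thesis using F(2) unfolding aff by blast
  qed
  have ri: "rel_interior S = {x \<in> S. \<forall>n\<in>N. 0 < n \<bullet> x}"
    using rel_interior_polyhedron_explicit[OF F(1,2) ab F(4)] b0 unfolding N_def by auto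
  have facN: "S \<inter> {x. n \<bullet> x = 0} facet_of S" if "n \<in> N" for n
    using that fac b0 unfolding N_def by fastforce
  \<comment> \<open>Two half-spaces that cut out the same facet agree on \<open>span S\<close>, so
    one of them could be dropped, against irredundancy.\<close>
  have injF: "h = h'" if h: "h \<in> F" "h' \<in> F" and e: "S \<inter> {x. a h \<bullet> x = 0} = S \<inter> {x. a h' \<bullet> x = 0}" for h h'
  proof (rule ccontr)
    assume ne: "h \<noteq> h'"
    have N: "- a h \<in> N" "- a h' \<in> N" using h unfolding N_def by auto
    have sp: "span (S \<inter> {x. (- a g) \<bullet> x = 0}) = span S \<inter> {x. (- a g) \<bullet> x = 0}" if "- a g \<in> N" for g
      by (rule span_facet[OF S(4) _ facN[OF that]]) simp
    have H: "span S \<inter> {x. a h \<bullet> x = 0} = span S \<inter> {x. a h' \<bullet> x = 0}"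
      using sp[OF N(1)] sp[OF N(2)] e by simp
    have "rel_interior S \<noteq> {}" using S(2,4) rel_interior_eq_empty by blast
    then obtain p where p': "p \<in> rel_interior S" by blast
    then have p: "p \<in> S" "a h \<bullet> p < 0" "a h' \<bullet> p < 0" using ri N by force+
    have "affine hull S \<inter> \<Inter>(F - {h}) \<subseteq> h"
    proof
      fix x assume x: "x \<in> affine hull S \<inter> \<Inter>(F - {h})"
      then have xs: "x \<in> span S" "a h' \<bullet> x \<le> 0" using aff h ne ab[OF h(2)] b0[OF h(2)] by auto
      \<comment> \<open>Moving \<open>x\<close> along the interior point \<open>p\<close> onto the
        common hyperplane shows that both forms take values at \<open>x\<close> in the same ratio as
        at \<open>p\<close>, where both are negative.\<close>
      let ?y = "x - ((a h' \<bullet> x) / (a h' \<bullet> p)) *\<^sub>R p"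
      have "?y \<in> span S" using xs span_base[OF p(1)] by (intro span_diff span_scale) auto
      moreover have "a h' \<bullet> ?y = 0" using p by (simp add: inner_diff_right)
      ultimately have "a h \<bullet> ?y = 0" using H by blast
      then have "a h \<bullet> x = ((a h' \<bullet> x) / (a h' \<bullet> p)) * (a h \<bullet> p)" by (simp add: inner_diff_right)
      also have "\<dots> \<le> 0" using xs p by (intro mult_nonneg_nonpos divide_nonpos_nonpos) auto
      finally show "x \<in> h" using ab[OF h(1)] b0[OF h(1)] by auto
    qed
    then have "affine hull S \<inter> \<Inter>(F - {h}) \<subseteq> S" using F(2) h(1) by blast
    then show False using F(4)[of "F - {h}"] h(1) by blast
  qed
  have injN: "n = m" if n: "n \<in> N" and m: "m \<in> N" and e: "S \<inter> {x. n \<bullet> x = 0} = S \<inter> {x. m \<bullet> x = 0}" for n m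
  proof -
    obtain h where h1: "h \<in> F" "n = - a h" using n unfolding N_def by blast
    moreover obtain h' where h2: "h' \<in> F" "m = - a h'" using m unfolding N_def by blast
    ultimately have "S \<inter> {x. a h \<bullet> x = 0} = S \<inter> {x. a h' \<bullet> x = 0}" using e by simp
    then have "h = h'" by (rule injF[OF h1(1) h2(1)])
    then show ?thesis using h1(2) h2(2) by simp
  qed
  have fe: "\<tau> = {x \<in> S. \<forall>n\<in>N. (\<forall>y\<in>\<tau>. n \<bullet> y = 0) \<longrightarrow> n \<bullet> x = 0}" if t: "\<tau> \<in> cone_faces S" for \<tau>
  proof (cases "\<tau> = S")
    case True then show ?thesis by auto
  next
    case False
    have t: "\<tau> face_of S" "\<tau> \<noteq> {}" using t unfolding cone_faces_def by auto
    then have tS: "\<tau> \<subseteq> S" using face_of_imp_subset by blast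
    have "\<tau> = \<Inter>{S \<inter> {x. a h \<bullet> x = b h} | h. h \<in> F \<and> \<tau> \<subseteq> S \<inter> {x. a h \<bullet> x = b h}}"
      by (rule face_of_polyhedron_explicit[OF F(1,2) ab F(4) t False])
    moreover have "x \<in> S \<inter> {x. a h \<bullet> x = b h}"
      if "x \<in> {x \<in> S. \<forall>n\<in>N. (\<forall>y\<in>\<tau>. n \<bullet> y = 0) \<longrightarrow> n \<bullet> x = 0}" "h \<in> F" "\<tau> \<subseteq> S \<inter> {x. a h \<bullet> x = b h}" for x h
      using that b0[OF that(2)] unfolding N_def by auto
    ultimately have "{x \<in> S. \<forall>n\<in>N. (\<forall>y\<in>\<tau>. n \<bullet> y = 0) \<longrightarrow> n \<bullet> x = 0} \<subseteq> \<tau>" by blast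
    then show ?thesis using tS by blast
  qed
  have "cone_normals S N"
    by unfold_locales (use ppc F(1) S_eq facN injN ri fe in \<open>auto simp: N_def\<close>)
  then show ?thesis using that by blast
qed

section \<open>Active normals, back faces and front faces\<close>

context cone_normals
begin

lemmas S_props = pointed_polyhedral_coneD[OF ppc]

text \<open>The normals of the facets that contain \<tau>; a larger face has fewer of them.\<close>

definition act :: "'a set \<Rightarrow> 'a set" where
  "act \<tau> = {n\<in>N. \<forall>y\<in>\<tau>. n \<bullet> y = 0}"

lemma act_anti: "\<rho> \<subseteq> \<tau> \<Longrightarrow> act \<tau> \<subseteq> act \<rho>"
  unfolding act_def by blast

lemma mem_face: "\<tau> \<in> cone_faces S \<Longrightarrow> x \<in> \<tau> \<longleftrightarrow> x \<in> S \<and> (\<forall>n\<in>act \<tau>. n \<bullet> x = 0)"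
  using face_eq[of \<tau>] unfolding act_def by blast

lemma mem_S: "x \<in> S \<longleftrightarrow> x \<in> span S \<and> (\<forall>n\<in>N. 0 \<le> n \<bullet> x)"
  using S_eq by blast

lemma facet_mem: "n \<in> N \<Longrightarrow> S \<inter> {x. n \<bullet> x = 0} \<in> cone_faces S"
  using facet unfolding facet_of_def cone_faces_def by blast

lemma face_rel_interior_nonempty: "\<tau> \<in> cone_faces S \<Longrightarrow> rel_interior \<tau> \<noteq> {}"
  unfolding cone_faces_def using face_of_imp_convex rel_interior_eq_empty by blast

text \<open>A face of \<open>S\<close> that meets the relative interior of \<tau> contains \<tau>;
  this is applied to the facet of \<open>n\<close>.\<close>

lemma rel_interior_act:
  assumes "\<tau> \<in> cone_faces S" "x \<in> rel_interior \<tau>" "n \<in> N"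
  shows "n \<bullet> x = 0 \<longleftrightarrow> n \<in> act \<tau>"
proof
  have x: "x \<in> \<tau>" using assms(2) rel_interior_subset by blast
  assume "n \<bullet> x = 0"
  then have "(S \<inter> {x. n \<bullet> x = 0}) \<inter> rel_interior \<tau> \<noteq> {}" using assms x cone_faces_subset[OF assms(1)] by blast
  then have "\<tau> \<subseteq> S \<inter> {x. n \<bullet> x = 0}"
    using subset_of_face_of[of "S \<inter> {x. n \<bullet> x = 0}" S \<tau>] facet_mem[OF assms(3)] cone_faces_subset[OF assms(1)]
    unfolding cone_faces_def by blast
  then show "n \<in> act \<tau>" using assms(3) unfolding act_def by blast
next
  assume "n \<in> act \<tau>"
  then show "n \<bullet> x = 0" using assms(2) rel_interior_subset unfolding act_def by blast
qed

lemma act_S: "act S = {}"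
proof -
  obtain x where "x \<in> rel_interior S" using face_rel_interior_nonempty cone_faces_self[OF ppc] by blast
  then show ?thesis using rel_int unfolding act_def by force
qed

definition min_face :: "'a \<Rightarrow> 'a set" where
  "min_face y = {x \<in> S. \<forall>n\<in>N. n \<bullet> y = 0 \<longrightarrow> n \<bullet> x = 0}"

text \<open>The sum of the normals vanishing at \<open>y\<close> is nonnegative on \<open>S\<close>,
  and it vanishes at a point only if each summand does. Hence the set is cut out by one supporting
  hyperplane.\<close>

lemma min_face:
  assumes y: "y \<in> S"
  shows "y \<in> min_face y" "min_face y \<in> cone_faces S" "act (min_face y) = {n\<in>N. n \<bullet> y = 0}"
proof -
  show 1: "y \<in> min_face y" unfolding min_face_def using y by blast
  let ?M = "{n\<in>N. n \<bullet> y = 0}"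
  have fM: "finite ?M" using finN by simp
  have nn: "n \<in> ?M \<Longrightarrow> x \<in> S \<Longrightarrow> 0 \<le> n \<bullet> x" for n x using mem_S[of x] by blast
  have "S \<inter> {x. (\<Sum>n\<in>?M. n) \<bullet> x = 0} face_of S"
  proof (rule face_of_Int_supporting_hyperplane_ge[OF S_props(2)])
    fix x assume "x \<in> S"
    then show "0 \<le> (\<Sum>n\<in>?M. n) \<bullet> x" unfolding inner_sum_left using nn by (intro sum_nonneg)
  qed
  moreover have "S \<inter> {x. (\<Sum>n\<in>?M. n) \<bullet> x = 0} = min_face y"
    unfolding min_face_def using sum_nonneg_eq_0_iff[OF fM nn] by (auto simp: inner_sum_left)
  ultimately show "min_face y \<in> cone_faces S" unfolding cone_faces_def using 1 by auto
  show "act (min_face y) = ?M" unfolding act_def using 1 unfolding min_face_def by blast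
qed

lemma eventually_in_cone:
  assumes "x \<in> span S" "v \<in> span S" and "\<And>n. n \<in> N \<Longrightarrow> 0 < n \<bullet> x \<or> (n \<bullet> x = 0 \<and> 0 \<le> n \<bullet> v)"
  shows "\<exists>e>0. \<forall>t\<in>{0..<e}. x + t *\<^sub>R v \<in> S"
proof -
  have "\<exists>e>0. \<forall>t\<in>{0..<e}. 0 \<le> n \<bullet> (x + t *\<^sub>R v)" if n: "n \<in> N" for n
  proof (cases "0 \<le> n \<bullet> v")
    case True
    have "0 \<le> n \<bullet> (x + t *\<^sub>R v)" if "t \<in> {0..<1}" for t
      using assms(3)[OF n] True that by (auto simp: inner_add_right)
    then show ?thesis by (intro exI[of _ 1]) auto
  next
    case False
    then have p: "0 < n \<bullet> x" using assms(3)[OF n] by auto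
    have "0 \<le> n \<bullet> (x + t *\<^sub>R v)" if t: "t \<in> {0..<(n \<bullet> x) / (- (n \<bullet> v))}" for t
    proof -
      have "t < (n \<bullet> x) / (- (n \<bullet> v))" using t by (simp only: atLeastLessThan_iff)
      then have "t * (- (n \<bullet> v)) < n \<bullet> x" using pos_less_divide_eq[of "- (n \<bullet> v)" t] False by simp
      then show ?thesis by (simp add: inner_add_right)
    qed
    moreover have "0 < (n \<bullet> x) / (- (n \<bullet> v))" using p False by (intro divide_pos_pos) auto
    ultimately show ?thesis by blast
  qed
  then obtain e where e: "\<And>n. n \<in> N \<Longrightarrow> e n > 0 \<and> (\<forall>t\<in>{0..<e n}. 0 \<le> n \<bullet> (x + t *\<^sub>R v))" by metis
  define \<epsilon> where "\<epsilon> = Min (insert 1 (e ` N))"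
  have "\<epsilon> > 0" unfolding \<epsilon>_def using finN e by (subst Min_gr_iff) auto
  moreover have "\<epsilon> \<le> e n" if "n \<in> N" for n unfolding \<epsilon>_def using finN that by (intro Min_le) auto
  then have "x + t *\<^sub>R v \<in> S" if "t \<in> {0..<\<epsilon>}" for t
    unfolding mem_S using e that assms(1,2) by (auto intro!: span_add span_scale) fastforce
  ultimately show ?thesis by blast
qed

text \<open>Inactive normals are positive on the relative interior, so a sufficiently short move
  cannot violate them. Only active normals matter, and these see nothing but the sign on
  \<open>v\<close>.\<close>

lemma back_faces_iff:
  assumes v: "v \<in> span S" and t: "\<tau> \<in> cone_faces S"
  shows "\<tau> \<in> back_faces S v \<longleftrightarrow> (\<forall>n\<in>act \<tau>. 0 \<le> n \<bullet> v)"
proof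
  assume b: "\<tau> \<in> back_faces S v"
  obtain x where x: "x \<in> rel_interior \<tau>" using face_rel_interior_nonempty[OF t] by blast
  then obtain e where e: "e > 0" "{0..<e} \<subseteq> {t. x + t *\<^sub>R v \<in> S}" using b unfolding back_faces_def by blast
  have "e / 2 \<in> {0..<e}" using e(1) by simp
  then have in_S: "x + (e / 2) *\<^sub>R v \<in> S" using e(2) by blast
  show "\<forall>n\<in>act \<tau>. 0 \<le> n \<bullet> v"
  proof
    fix n assume n: "n \<in> act \<tau>"
    then have "n \<in> N" unfolding act_def by blast
    then have "0 \<le> n \<bullet> (x + (e / 2) *\<^sub>R v)" "n \<bullet> x = 0" using in_S mem_S rel_interior_act[OF t x] n by blast+
    then show "0 \<le> n \<bullet> v" using e(1) by (simp add: inner_add_right zero_le_mult_iff)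
  qed
next
  assume a: "\<forall>n\<in>act \<tau>. 0 \<le> n \<bullet> v"
  have "\<exists>e>0. {0..<e} \<subseteq> {t. x + t *\<^sub>R v \<in> S}" if x: "x \<in> rel_interior \<tau>" for x
  proof -
    have xS: "x \<in> S" using x rel_interior_subset cone_faces_subset[OF t] by blast
    then have "0 < n \<bullet> x \<or> n \<bullet> x = 0 \<and> 0 \<le> n \<bullet> v" if "n \<in> N" for n
      using rel_interior_act[OF t x that] a mem_S[of x] that by force
    from eventually_in_cone[OF span_base[OF xS] v this] show ?thesis by blast
  qed
  then show "\<tau> \<in> back_faces S v" unfolding back_faces_def using t by blast
qed

lemma front_faces_iff:
  assumes v: "v \<in> span S" and t: "\<tau> \<in> cone_faces S"
  shows "\<tau> \<in> front_faces S v \<longleftrightarrow> (\<forall>n\<in>act \<tau>. n \<bullet> v \<le> 0)"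
  unfolding front_faces_def using back_faces_iff[OF span_neg[OF v] t] by simp

lemma back_subset: "back_faces S v \<subseteq> cone_faces S" "front_faces S v \<subseteq> cone_faces S"
  unfolding front_faces_def back_faces_def by auto

lemma back_up:
  assumes "v \<in> span S" "\<tau> \<in> back_faces S v" "\<rho> \<in> cone_faces S" "\<tau> \<subseteq> \<rho>"
  shows "\<rho> \<in> back_faces S v"
proof -
  have "\<tau> \<in> cone_faces S" using assms(2) back_subset by blast
  then show ?thesis using assms back_faces_iff[OF assms(1)] act_anti[OF assms(4)] by blast
qed

lemma front_up:
  assumes "v \<in> span S" "\<tau> \<in> front_faces S v" "\<rho> \<in> cone_faces S" "\<tau> \<subseteq> \<rho>"
  shows "\<rho> \<in> front_faces S v"
  using back_up[OF span_neg[OF assms(1)]] assms unfolding front_faces_def by blast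

lemma S_back: "v \<in> span S \<Longrightarrow> S \<in> back_faces S v"
  using back_faces_iff[OF _ cone_faces_self[OF ppc]] act_S by simp

lemma S_front: "v \<in> span S \<Longrightarrow> S \<in> front_faces S v"
  using S_back[OF span_neg] unfolding front_faces_def by blast

text \<open>Inside \<open>\<rho>\<close>, a point near \<open>\<tau>\<close> pushed in direction \<open>v\<close> leaves \<open>\<rho>\<close> through the required face.\<close>

lemma exit_face:
  assumes v: "v \<in> span S" and t: "\<tau> \<in> cone_faces S" and r: "\<rho> \<in> front_faces S v"
    and sub: "\<tau> \<subseteq> \<rho>" and nb: "\<tau> \<notin> back_faces S v"
  shows "\<exists>\<gamma>\<in>strict_front_faces S v. \<tau> \<subseteq> \<gamma> \<and> \<gamma> \<subseteq> \<rho>"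
proof (cases "\<rho> \<in> back_faces S v")
  case False
  then have "\<rho> \<in> strict_front_faces S v" using r unfolding strict_front_faces_def by blast
  then show ?thesis using sub by blast
next
  case True
  have rF: "\<rho> \<in> cone_faces S" using r back_subset by blast
  \<comment> \<open>In the remaining case \<rho> is both back and front, so \<open>v\<close> is
    parallel to \<rho> and moving along \<open>v\<close> keeps the equations of \<rho>.\<close>
  have r0: "n \<bullet> v = 0" if "n \<in> act \<rho>" for n
    using that True r back_faces_iff[OF v rF] front_faces_iff[OF v rF] by (meson order_antisym)
  define J where "J = {n\<in>act \<tau>. n \<bullet> v < 0}"
  have finJ: "finite J" unfolding J_def act_def using finN by simp
  have neJ: "J \<noteq> {}" using nb back_faces_iff[OF v t] unfolding J_def by force
  obtain x where x: "x \<in> rel_interior \<tau>" using face_rel_interior_nonempty[OF t] by blast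
  obtain z where z: "z \<in> rel_interior \<rho>" using face_rel_interior_nonempty[OF rF] by blast
  have xt: "x \<in> \<tau>" and zr: "z \<in> \<rho>" using x z rel_interior_subset by blast+
  have xS: "x \<in> S" and zS: "z \<in> S" using xt zr cone_faces_subset t rF by blast+
  have zn: "0 \<le> n \<bullet> z" "0 \<le> n \<bullet> x" if "n \<in> N" for n using zS xS mem_S that by blast+
  have zJ: "0 < n \<bullet> z" if "n \<in> J" for n
  proof -
    have n: "n \<in> N" "n \<notin> act \<rho>" using that r0[of n] unfolding J_def act_def by auto
    then have "n \<bullet> z \<noteq> 0" using rel_interior_act[OF rF z] by blast
    then show ?thesis using zn(1)[OF n(1)] by simp
  qed
  \<comment> \<open>The first time at which the ray from \<open>z\<close> in direction
    \<open>v\<close> meets the hyperplane of a normal active on \<tau> and negative on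
    \<open>v\<close>. Up to then all normals active on \<tau> stay nonnegative.\<close>
  define s where "s = Min ((\<lambda>n. (n \<bullet> z) / (- (n \<bullet> v))) ` J)"
  have s_in: "s \<in> (\<lambda>n. (n \<bullet> z) / (- (n \<bullet> v))) ` J" unfolding s_def using finJ neJ by (intro Min_in) auto
  then obtain m where m: "m \<in> J" "s = (m \<bullet> z) / (- (m \<bullet> v))" by blast
  have mv: "m \<bullet> v < 0" using m(1) unfolding J_def by blast
  have s0: "0 < s" unfolding m(2) using zJ[OF m(1)] mv by (intro divide_pos_pos) auto
  have s_le: "s \<le> (n \<bullet> z) / (- (n \<bullet> v))" if "n \<in> J" for n
    unfolding s_def using finJ that by (intro Min_le) auto
  define q where "q = z + s *\<^sub>R v"
  have q_sp: "q \<in> span S" unfolding q_def using span_base[OF zS] v by (intro span_add span_scale)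
  have qm: "m \<bullet> q = 0" unfolding q_def inner_add_right inner_scaleR_right m(2) using mv by (simp add: field_simps)
  have qn: "0 \<le> n \<bullet> q" if "n \<in> act \<tau>" for n
  proof (cases "n \<in> J")
    case True
    then have "0 < - (n \<bullet> v)" unfolding J_def by simp
    then have "s * (- (n \<bullet> v)) \<le> n \<bullet> z" using s_le[OF True] pos_le_divide_eq by blast
    then show ?thesis unfolding q_def by (simp add: inner_add_right)
  next
    case False
    then show ?thesis using that zn s0 unfolding q_def J_def act_def by (simp add: inner_add_right)
  qed
  \<comment> \<open>The exit point \<open>q\<close> satisfies the constraints active on \<tau>,
    though perhaps not the others. Using it as a direction from \<open>x\<close> therefore stays in
    \<open>S\<close> for a short while.\<close>
  have pos: "0 < n \<bullet> x \<or> n \<bullet> x = 0 \<and> 0 \<le> n \<bullet> q" if "n \<in> N" for n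
    using rel_interior_act[OF t x that] qn zn(2)[OF that] by fastforce
  obtain e0 where e0: "e0 > 0" "\<forall>c\<in>{0..<e0}. x + c *\<^sub>R q \<in> S"
    using eventually_in_cone[OF span_base[OF xS] q_sp pos] by blast
  text \<open>Halving the parameter keeps the inequalities that are strict at \<open>x\<close> strict.\<close>
  define c where "c = e0 / 4"
  have c: "0 < c" "x + c *\<^sub>R q \<in> S" "x + (2 * c) *\<^sub>R q \<in> S" unfolding c_def using e0 by auto
  define y where "y = x + c *\<^sub>R q"
  have yS: "y \<in> S" using c(2) unfolding y_def .
  have act_y: "n \<in> act \<tau> \<and> n \<bullet> q = 0" if n: "n \<in> N" "n \<bullet> y = 0" for n
  proof -
    have e: "n \<bullet> x + c * (n \<bullet> q) = 0" using n(2) unfolding y_def by (simp add: inner_add_right)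
    have "0 \<le> n \<bullet> (x + (2 * c) *\<^sub>R q)" using c(3) mem_S n(1) by blast
    then have "0 \<le> n \<bullet> x + 2 * (c * (n \<bullet> q))" by (simp add: inner_add_right)
    with e zn(2)[OF n(1)] have "n \<bullet> x = 0" by linarith
    with e c(1) show ?thesis using rel_interior_act[OF t x n(1)] by simp
  qed
  let ?g = "min_face y"
  note g = min_face[OF yS]
  have "\<tau> \<subseteq> ?g"
    using act_y cone_faces_subset[OF t] unfolding min_face_def act_def by blast
  moreover have "?g \<subseteq> \<rho>"
  proof
    fix w assume w: "w \<in> ?g"
    have "n \<bullet> w = 0" if n: "n \<in> act \<rho>" for n
    proof -
      have "n \<bullet> x = 0" "n \<bullet> z = 0" "n \<bullet> v = 0" "n \<in> N" using n r0[OF n] xt zr sub unfolding act_def by auto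
      then have "n \<bullet> y = 0" unfolding y_def q_def by (simp add: inner_add_right)
      then show ?thesis using w \<open>n \<in> N\<close> unfolding min_face_def by blast
    qed
    then show "w \<in> \<rho>" using mem_face[OF rF] w unfolding min_face_def by blast
  qed
  \<comment> \<open>A normal vanishing at \<open>y\<close> vanishes at
    \<open>q = z + s *\<^sub>R v\<close> as well. Since it is nonnegative at \<open>z\<close> and
    \<open>s > 0\<close>, it cannot be positive on \<open>v\<close>. The minimizing normal
    \<open>m\<close> is among them and negative on \<open>v\<close>, which excludes a back
    face.\<close>
  moreover have "?g \<in> front_faces S v"
    unfolding front_faces_iff[OF v g(2)] g(3)
  proof
    fix n assume n: "n \<in> {n\<in>N. n \<bullet> y = 0}"
    then have "n \<bullet> q = 0" using act_y by blast
    then have "n \<bullet> z + s * (n \<bullet> v) = 0" unfolding q_def by (simp add: inner_add_right)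
    then show "n \<bullet> v \<le> 0" using zn(1)[of n] s0 n by (smt (verit) mem_Collect_eq mult_pos_pos)
  qed
  moreover have "?g \<notin> back_faces S v"
  proof -
    have "m \<in> N" "m \<bullet> x = 0" using m(1) xt unfolding J_def act_def by auto
    then have "m \<bullet> y = 0" unfolding y_def using qm by (simp add: inner_add_right)
    then have "m \<in> act ?g" unfolding g(3) using \<open>m \<in> N\<close> by blast
    then show ?thesis unfolding back_faces_iff[OF v g(2)] using mv by force
  qed
  ultimately show ?thesis unfolding strict_front_faces_def by blast
qed

text \<open>The common back face is essential: a short move along \<open>v\<close> from its interior
  stays in \<open>S\<close>, and normals active on either front face are forced to vanish on
  \<open>v\<close>. So the move stays in both faces, hence in their intersection, which makes the
  intersection parallel to \<open>v\<close>.\<close>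

lemma front_Int:
  assumes v: "v \<in> span S" and t: "\<tau> \<in> back_faces S v" and r: "\<rho> \<in> front_faces S v" "\<rho>' \<in> front_faces S v"
    and sub: "\<tau> \<subseteq> \<rho>" "\<tau> \<subseteq> \<rho>'"
  shows "\<rho> \<inter> \<rho>' \<in> front_faces S v"
proof -
  have F: "\<tau> \<in> cone_faces S" "\<rho> \<in> cone_faces S" "\<rho>' \<in> cone_faces S" using t r back_subset by blast+
  have I: "\<rho> \<inter> \<rho>' \<in> cone_faces S" using cone_faces_Int[OF ppc F(2,3)] .
  obtain x where x: "x \<in> rel_interior \<tau>" using face_rel_interior_nonempty[OF F(1)] by blast
  then have xt: "x \<in> \<tau>" using rel_interior_subset by blast
  obtain e where e: "e > 0" "{0..<e} \<subseteq> {t. x + t *\<^sub>R v \<in> S}" using t x unfolding back_faces_def by blast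
  have "e / 2 \<in> {0..<e}" using e(1) by simp
  then have yS: "x + (e / 2) *\<^sub>R v \<in> S" using e(2) by blast
  have in_r: "x + (e / 2) *\<^sub>R v \<in> \<rho>0" if "\<rho>0 \<in> front_faces S v" "\<tau> \<subseteq> \<rho>0" for \<rho>0
  proof -
    have f: "\<rho>0 \<in> cone_faces S" using that back_subset by blast
    have "n \<bullet> (x + (e / 2) *\<^sub>R v) = 0" if n: "n \<in> act \<rho>0" for n
    proof -
      have "n \<bullet> v \<le> 0" using front_faces_iff[OF v f] \<open>\<rho>0 \<in> front_faces S v\<close> n by blast
      moreover have "0 \<le> n \<bullet> v" using back_faces_iff[OF v F(1)] t n act_anti[OF \<open>\<tau> \<subseteq> \<rho>0\<close>] by blast
      moreover have "n \<bullet> x = 0" using n xt \<open>\<tau> \<subseteq> \<rho>0\<close> unfolding act_def by blast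
      ultimately show ?thesis by (simp add: inner_add_right)
    qed
    then show ?thesis using mem_face[OF f] yS by blast
  qed
  have y: "x + (e / 2) *\<^sub>R v \<in> \<rho> \<inter> \<rho>'" "x \<in> \<rho> \<inter> \<rho>'" using in_r r sub xt by blast+
  have "n \<bullet> v \<le> 0" if n: "n \<in> act (\<rho> \<inter> \<rho>')" for n
  proof -
    have "n \<bullet> (x + (e / 2) *\<^sub>R v) = 0" "n \<bullet> x = 0" using n y unfolding act_def by blast+
    then show ?thesis using e(1) by (simp add: inner_add_right)
  qed
  then show ?thesis using front_faces_iff[OF v I] by blast
qed

end

section \<open>Polynomial functions on cones\<close>

definition hom_poly :: "('a::euclidean_space \<Rightarrow> real) \<Rightarrow> nat \<Rightarrow> bool" where
  "hom_poly p d \<longleftrightarrow> real_polynomial_function p \<and> (\<forall>c x. p (c *\<^sub>R x) = c ^ d * p x)"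

lemma hom_polyD: "hom_poly p d \<Longrightarrow> real_polynomial_function p" "hom_poly p d \<Longrightarrow> p (c *\<^sub>R x) = c ^ d * p x"
  unfolding hom_poly_def by auto

lemma hom_poly_0: "hom_poly (\<lambda>_. 0) d"
  unfolding hom_poly_def by (auto intro: real_polynomial_function.intros(2))

lemma hom_poly_add: "hom_poly p d \<Longrightarrow> hom_poly q d \<Longrightarrow> hom_poly (\<lambda>x. p x + q x) d"
  unfolding hom_poly_def by (auto intro: real_polynomial_function.intros(3) simp: distrib_left)

lemma hom_poly_minus: "hom_poly p d \<Longrightarrow> hom_poly (\<lambda>x. - p x) d"
  unfolding hom_poly_def by (auto intro: real_polynomial_function_minus)

lemma hom_poly_mult: "hom_poly p d \<Longrightarrow> hom_poly q e \<Longrightarrow> hom_poly (\<lambda>x. p x * q x) (d + e)"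
  unfolding hom_poly_def by (auto intro: real_polynomial_function.intros(4) simp: power_add)

lemma hom_poly_sum: "finite I \<Longrightarrow> (\<And>i. i \<in> I \<Longrightarrow> hom_poly (p i) d) \<Longrightarrow> hom_poly (\<lambda>x. \<Sum>i\<in>I. p i x) d"
  by (induct I rule: finite_induct) (auto simp: hom_poly_0 hom_poly_add)

lemma hom_poly_linear: "bounded_linear f \<Longrightarrow> hom_poly f 1"
  unfolding hom_poly_def by (auto intro: real_polynomial_function.intros(1) simp: bounded_linear.linear linear_scale)

lemma real_polynomial_function_decompose:
  fixes p :: "'a::euclidean_space \<Rightarrow> real"
  assumes "real_polynomial_function p"
  shows "\<exists>N h. (\<forall>d. hom_poly (h d) d) \<and> (\<forall>d>N. h d = (\<lambda>_. 0)) \<and> p = (\<lambda>x. \<Sum>d\<le>N. h d x)"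
  using assms
proof (induct rule: real_polynomial_function.induct)
  case (linear f)
  then have "hom_poly (if d = 1 then f else (\<lambda>_. 0)) d" for d
    using hom_poly_linear hom_poly_0 by auto
  then show ?case by (intro exI[of _ 1] exI[of _ "\<lambda>d. if d = 1 then f else (\<lambda>_. 0)"]) auto
next
  case (const c)
  have c: "hom_poly (\<lambda>_. c) 0" unfolding hom_poly_def by auto
  show ?case
    by (intro exI[of _ "0::nat"] exI[of _ "\<lambda>d. if d = 0 then (\<lambda>_. c) else (\<lambda>_. 0)"]) (auto simp: c hom_poly_0)
next
  case (add f g)
  from add(2) obtain M h where h: "\<And>d. hom_poly (h d) d" "\<And>d. d > M \<Longrightarrow> h d = (\<lambda>_. 0)" "f = (\<lambda>x. \<Sum>d\<le>M. h d x)"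
    by blast
  from add(4) obtain N k where k: "\<And>d. hom_poly (k d) d" "\<And>d. d > N \<Longrightarrow> k d = (\<lambda>_. 0)" "g = (\<lambda>x. \<Sum>d\<le>N. k d x)"
    by blast
  have "f x = (\<Sum>d\<le>max M N. h d x)" "g x = (\<Sum>d\<le>max M N. k d x)" for x
    unfolding h(3) k(3) by (rule sum.mono_neutral_left; use h(2) k(2) in auto)+
  then show ?case
    by (intro exI[of _ "max M N"] exI[of _ "\<lambda>d x. h d x + k d x"])
      (use h k in \<open>auto simp: sum.distrib hom_poly_add\<close>)
next
  case (mult f g)
  from mult(2) obtain M h where h: "\<And>d. hom_poly (h d) d" "\<And>d. d > M \<Longrightarrow> h d = (\<lambda>_. 0)" "f = (\<lambda>x. \<Sum>d\<le>M. h d x)"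
    by blast
  from mult(4) obtain N k where k: "\<And>d. hom_poly (k d) d" "\<And>d. d > N \<Longrightarrow> k d = (\<lambda>_. 0)" "g = (\<lambda>x. \<Sum>d\<le>N. k d x)"
    by blast
  let ?l = "\<lambda>d x. \<Sum>i\<le>d. h i x * k (d - i) x"
  have "hom_poly (?l d) d" for d
    by (rule hom_poly_sum) (use hom_poly_mult[OF h(1) k(1)] in \<open>auto, metis le_add_diff_inverse\<close>)
  moreover have "?l d = (\<lambda>_. 0)" if "d > M + N" for d
  proof -
    have "h i x * k (d - i) x = 0" if "i \<le> d" for i x
    proof (cases "i > M")
      case False
      then have "d - i > N" using \<open>d > M + N\<close> by linarith
      then show ?thesis using k(2) by simp
    qed (use h(2) in simp)
    then show ?thesis by (intro ext sum.neutral ballI) simp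
  qed
  moreover have "f x * g x = (\<Sum>d\<le>M + N. ?l d x)" for x
    using polynomial_product[of M "\<lambda>i. h i x" N "\<lambda>i. k i x" 1] h k by simp
  ultimately show ?case by (intro exI[of _ "M + N"] exI[of _ ?l]) auto
qed

text \<open>Comparison of coefficients of polynomials in \<open>c\<close>. With \<open>a d\<close>
  the value of the degree \<open>d\<close> part at a point, it reads off homogeneous components from
  the behaviour under scaling.\<close>

lemma homogeneous_coefficient:
  fixes a :: "nat \<Rightarrow> real"
  assumes "\<And>c. (\<Sum>d\<le>N. c ^ d * a d) = c ^ m * b"
  shows "b = (if m \<le> N then a m else 0)"
proof -
  let ?K = "max N m"
  have "(\<Sum>d\<le>?K. (if d \<le> N then a d else 0) * c ^ d) = (\<Sum>d\<le>?K. (if d = m then b else 0) * c ^ d)" for c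
  proof -
    have "(\<Sum>d\<le>?K. (if d \<le> N then a d else 0) * c ^ d) = (\<Sum>d\<le>N. c ^ d * a d)"
      by (rule sum.mono_neutral_cong_right) auto
    moreover have "(\<Sum>d\<le>?K. (if d = m then b else 0) * c ^ d) = (\<Sum>d\<in>{m}. c ^ d * b)"
      by (rule sum.mono_neutral_cong_right) auto
    ultimately show ?thesis using assms by simp
  qed
  then have "\<forall>i\<le>?K. (if i \<le> N then a i else 0) = (if i = m then b else 0)"
    using polyfun_eq_coeffs[of "\<lambda>d. if d \<le> N then a d else 0" ?K "\<lambda>d. if d = m then b else 0"] by blast
  then have "(if m \<le> N then a m else 0) = b" by (metis max.cobounded2)
  then show ?thesis by simp
qed

text \<open>A form of the factor theorem: when \<open>n \<bullet> v = 1\<close>, the shifted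
  argument is the projection of \<open>x\<close> along \<open>v\<close> onto the hyperplane of
  \<open>n\<close>.\<close>

lemma polynomial_linear_division:
  fixes p :: "'a::euclidean_space \<Rightarrow> real"
  assumes "real_polynomial_function p"
  shows "\<exists>q. real_polynomial_function q \<and> (\<forall>x. p x - p (x - (n \<bullet> x) *\<^sub>R v) = (n \<bullet> x) * q x)"
  using assms
proof (induct rule: real_polynomial_function.induct)
  case (linear f)
  then have "f x - f (x - (n \<bullet> x) *\<^sub>R v) = (n \<bullet> x) * f v" for x
    by (simp add: bounded_linear.linear linear_diff linear_scale)
  then show ?case by (intro exI[of _ "\<lambda>_. f v"]) (simp add: real_polynomial_function.intros(2))
next
  case (const c)
  then show ?case by (intro exI[of _ "\<lambda>_. 0"]) (simp add: real_polynomial_function.intros(2))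
next
  case (add f g)
  from add(2) obtain q where q: "real_polynomial_function q" "\<And>x. f x - f (x - (n \<bullet> x) *\<^sub>R v) = (n \<bullet> x) * q x" by blast
  from add(4) obtain r where r: "real_polynomial_function r" "\<And>x. g x - g (x - (n \<bullet> x) *\<^sub>R v) = (n \<bullet> x) * r x" by blast
  have "f x + g x - (f (x - (n \<bullet> x) *\<^sub>R v) + g (x - (n \<bullet> x) *\<^sub>R v)) = (n \<bullet> x) * (q x + r x)" for x
    using q(2)[of x] r(2)[of x] unfolding distrib_left by linarith
  then show ?case using real_polynomial_function.intros(3)[OF q(1) r(1)] by blast
next
  case (mult f g)
  from mult(2) obtain q where q: "real_polynomial_function q" "\<And>x. f x - f (x - (n \<bullet> x) *\<^sub>R v) = (n \<bullet> x) * q x" by blast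
  from mult(4) obtain r where r: "real_polynomial_function r" "\<And>x. g x - g (x - (n \<bullet> x) *\<^sub>R v) = (n \<bullet> x) * r x" by blast
  let ?s = "\<lambda>x. q x * g x + (f x - (n \<bullet> x) * q x) * r x"
  have "real_polynomial_function (\<lambda>x. n \<bullet> x)" by (simp add: bounded_linear_inner_right real_polynomial_function.intros(1))
  then have "real_polynomial_function ?s"
    using q(1) r(1) mult by (intro real_polynomial_function.intros(3) real_polynomial_function.intros(4) real_polynomial_function_diff) auto
  moreover have "f x * g x - f (x - (n \<bullet> x) *\<^sub>R v) * g (x - (n \<bullet> x) *\<^sub>R v) = (n \<bullet> x) * ?s x" for x
  proof -
    have 1: "f (x - (n \<bullet> x) *\<^sub>R v) = f x - (n \<bullet> x) * q x" "g (x - (n \<bullet> x) *\<^sub>R v) = g x - (n \<bullet> x) * r x"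
      using q(2)[of x] r(2)[of x] by linarith+
    show ?thesis unfolding 1 by (simp add: algebra_simps)
  qed
  ultimately show ?case by blast
qed

text \<open>On the line through \<open>y\<close> and a relative interior point of \<open>C\<close>,
  \<open>p\<close> is a univariate polynomial that vanishes on an interval.\<close>

lemma polynomial_zero_on_span:
  fixes p :: "'a::euclidean_space \<Rightarrow> real"
  assumes p: "real_polynomial_function p" and C: "convex C" "0 \<in> C"
    and z: "\<And>x. x \<in> C \<Longrightarrow> p x = 0" and y: "y \<in> span C"
  shows "p y = 0"
proof -
  obtain x0 where x0: "x0 \<in> rel_interior C" using C rel_interior_eq_empty by blast
  have aff: "affine hull C = span C" using affine_hull_span_0 C(2) hull_inc by metis
  obtain e where e: "e > 0" "ball x0 e \<inter> affine hull C \<subseteq> C"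
    using x0 mem_rel_interior_ball[of x0 C] by blast
  have x0C: "x0 \<in> C" using x0 rel_interior_subset by blast
  let ?w = "y - x0"
  let ?g = "\<lambda>s::real. p (x0 + s *\<^sub>R ?w)"
  have "polynomial_function (\<lambda>s::real. x0 + s *\<^sub>R ?w)"
    by (intro polynomial_function_add polynomial_function_mult polynomial_function_const) (simp add: polynomial_function_id)
  then have "real_polynomial_function ?g"
    using real_polynomial_function_compose[OF _ p, of "\<lambda>s. x0 + s *\<^sub>R ?w"] by (simp add: o_def)
  then obtain a n where a: "?g = (\<lambda>s. \<Sum>i\<le>n. a i * s ^ i)"
    unfolding real_polynomial_function_iff_sum by blast
  \<comment> \<open>Adding 1 to the norm avoids division by zero when \<open>y\<close> is the
    interior point itself.\<close>
  have sub: "{0<..<e / (norm ?w + 1)} \<subseteq> {s. (\<Sum>i\<le>n. a i * s ^ i) = 0}"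
  proof
    fix s assume s: "s \<in> {0<..<e / (norm ?w + 1)}"
    have "0 < norm ?w + 1" using norm_ge_zero[of ?w] by linarith
    then have "s * (norm ?w + 1) < e" using s using pos_less_divide_eq[of "norm ?w + 1" s e] by simp
    then have "s * norm ?w < e" using s by (simp add: distrib_left)
    then have "x0 + s *\<^sub>R ?w \<in> ball x0 e" using s by (simp add: dist_norm)
    moreover have "x0 + s *\<^sub>R ?w \<in> affine hull C"
      unfolding aff using span_base[OF x0C] y by (intro span_add span_scale span_diff)
    ultimately have "?g s = 0" using e(2) z by blast
    then show "s \<in> {s. (\<Sum>i\<le>n. a i * s ^ i) = 0}" using fun_cong[OF a, of s] by simp
  qed
  have "0 < e / (norm ?w + 1)" using e(1) norm_ge_zero[of ?w] by (intro divide_pos_pos) linarith+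
  then have "infinite {0<..<e / (norm ?w + 1)}" by simp
  then have "infinite {s. (\<Sum>i\<le>n. a i * s ^ i) = 0}" using sub finite_subset by blast
  then have "\<forall>i\<le>n. a i = 0" using polyfun_finite_roots[of a n] by blast
  then have "?g 1 = 0" using fun_cong[OF a, of 1] by simp
  then show ?thesis by simp
qed

text \<open>Extension by 0 instead of \<open>undefined\<close> makes these functions closed under
  the pointwise operations of the function type, so that ordinary sums apply. Passing to and from
  the stalk ring is \<open>zext\<close> and \<open>restrict\<close>.\<close>

definition polyR :: "'a::euclidean_space set \<Rightarrow> ('a \<Rightarrow> real) set" where
  "polyR S = {f. (\<forall>x. x \<notin> S \<longrightarrow> f x = 0) \<and> (\<exists>p. real_polynomial_function p \<and> (\<forall>x\<in>S. f x = p x))}"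

text \<open>Integer degrees, with zero parts in negative degree, let generators of arbitrary degree
  be subtracted freely.\<close>

definition polyA :: "'a::euclidean_space set \<Rightarrow> int \<Rightarrow> ('a \<Rightarrow> real) set" where
  "polyA S d = {f. (\<forall>x. x \<notin> S \<longrightarrow> f x = 0) \<and> (if d < 0 then f = (\<lambda>_. 0) else \<exists>p. hom_poly p (nat d) \<and> (\<forall>x\<in>S. f x = p x))}"

definition zext :: "'a set \<Rightarrow> ('a \<Rightarrow> real) \<Rightarrow> 'a \<Rightarrow> real" where
  "zext S f = (\<lambda>x. if x \<in> S then f x else 0)"

lemma zext_polyR: "real_polynomial_function p \<Longrightarrow> zext S p \<in> polyR S"
  unfolding zext_def polyR_def by auto

lemma zext_polyA: "hom_poly p d \<Longrightarrow> zext S p \<in> polyA S (int d)"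
  unfolding zext_def polyA_def by auto

lemma polyRE:
  assumes "f \<in> polyR S"
  obtains p where "real_polynomial_function p" "f = zext S p"
proof -
  obtain p where "real_polynomial_function p" "\<forall>x\<in>S. f x = p x" "\<forall>x. x \<notin> S \<longrightarrow> f x = 0"
    using assms unfolding polyR_def by blast
  then show ?thesis by (intro that[of p]) (auto simp: zext_def)
qed

lemma polyAE:
  assumes "f \<in> polyA S d"
  obtains "f = zext S (\<lambda>_. 0)" | p where "0 \<le> d" "hom_poly p (nat d)" "f = zext S p"
proof (cases "d < 0")
  case True
  then show ?thesis using assms that(1) unfolding polyA_def zext_def by auto
next
  case False
  then obtain p where "hom_poly p (nat d)" "\<forall>x\<in>S. f x = p x" "\<forall>x. x \<notin> S \<longrightarrow> f x = 0"
    using assms unfolding polyA_def by auto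
  then show ?thesis using False by (intro that(2)[of p]) (auto simp: zext_def)
qed

lemma polyA_0: "zext S (\<lambda>_. 0) \<in> polyA S d"
  using hom_poly_0 unfolding polyA_def zext_def by auto

lemma zext_ops:
  "zext S f + zext S g = zext S (\<lambda>x. f x + g x)" "zext S f * zext S g = zext S (\<lambda>x. f x * g x)"
  "- zext S f = zext S (\<lambda>x. - f x)" "0 = zext S (\<lambda>_. 0)"
  unfolding zext_def by (auto simp: fun_eq_iff)

lemma zext_restrict: "T \<subseteq> S \<Longrightarrow> zext T (zext S f) = zext T f"
  unfolding zext_def by (auto simp: fun_eq_iff)

lemma polyA_mono_deg: "0 \<le> d \<Longrightarrow> hom_poly p (nat d) \<Longrightarrow> zext S p \<in> polyA S d"
  using zext_polyA[of p "nat d" S] by simp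

lemma polyA_mult:
  assumes "f \<in> polyA S d" "g \<in> polyA S e"
  shows "f * g \<in> polyA S (d + e)"
proof -
  from assms(1) show ?thesis
  proof (cases rule: polyAE)
    case 1
    then have "f * g = zext S (\<lambda>_. 0)" by (auto simp: zext_def fun_eq_iff)
    then show ?thesis using polyA_0 by metis
  next
    case (2 p)
    note p = 2
    from assms(2) show ?thesis
    proof (cases rule: polyAE)
      case 1
      then have "f * g = zext S (\<lambda>_. 0)" by (auto simp: zext_def fun_eq_iff)
      then show ?thesis using polyA_0 by metis
    next
      case (2 q)
      have "hom_poly (\<lambda>x. p x * q x) (nat (d + e))"
        using hom_poly_mult[OF p(2) 2(2)] p(1) 2(1) by (simp add: nat_add_distrib)
      then show ?thesis using p 2 by (simp add: zext_ops polyA_mono_deg)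
    qed
  qed
qed

lemma polyA_add:
  assumes "f \<in> polyA S d" "g \<in> polyA S d"
  shows "f + g \<in> polyA S d"
proof (cases "d < 0")
  case True
  then show ?thesis using assms unfolding polyA_def by auto
next
  case False
  then obtain p q where "hom_poly p (nat d)" "hom_poly q (nat d)" "\<forall>x\<in>S. f x = p x" "\<forall>x\<in>S. g x = q x"
    using assms unfolding polyA_def by auto
  then show ?thesis using assms False hom_poly_add[of p "nat d" q] unfolding polyA_def by auto
qed

lemma polyA_minus:
  assumes "f \<in> polyA S d"
  shows "- f \<in> polyA S d"
proof (cases "d < 0")
  case True
  then show ?thesis using assms unfolding polyA_def by (auto simp: fun_eq_iff)
next
  case False
  then obtain p where "hom_poly p (nat d)" "\<forall>x\<in>S. f x = p x"
    using assms unfolding polyA_def by auto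
  then show ?thesis using assms False hom_poly_minus[of p "nat d"] unfolding polyA_def by auto
qed

lemma polyA_zero: "(0 :: 'a::euclidean_space \<Rightarrow> real) \<in> polyA S d"
  using polyA_0[of S d] zext_ops(4)[of S] by simp

lemma connected_graded_ring_poly:
  assumes S: "0 \<in> S"
  shows "connected_graded_ring (polyR S) (polyA S) (zext S (\<lambda>_. 1))"
proof
  fix a d assume "a \<in> polyA S d"
  then show "a \<in> polyR S"
    by (cases rule: polyAE) (auto intro!: zext_polyR real_polynomial_function.intros(2) simp: hom_polyD(1))
next
  fix a b assume "a \<in> polyR S" "b \<in> polyR S"
  then obtain p q where "real_polynomial_function p" "a = zext S p" "real_polynomial_function q" "b = zext S q"
    by (elim polyRE)
  then show "a + b \<in> polyR S" "a * b \<in> polyR S"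
    by (auto simp: zext_ops intro!: zext_polyR real_polynomial_function.intros(3) real_polynomial_function.intros(4))
next
  show "0 \<in> polyA S d" for d using polyA_zero .
  show "a \<in> polyA S d \<Longrightarrow> b \<in> polyA S d \<Longrightarrow> a + b \<in> polyA S d" for a b d by (rule polyA_add)
  show "a \<in> polyA S d \<Longrightarrow> b \<in> polyA S e \<Longrightarrow> a * b \<in> polyA S (d + e)" for a b d e by (rule polyA_mult)
  show "a \<in> polyA S d \<Longrightarrow> - a \<in> polyA S d" for a d by (rule polyA_minus)
  show "zext S (\<lambda>_. 1) \<in> polyA S 0"
    by (rule polyA_mono_deg) (auto simp: hom_poly_def intro: real_polynomial_function.intros(2))
  show "zext S (\<lambda>_. 1) * a = a" if "a \<in> polyR S" for a
    using that by (rule polyRE) (simp add: zext_ops)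
  have "zext S (\<lambda>_. 1) 0 = 1" using S by (simp add: zext_def)
  then show "zext S (\<lambda>_. 1) \<noteq> 0" by auto
  show "a = 0" if "d < 0" "a \<in> polyA S d" for a d using that unfolding polyA_def by auto
next
  fix a assume a: "a \<in> polyA S 0" "a \<noteq> 0"
  from a(1) show "\<exists>b\<in>polyA S 0. b * a = zext S (\<lambda>_. 1)"
  proof (cases rule: polyAE)
    case 1 then show ?thesis using a(2) zext_ops(4)[of S] by simp
  next
    case (2 p)
    \<comment> \<open>Scaling by \<open>c = 0\<close> shows that a homogeneous function of degree 0
      is constant, as \<open>0 ^ 0 = 1\<close>.\<close>
    have k: "p x = p 0" for x using hom_polyD(2)[OF 2(2), of 0 x] by simp
    then have pk: "p = (\<lambda>_. p 0)" by blast
    have "p 0 \<noteq> 0"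
    proof
      assume "p 0 = 0"
      then have "p = (\<lambda>_. 0)" using pk by simp
      then show False using 2(3) a(2) zext_ops(4)[of S] by simp
    qed
    then have "zext S (\<lambda>_. inverse (p 0)) * a = zext S (\<lambda>_. 1)" unfolding 2(3) by (subst pk) (simp add: zext_ops)
    moreover have "zext S (\<lambda>_. inverse (p 0)) \<in> polyA S 0"
      by (rule polyA_mono_deg) (auto simp: hom_poly_def intro: real_polynomial_function.intros(2))
    ultimately show ?thesis by blast
  qed
qed

lemma polyR_decompose:
  assumes "a \<in> polyR S"
  shows "\<exists>N h. (\<forall>d. h d \<in> polyA S (int d)) \<and> a = (\<Sum>d\<le>N. h d)"
proof -
  obtain p where p: "real_polynomial_function p" "a = zext S p" using assms by (rule polyRE)
  obtain N h where h: "\<And>d. hom_poly (h d) d" "p = (\<lambda>x. \<Sum>d\<le>N. h d x)"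
    using real_polynomial_function_decompose[OF p(1)] by blast
  have "(\<Sum>d\<in>D. zext S (h d)) = zext S (\<lambda>x. \<Sum>d\<in>D. h d x)" if "finite D" for D
    using that by (induct D rule: finite_induct) (simp_all add: zext_ops(1) flip: zext_ops(4))
  then have "a = (\<Sum>d\<le>N. zext S (h d))" unfolding p(2) h(2) by simp
  then show ?thesis using zext_polyA[OF h(1)] by (intro exI[of _ N] exI[of _ "\<lambda>d. zext S (h d)"]) blast
qed

section \<open>Division by the linear form of a facet\<close>

context cone_normals
begin

lemma pos_point: "\<exists>x\<in>S. \<forall>n\<in>N. 0 < n \<bullet> x"
  using face_rel_interior_nonempty[OF cone_faces_self[OF ppc]] rel_int by blast

text \<open>An interior point, scaled so that \<open>n\<close> takes the value 1, gives a projection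
  of \<open>span S\<close> onto the span of the facet. There the polynomial vanishes, and
  \<open>polynomial_linear_division\<close> yields the quotient.\<close>

lemma facet_division:
  assumes n: "n \<in> N" and p: "real_polynomial_function p" and z: "\<And>x. x \<in> S \<Longrightarrow> n \<bullet> x = 0 \<Longrightarrow> p x = 0"
  shows "\<exists>q. real_polynomial_function q \<and> (\<forall>x\<in>span S. p x = (n \<bullet> x) * q x)"
proof -
  obtain x0 where x0: "x0 \<in> S" "0 < n \<bullet> x0" using pos_point n by blast
  define v where "v = (1 / (n \<bullet> x0)) *\<^sub>R x0"
  have v: "v \<in> span S" "n \<bullet> v = 1" unfolding v_def using x0 by (auto intro: span_scale span_base)
  obtain q where q: "real_polynomial_function q" "\<And>x. p x - p (x - (n \<bullet> x) *\<^sub>R v) = (n \<bullet> x) * q x"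
    using polynomial_linear_division[OF p] by blast
  have C: "convex (S \<inter> {x. n \<bullet> x = 0})" "0 \<in> S \<inter> {x. n \<bullet> x = 0}"
    using S_props(2,4) by (auto intro!: convex_Int convex_hyperplane)
  have sp: "span (S \<inter> {x. n \<bullet> x = 0}) = span S \<inter> {x. n \<bullet> x = 0}"
    by (rule span_facet[OF S_props(4) _ facet[OF n]]) simp
  have "p x = (n \<bullet> x) * q x" if x: "x \<in> span S" for x
  proof -
    have "x - (n \<bullet> x) *\<^sub>R v \<in> span S" using x v(1) by (intro span_diff span_scale)
    then have "x - (n \<bullet> x) *\<^sub>R v \<in> span (S \<inter> {x. n \<bullet> x = 0})"
      unfolding sp using v(2) by (simp add: inner_diff_right)
    then have "p (x - (n \<bullet> x) *\<^sub>R v) = 0"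
      using polynomial_zero_on_span[OF p C] z by blast
    then show ?thesis using q(2)[of x] by simp
  qed
  then show ?thesis using q(1) by blast
qed

definition lin :: "'a \<Rightarrow> 'a \<Rightarrow> real" where
  "lin n = zext S (\<lambda>x. n \<bullet> x)"

lemma lin_polyA: "lin n \<in> polyA S 1"
  unfolding lin_def using zext_polyA[OF hom_poly_linear[OF bounded_linear_inner_right, of n], of S] by simp

lemma lin_cancel:
  assumes n: "n \<in> N" and "a \<in> polyR S" "b \<in> polyR S" "lin n * a = lin n * b"
  shows "a = b"
proof -
  obtain p q where p: "real_polynomial_function p" "a = zext S p" and q: "real_polynomial_function q" "b = zext S q"
    using assms by (elim polyRE)
  obtain x0 where x0: "x0 \<in> S" "0 < n \<bullet> x0" using pos_point n by blast
  have pq: "p x = q x" if "x \<in> S" "n \<bullet> x \<noteq> 0" for x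
    using fun_cong[OF assms(4), of x] that unfolding lin_def p(2) q(2) zext_def by simp
  text \<open>Points of \<open>S\<close> on the hyperplane are limits of points of \<open>S\<close> off it.\<close>
  have "p x = q x" if x: "x \<in> S" for x
  proof (cases "n \<bullet> x = 0")
    case True
    have C: "p y - q y = 0" if y: "y \<in> closed_segment x x0" "y \<noteq> x" for y
    proof -
      obtain u where u: "0 \<le> u" "u \<le> 1" "y = (1 - u) *\<^sub>R x + u *\<^sub>R x0"
        using y(1) unfolding closed_segment_def by blast
      then have "u \<noteq> 0" using y(2) by auto
      then have "0 < n \<bullet> y" using u x0 True by (simp add: inner_add_right)
      moreover have "y \<in> S" using y(1) closed_segment_subset[OF x x0(1) S_props(2)] by blast
      ultimately show ?thesis using pq[of y] by simp
    qed
    have cont: "continuous_on UNIV (\<lambda>y. p y - q y)"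
      using p(1) q(1) by (intro continuous_on_diff) (auto intro: continuous_on_polymonial_function simp: real_polynomial_function_eq)
    have "((\<lambda>u. p ((1 - u) *\<^sub>R x + u *\<^sub>R x0) - q ((1 - u) *\<^sub>R x + u *\<^sub>R x0)) \<longlongrightarrow> p ((1 - 0) *\<^sub>R x + 0 *\<^sub>R x0) - q ((1 - 0) *\<^sub>R x + 0 *\<^sub>R x0)) (at_right 0)"
      by (intro continuous_on_tendsto_compose[OF cont, of _ _ "at_right 0"] tendsto_intros) auto
    moreover have "\<forall>\<^sub>F u in at_right 0. p ((1 - u) *\<^sub>R x + u *\<^sub>R x0) - q ((1 - u) *\<^sub>R x + u *\<^sub>R x0) = 0"
    proof (rule eventually_at_rightI[of 0 1])
      fix u :: real assume u: "u \<in> {0<..<1}"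
      have "x \<noteq> x0" using True x0 by auto
      then have "(1 - u) *\<^sub>R x + u *\<^sub>R x0 \<noteq> x" using u by (auto simp: algebra_simps)
      moreover have "(1 - u) *\<^sub>R x + u *\<^sub>R x0 \<in> closed_segment x x0"
        using u unfolding closed_segment_def by (intro CollectI exI[of _ u]) auto
      ultimately show "p ((1 - u) *\<^sub>R x + u *\<^sub>R x0) - q ((1 - u) *\<^sub>R x + u *\<^sub>R x0) = 0" using C by blast
    qed simp
    ultimately have "p ((1 - 0) *\<^sub>R x + 0 *\<^sub>R x0) - q ((1 - 0) *\<^sub>R x + 0 *\<^sub>R x0) = 0"
      by (intro tendsto_unique[OF trivial_limit_at_right_real _ tendsto_eventually])
    then show ?thesis by simp
  qed (use pq x in blast)
  then show ?thesis unfolding p(2) q(2) zext_def by auto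
qed

lemma lin_divides:
  assumes n: "n \<in> N" and a: "a \<in> polyR S" and z: "\<And>x. x \<in> S \<Longrightarrow> n \<bullet> x = 0 \<Longrightarrow> a x = 0"
  shows "\<exists>q\<in>polyR S. a = lin n * q"
proof -
  obtain p where p: "real_polynomial_function p" "a = zext S p" using a by (rule polyRE)
  obtain q where q: "real_polynomial_function q" "\<forall>x\<in>span S. p x = (n \<bullet> x) * q x"
    using facet_division[OF n p(1)] z unfolding p(2) zext_def by auto
  then have "a = lin n * zext S q" unfolding lin_def p(2) zext_ops by (auto simp: zext_def fun_eq_iff span_base)
  then show ?thesis using zext_polyR[OF q(1)] by blast
qed

text \<open>The quotient is known only to be a polynomial. Expanding it into homogeneous parts and
  comparing degrees in the product leaves one part, because \<open>lin n\<close> can be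
  cancelled.\<close>

lemma lin_divides_homogeneous:
  assumes n: "n \<in> N" and a: "lin n * q \<in> polyA S d" and q: "q \<in> polyR S"
  shows "q \<in> polyA S (d - 1)"
proof -
  interpret connected_graded_ring "polyR S" "polyA S" "zext S (\<lambda>_. 1)"
    using connected_graded_ring_poly S_props(4) .
  show ?thesis
    using a
  proof (cases rule: polyAE)
    case 1
    then have "lin n * q = lin n * 0" using zext_ops(4)[of S] by simp
    then have "q = 0" using lin_cancel[OF n q R_0] by blast
    then show ?thesis using A_0 by simp
  next
    case (2 p)
    obtain r where r: "real_polynomial_function r" "q = zext S r" using q by (rule polyRE)
    obtain N h where h: "\<And>e. hom_poly (h e) e" "r = (\<lambda>x. \<Sum>e\<le>N. h e x)"
      using real_polynomial_function_decompose[OF r(1)] by blast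
    have l: "real_polynomial_function (\<lambda>x. n \<bullet> x)" by (simp add: bounded_linear_inner_right real_polynomial_function.intros(1))
    have "(n \<bullet> x) * r x - p x = 0" if "x \<in> span S" for x
    proof (rule polynomial_zero_on_span[OF _ S_props(2,4) _ that])
      show "real_polynomial_function (\<lambda>x. (n \<bullet> x) * r x - p x)"
        using r(1) l hom_polyD(1)[OF 2(2)] by (intro real_polynomial_function_diff real_polynomial_function.intros(4))
      show "(n \<bullet> x) * r x - p x = 0" if "x \<in> S" for x
        using fun_cong[OF 2(3), of x] that unfolding r(2) lin_def zext_def by simp
    qed
    then have eq: "(n \<bullet> x) * r x = p x" if "x \<in> span S" for x using that by fastforce
    \<comment> \<open>Multiplication by the linear form raises degrees by one, so the coefficient in
      degree 0 is 0 and that in degree \<open>Suc e\<close> comes from \<open>h e\<close>.\<close>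
    have coef: "p x = (if nat d \<le> Suc N then (case nat d of 0 \<Rightarrow> 0 | Suc e \<Rightarrow> (n \<bullet> x) * h e x) else 0)" if x: "x \<in> span S" for x
    proof -
      have "(\<Sum>e\<le>Suc N. c ^ e * (case e of 0 \<Rightarrow> 0 | Suc e \<Rightarrow> (n \<bullet> x) * h e x)) = c ^ nat d * p x" for c
      proof -
        have "c ^ nat d * p x = p (c *\<^sub>R x)" using hom_polyD(2)[OF 2(2)] by simp
        also have "\<dots> = (n \<bullet> (c *\<^sub>R x)) * r (c *\<^sub>R x)" using eq[OF span_scale[OF x]] by simp
        also have "\<dots> = (\<Sum>e\<le>N. c ^ Suc e * ((n \<bullet> x) * h e x))"
          unfolding h(2) hom_polyD(2)[OF h(1)] by (simp add: sum_distrib_left algebra_simps)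
        also have "\<dots> = (\<Sum>e\<le>Suc N. c ^ e * (case e of 0 \<Rightarrow> 0 | Suc e \<Rightarrow> (n \<bullet> x) * h e x))"
          by (subst sum.atMost_Suc_shift) simp
        finally show ?thesis by simp
      qed
      then show ?thesis by (rule homogeneous_coefficient)
    qed
    show ?thesis
    proof (cases "nat d \<le> Suc N \<and> nat d \<noteq> 0")
      case True
      then obtain e where e: "nat d = Suc e" by (cases "nat d") auto
      then have "zext S p = lin n * zext S (h e)"
        unfolding lin_def zext_ops using True coef by (auto simp: zext_def fun_eq_iff span_base)
      then have "lin n * q = lin n * zext S (h e)" using 2(3) by simp
      then have "q = zext S (h e)"
        using lin_cancel[OF n q] zext_polyR[OF hom_polyD(1)[OF h(1)]] by blast
      moreover have "d - 1 = int e" using e by linarith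
      ultimately show ?thesis using zext_polyA[OF h(1)[of e], of S] by simp
    next
      case False
      then have "zext S p = lin n * 0" using coef by (auto simp: zext_def fun_eq_iff span_base)
      then have "lin n * q = lin n * 0" using 2(3) by simp
      then have "q = 0" using lin_cancel[OF n q R_0] by blast
      then show ?thesis using A_0 by simp
    qed
  qed
qed

end

section \<open>Line shellings\<close>

context cone_normals
begin

text \<open>Conditions already secured are open, so they survive a short move in a direction that
  secures one more.\<close>

lemma generic_point:
  assumes "finite C" "\<And>c. c \<in> C \<Longrightarrow> \<exists>x\<in>span S. c \<bullet> x \<noteq> 0"
  shows "\<exists>p\<in>rel_interior S. \<forall>c\<in>C. c \<bullet> p \<noteq> 0"
  using assms
proof (induct C rule: finite_induct)
  case empty
  then show ?case using face_rel_interior_nonempty[OF cone_faces_self[OF ppc]] by blast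
next
  case (insert c C)
  then obtain p where p: "p \<in> rel_interior S" "\<forall>c\<in>C. c \<bullet> p \<noteq> 0" by blast
  obtain x where x: "x \<in> span S" "c \<bullet> x \<noteq> 0" using insert(4) by blast
  have pS: "p \<in> span S" "\<And>n. n \<in> N \<Longrightarrow> 0 < n \<bullet> p" using p(1) rel_int span_base by auto
  let ?p = "\<lambda>t. p + t *\<^sub>R x"
  have lim: "((\<lambda>t. a \<bullet> ?p t) \<longlongrightarrow> a \<bullet> p) (at_right 0)" for a
    by (auto intro!: tendsto_eq_intros)
  have "\<forall>\<^sub>F t in at_right 0. \<forall>n\<in>N. 0 < n \<bullet> ?p t"
    using finN order_tendstoD(1)[OF lim] pS(2) by (intro eventually_ball_finite) auto
  moreover have "\<forall>\<^sub>F t in at_right 0. \<forall>c\<in>C. c \<bullet> ?p t \<noteq> 0"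
    using insert(1) tendsto_imp_eventually_ne[OF lim] p(2) by (intro eventually_ball_finite) auto
  moreover have "\<forall>\<^sub>F t in at_right 0. c \<bullet> ?p t \<noteq> 0"
  proof (cases "c \<bullet> p = 0")
    case True
    then have "c \<bullet> ?p t \<noteq> 0" if "t > 0" for t using that x(2) by (simp add: inner_add_right)
    then show ?thesis by (intro eventually_at_right_less[THEN eventually_mono]) auto
  qed (rule tendsto_imp_eventually_ne[OF lim])
  ultimately have "\<forall>\<^sub>F t in at_right 0. (\<forall>n\<in>N. 0 < n \<bullet> ?p t) \<and> (\<forall>c\<in>C. c \<bullet> ?p t \<noteq> 0) \<and> c \<bullet> ?p t \<noteq> 0"
    by (intro eventually_conj)
  then obtain t where t: "\<forall>n\<in>N. 0 < n \<bullet> ?p t" "\<forall>c\<in>C. c \<bullet> ?p t \<noteq> 0" "c \<bullet> ?p t \<noteq> 0"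
    using eventually_happens[of _ "at_right (0::real)"] trivial_limit_at_right_real by blast
  have "?p t \<in> span S" using pS(1) x(1) by (intro span_add span_scale)
  then have "?p t \<in> rel_interior S" unfolding rel_int mem_S mem_Collect_eq using t(1) by (auto intro: less_imp_le)
  then show ?case using t(2,3) by blast
qed

text \<open>The list is sorted by the time at which \<open>p + t *\<^sub>R v\<close> crosses the
  hyperplanes. At the \<open>i\<close>-th crossing exactly the normals crossed before are negative;
  normals nonnegative on \<open>v\<close> are never crossed.\<close>

lemma line_shelling_normals:
  assumes v: "v \<in> span S"
  obtains ns q where "set ns = {n\<in>N. n \<bullet> v < 0}"
    "\<And>i. i < length ns \<Longrightarrow> q i \<in> span S \<and> ns ! i \<bullet> q i = 0 \<and> (\<forall>n\<in>N. n \<bullet> q i < 0 \<longleftrightarrow> n \<in> set (take i ns))"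
proof -
  let ?M = "{n\<in>N. n \<bullet> v < 0}"
  \<comment> \<open>This form vanishes at \<open>p\<close> exactly when the hyperplanes of
    \<open>n\<close> and \<open>m\<close> are crossed at the same time. It is not zero on
    \<open>span S\<close>, since otherwise both normals would define the same facet.\<close>
  let ?c = "\<lambda>n m. (1 / (n \<bullet> v)) *\<^sub>R n - (1 / (m \<bullet> v)) *\<^sub>R m"
  let ?C = "(\<lambda>(n, m). ?c n m) ` {(n, m) \<in> ?M \<times> ?M. n \<noteq> m}"
  have "finite (?M \<times> ?M)" using finN by simp
  then have "finite {(n, m) \<in> ?M \<times> ?M. n \<noteq> m}" by (rule rev_finite_subset) auto
  then have "finite ?C" by (rule finite_imageI)
  moreover have "\<exists>x\<in>span S. c \<bullet> x \<noteq> 0" if cC: "c \<in> ?C" for c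
  proof (rule ccontr)
    assume z: "\<not> (\<exists>x\<in>span S. c \<bullet> x \<noteq> 0)"
    obtain n m where nm: "n \<in> ?M" "m \<in> ?M" "n \<noteq> m" "c = ?c n m" using cC by auto
    have "n \<bullet> x = 0 \<longleftrightarrow> m \<bullet> x = 0" if "x \<in> S" for x
    proof -
      have "c \<bullet> x = 0" using z that span_base by blast
      then have "(n \<bullet> x) / (n \<bullet> v) = (m \<bullet> x) / (m \<bullet> v)" unfolding nm(4) by (simp add: inner_diff_left)
      then show ?thesis using nm(1,2) by (auto simp: field_simps)
    qed
    then have "n = m" using inj[of n m] nm(1,2) by blast
    then show False using nm(3) by blast
  qed
  ultimately obtain p where p: "p \<in> rel_interior S" "\<forall>c\<in>?C. c \<bullet> p \<noteq> 0" using generic_point by blast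
  have pN: "0 < n \<bullet> p" if "n \<in> N" for n using p(1) rel_int that by blast
  have pS: "p \<in> span S" using p(1) rel_interior_subset span_base by blast
  define t where "t n = (n \<bullet> p) / (- (n \<bullet> v))" for n
  have t_inj: "n = m" if "n \<in> ?M" "m \<in> ?M" "t n = t m" for n m
  proof (rule ccontr)
    assume "n \<noteq> m"
    then have "(n, m) \<in> {(n, m) \<in> ?M \<times> ?M. n \<noteq> m}" using that by simp
    then have "?c n m \<in> ?C" by (rule rev_image_eqI) simp
    then have "?c n m \<bullet> p \<noteq> 0" using p(2) by blast
    then show False using that(3) unfolding t_def by (simp add: inner_diff_left)
  qed
  have t_pos: "0 < t n" if "n \<in> ?M" for n unfolding t_def using that pN by (intro divide_pos_pos) auto
  obtain xs where xs: "set xs = ?M" "distinct xs" using finite_distinct_list[of ?M] finN by auto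
  define ns where "ns = sort_key t xs"
  have ns: "set ns = ?M" "distinct ns" "sorted (map t ns)" unfolding ns_def using xs by auto
  define q where "q i = p + t (ns ! i) *\<^sub>R v" for i
  have "q i \<in> span S \<and> ns ! i \<bullet> q i = 0 \<and> (\<forall>n\<in>N. n \<bullet> q i < 0 \<longleftrightarrow> n \<in> set (take i ns))"
    if i: "i < length ns" for i
  proof (intro conjI ballI)
    have nsi: "ns ! i \<in> ?M" using ns(1) i nth_mem by blast
    show "q i \<in> span S" unfolding q_def using pS v by (intro span_add span_scale)
    show "ns ! i \<bullet> q i = 0" unfolding q_def t_def inner_add_right inner_scaleR_right using nsi by simp
    fix n assume n: "n \<in> N"
    show "n \<bullet> q i < 0 \<longleftrightarrow> n \<in> set (take i ns)"
    proof (cases "n \<bullet> v < 0")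
      case False
      then have "0 < n \<bullet> q i" unfolding q_def inner_add_right inner_scaleR_right
        using t_pos[OF nsi] pN[OF n] by (intro add_pos_nonneg mult_nonneg_nonneg) auto
      moreover have "n \<notin> set (take i ns)" using False ns(1) set_take_subset[of i ns] by blast
      ultimately show ?thesis by simp
    next
      case True
      then have "n \<in> set ns" using n ns(1) by blast
      then obtain j where j: "j < length ns" "n = ns ! j" by (metis in_set_conv_nth)
      have "n \<bullet> q i < 0 \<longleftrightarrow> n \<bullet> p < t (ns ! i) * (- (n \<bullet> v))"
        unfolding q_def by (simp add: inner_add_right) linarith
      also have "\<dots> \<longleftrightarrow> t n < t (ns ! i)"
        unfolding t_def[of n] using True pos_divide_less_eq[of "- (n \<bullet> v)"] by simp
      also have "\<dots> \<longleftrightarrow> j < i"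
      proof
        assume "t n < t (ns ! i)"
        then show "j < i" using sorted_nth_mono[OF ns(3), of i j] i j by (metis length_map linorder_not_le not_less nth_map)
      next
        assume ji: "j < i"
        then have "t n \<le> t (ns ! i)" using sorted_nth_mono[OF ns(3), of j i] i j by simp
        moreover have "n \<noteq> ns ! i" using ns(2) i j ji nth_eq_iff_index_eq by blast
        then have "t n \<noteq> t (ns ! i)" using t_inj[OF _ nsi] True n by blast
        ultimately show "t n < t (ns ! i)" by simp
      qed
      also have "\<dots> \<longleftrightarrow> n \<in> set (take i ns)"
        using ns(2) i j by (auto simp: in_set_conv_nth nth_eq_iff_index_eq)
      finally show ?thesis .
    qed
  qed
  then show ?thesis using that ns(1) by blast
qed

text \<open>As \<open>q\<close> is parallel to \<rho>, a point of \<rho> moved along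
  \<open>q\<close> keeps the equations of \<rho>; it leaves \<rho> only by leaving
  \<open>S\<close>.\<close>

lemma back_faces_face:
  assumes r: "\<rho> \<in> cone_faces S" and q: "q \<in> span \<rho>"
  shows "back_faces \<rho> q = cone_faces \<rho> \<inter> back_faces S q"
proof -
  have rS: "\<rho> \<subseteq> S" using cone_faces_subset[OF r] .
  have qn: "n \<bullet> q = 0" if "n \<in> act \<rho>" for n
  proof -
    have "span \<rho> \<subseteq> {x. n \<bullet> x = 0}"
      by (rule span_minimal) (use that in \<open>auto simp: act_def subspace_hyperplane\<close>)
    then show ?thesis using q by blast
  qed
  have "x + t *\<^sub>R q \<in> \<rho> \<longleftrightarrow> x + t *\<^sub>R q \<in> S" if "x \<in> rel_interior \<tau>" "\<tau> \<in> cone_faces \<rho>" for x t \<tau>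
  proof -
    have "x \<in> \<rho>" using that rel_interior_subset cone_faces_subset by blast
    then have "n \<bullet> (x + t *\<^sub>R q) = 0" if "n \<in> act \<rho>" for n
      using qn[OF that] that unfolding act_def by (simp add: inner_add_right)
    then show ?thesis using mem_face[OF r] by blast
  qed
  then show ?thesis unfolding back_faces_def using cone_faces_face[OF r] by auto
qed

text \<open>The non-back faces for a direction are those lying in a facet whose normal is negative
  on it. Applied to \<open>v\<close> this gives the union of facets; applied to the crossing points
  it gives the earlier facets.\<close>

lemma line_shelling:
  assumes v: "v \<in> span S"
  obtains k \<rho> q n where "cone_faces S - back_faces S v = (\<Union>i<k. cone_faces (\<rho> i))"
    "\<And>i::nat. i < k \<Longrightarrow> n i \<in> N \<and> \<rho> i = S \<inter> {x. n i \<bullet> x = 0}"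
    "\<And>i. i < k \<Longrightarrow> q i \<in> span (\<rho> i)"
    "\<And>i. i < k \<Longrightarrow> cone_faces (\<rho> i) - back_faces (\<rho> i) (q i) = cone_faces (\<rho> i) \<inter> (\<Union>j<i. cone_faces (\<rho> j))"
proof -
  obtain ns q where ns: "set ns = {n\<in>N. n \<bullet> v < 0}"
    and q: "\<And>i. i < length ns \<Longrightarrow> q i \<in> span S \<and> ns ! i \<bullet> q i = 0 \<and> (\<forall>n\<in>N. n \<bullet> q i < 0 \<longleftrightarrow> n \<in> set (take i ns))"
    using line_shelling_normals[OF v] by blast
  let ?r = "\<lambda>n. S \<inter> {x. n \<bullet> x = 0}"
  have faces: "\<tau> \<in> cone_faces (?r n) \<longleftrightarrow> \<tau> \<in> cone_faces S \<and> n \<in> act \<tau>" if "n \<in> N" for n \<tau>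
    using cone_faces_face[OF facet_mem[OF that]] that cone_faces_subset unfolding act_def by blast
  have nb: "\<tau> \<in> cone_faces S - back_faces S w \<longleftrightarrow> (\<exists>n\<in>N. n \<bullet> w < 0 \<and> \<tau> \<in> cone_faces (?r n))" if "w \<in> span S" for \<tau> w
  proof -
    have "\<tau> \<in> cone_faces S - back_faces S w \<longleftrightarrow> \<tau> \<in> cone_faces S \<and> (\<exists>n\<in>act \<tau>. n \<bullet> w < 0)"
      using back_faces_iff[OF that, of \<tau>] by (meson DiffD1 DiffD2 DiffI not_le)
    moreover have "n \<in> N" if "n \<in> act \<tau>" for n using that unfolding act_def by blast
    ultimately show ?thesis using faces by blast
  qed
  have nsN: "n \<in> N" if "n \<in> set ns" for n using that ns by blast
  show ?thesis
  proof (rule that[where k = "length ns" and \<rho> = "\<lambda>i. ?r (ns ! i)" and n = "\<lambda>i. ns ! i" and q = q])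
    show "cone_faces S - back_faces S v = (\<Union>i<length ns. cone_faces (?r (ns ! i)))"
    proof (rule Set.set_eqI)
      fix \<tau>
      have "\<tau> \<in> cone_faces S - back_faces S v \<longleftrightarrow> (\<exists>n\<in>set ns. \<tau> \<in> cone_faces (?r n))"
        unfolding nb[OF v] ns by blast
      also have "\<dots> \<longleftrightarrow> \<tau> \<in> (\<Union>i<length ns. cone_faces (?r (ns ! i)))"
        by (auto simp: set_conv_nth)
      finally show "\<tau> \<in> cone_faces S - back_faces S v \<longleftrightarrow> \<tau> \<in> (\<Union>i<length ns. cone_faces (?r (ns ! i)))" .
    qed
    fix i assume i: "i < length ns"
    then have n: "ns ! i \<in> N" using nsN by simp
    show "ns ! i \<in> N \<and> ?r (ns ! i) = ?r (ns ! i)" using n by blast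
    have "span (?r (ns ! i)) = span S \<inter> {x. ns ! i \<bullet> x = 0}"
      by (rule span_facet[OF S_props(4) _ facet[OF n]]) simp
    then show qs: "q i \<in> span (?r (ns ! i))" using q[OF i] by blast
    show "cone_faces (?r (ns ! i)) - back_faces (?r (ns ! i)) (q i) = cone_faces (?r (ns ! i)) \<inter> (\<Union>j<i. cone_faces (?r (ns ! j)))"
    proof (rule Set.set_eqI)
      fix \<tau>
      have qS: "q i \<in> span S" using q[OF i] by blast
      have "\<tau> \<in> cone_faces S - back_faces S (q i) \<longleftrightarrow> (\<exists>n\<in>set (take i ns). \<tau> \<in> cone_faces (?r n))"
        unfolding nb[OF qS] using q[OF i] nsN set_take_subset[of i ns] by blast
      also have "\<dots> \<longleftrightarrow> \<tau> \<in> (\<Union>j<i. cone_faces (?r (ns ! j)))"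
        using nth_image[of i ns, symmetric] i by (simp add: atLeast0LessThan)
      finally show "\<tau> \<in> cone_faces (?r (ns ! i)) - back_faces (?r (ns ! i)) (q i) \<longleftrightarrow>
          \<tau> \<in> cone_faces (?r (ns ! i)) \<inter> (\<Union>j<i. cone_faces (?r (ns ! j)))"
        unfolding back_faces_face[OF facet_mem[OF n] qs] using faces[OF n] by blast
    qed
  qed
qed

lemma facet_dim:
  assumes "n \<in> N"
  shows "dim (S \<inter> {x. n \<bullet> x = 0}) < dim S"
proof -
  have "0 \<in> affine hull S" "0 \<in> affine hull (S \<inter> {x. n \<bullet> x = 0})" using S_props(4) by (auto intro: hull_inc)
  then show ?thesis using facet[OF assms] aff_dim_zero unfolding facet_of_def by (metis less_add_one diff_add_cancel of_nat_less_iff)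
qed

text \<open>All active normals vanish on \<open>v\<close>, so a short move along \<open>v\<close>
  from the relative interior stays in \<tau>, and \<open>v\<close> is a multiple of the difference
  of two points of \<tau>.\<close>

lemma direction_in_span:
  assumes v: "v \<in> span S" and t: "\<tau> \<in> back_faces S v" "\<tau> \<in> front_faces S v"
  shows "v \<in> span \<tau>"
proof -
  have F: "\<tau> \<in> cone_faces S" using t back_subset by blast
  have v0: "n \<bullet> v = 0" if "n \<in> act \<tau>" for n
    using that t back_faces_iff[OF v F] front_faces_iff[OF v F] by (meson order_antisym)
  obtain x where x: "x \<in> rel_interior \<tau>" using face_rel_interior_nonempty[OF F] by blast
  then have xt: "x \<in> \<tau>" using rel_interior_subset by blast
  obtain e where e: "e > 0" "{0..<e} \<subseteq> {t. x + t *\<^sub>R v \<in> S}" using t x unfolding back_faces_def by blast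
  have "e / 2 \<in> {0..<e}" using e(1) by simp
  then have yS: "x + (e / 2) *\<^sub>R v \<in> S" using e(2) by blast
  have "n \<bullet> (x + (e / 2) *\<^sub>R v) = 0" if "n \<in> act \<tau>" for n
    using v0[OF that] xt that unfolding act_def by (simp add: inner_add_right)
  then have "x + (e / 2) *\<^sub>R v \<in> \<tau>" using mem_face[OF F] yS by blast
  then have "(x + (e / 2) *\<^sub>R v) - x \<in> span \<tau>" using xt by (intro span_diff span_base)
  then have "(2 / e) *\<^sub>R ((x + (e / 2) *\<^sub>R v) - x) \<in> span \<tau>" by (rule span_scale)
  then show ?thesis using e(1) by simp
qed

end

section \<open>Kernels of surjections onto modules over a facet\<close>

lemma sum_fun_apply: "(\<Sum>i\<in>T. f i) x = (\<Sum>i\<in>T. f i x)"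
  by (induct T rule: infinite_finite_induct) simp_all

context cone_normals
begin

text \<open>
  The matrix \<open>C\<close> lifts a surjection from the free module on \<open>B\<close> to the free module on \<open>Y\<close> over
  the quotient by the linear form, and \<open>D\<close> lifts a right inverse of it. By Schanuel's lemma the
  kernel is a direct summand of the sum of the free modules on \<open>B\<close> and on \<open>Y\<close> (shifted by one).
  The frame below is the one that comes from this summand.
\<close>

lemma kernel_free_coordinates:
  fixes B :: "'m set" and Y :: "'y set" and deg :: "'m \<Rightarrow> int" and dY :: "'y \<Rightarrow> int"
    and C :: "'m \<Rightarrow> 'y \<Rightarrow> 'a \<Rightarrow> real" and D :: "'y \<Rightarrow> 'm \<Rightarrow> 'a \<Rightarrow> real" and L K :: "('m \<Rightarrow> 'a \<Rightarrow> real) set"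
  assumes n: "n \<in> N"
    and L: "L = {w. finite {b. w b \<noteq> 0} \<and> (\<forall>b. w b \<noteq> 0 \<longrightarrow> b \<in> B) \<and> (\<forall>b. w b \<in> polyR S)}"
    and C: "\<And>b y. b \<in> B \<Longrightarrow> y \<in> Y \<Longrightarrow> C b y \<in> polyA S (deg b - dY y)"
    and Cfin: "\<And>b. b \<in> B \<Longrightarrow> finite {y\<in>Y. C b y \<noteq> 0}"
    and D: "\<And>y. y \<in> Y \<Longrightarrow> D y \<in> L" "\<And>y b. y \<in> Y \<Longrightarrow> D y b \<in> polyA S (dY y - deg b)"
    and g: "g = (\<lambda>y w. \<Sum>b\<in>{b. w b \<noteq> 0}. w b * C b y)"
    and DC: "\<And>y y' x. y \<in> Y \<Longrightarrow> y' \<in> Y \<Longrightarrow> x \<in> S \<Longrightarrow> n \<bullet> x = 0 \<Longrightarrow> g y' (D y) x = (if y' = y then 1 else 0)"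
    and K: "K = {w\<in>L. \<forall>y\<in>Y. \<forall>x\<in>S. n \<bullet> x = 0 \<longrightarrow> g y w x = 0}"
  shows "\<exists>U\<subseteq>K. (\<forall>w\<in>U. \<exists>\<delta>. \<forall>b. w b \<in> polyA S (\<delta> - deg b)) \<and>
     (\<forall>p\<in>K. \<exists>T c. finite T \<and> T \<subseteq> U \<and> (\<forall>w\<in>T. c w \<in> polyR S) \<and> p = (\<Sum>w\<in>T. (\<lambda>b. c w * w b))) \<and>
     (\<forall>T c. finite T \<longrightarrow> T \<subseteq> U \<longrightarrow> (\<forall>w\<in>T. c w \<in> polyR S) \<longrightarrow> (\<Sum>w\<in>T. (\<lambda>b. c w * w b)) = 0 \<longrightarrow> (\<forall>w\<in>T. c w = 0))"
proof -
  let ?u = "zext S (\<lambda>_. 1)"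
  define G where "G \<delta> = {w :: 'm \<Rightarrow> 'a \<Rightarrow> real. \<forall>b. w b \<in> polyA S (\<delta> - deg b)}" for \<delta>
  define s where "s a w = (\<lambda>b. a * w b)" for a :: "'a \<Rightarrow> real" and w :: "'m \<Rightarrow> 'a \<Rightarrow> real"
  interpret P: connected_graded_ring "polyR S" "polyA S" ?u
    using connected_graded_ring_poly S_props(4) .
  interpret M: connected_graded_module "polyR S" "polyA S" ?u s G
  proof unfold_locales
    fix a :: "'a \<Rightarrow> real" and w :: "'m \<Rightarrow> 'a \<Rightarrow> real" and d' e assume "a \<in> polyA S d'" "w \<in> G e"
    then have "a * w j \<in> polyA S (d' + (e - deg j))" for j unfolding G_def using P.A_mult by blast
    then show "s a w \<in> G (d' + e)" unfolding G_def s_def by (simp add: add_diff_eq)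
  qed (auto simp: s_def G_def fun_eq_iff algebra_simps P.A_0 P.A_add P.A_minus)
  have CR: "C b y \<in> polyR S" if "b \<in> B" "y \<in> Y" for b y using P.A_R C that by blast
  have u_n: "?u * a = a" if "a \<in> polyR S" for a using P.u_neutral that .
  have Lfin: "finite {b. w b \<noteq> 0}" and LB: "\<And>b. w b \<noteq> 0 \<Longrightarrow> b \<in> B" and LR: "\<And>b. w b \<in> polyR S" if "w \<in> L" for w
    using that unfolding L by auto
  have LI: "w \<in> L" if "finite T" "T \<subseteq> B" "\<And>b. b \<notin> T \<Longrightarrow> w b = 0" "\<And>b. w b \<in> polyR S" for w T
    unfolding L using that finite_subset[of "{b. w b \<noteq> 0}" T] by auto
  have g_sup: "g y w = (\<Sum>b\<in>T. w b * C b y)" if "finite T" "\<And>b. b \<notin> T \<Longrightarrow> w b = 0" for y w T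
    unfolding g by (rule sum.mono_neutral_left) (use that in auto)
  have L_add: "w + w' \<in> L" if "w \<in> L" "w' \<in> L" for w w'
    by (rule LI[of "{b. w b \<noteq> 0} \<union> {b. w' b \<noteq> 0}"]) (use that Lfin LB LR P.R_add in auto)
  have L_s: "s a w \<in> L" if "a \<in> polyR S" "w \<in> L" for a w
    by (rule LI[of "{b. w b \<noteq> 0}"]) (use that Lfin LB LR P.R_mult in \<open>auto simp: s_def\<close>)
  have L_0: "0 \<in> L" by (rule LI[of "{}"]) (auto simp: P.R_0)
  have L_su: "s ?u w = w" if "w \<in> L" for w unfolding s_def using u_n LR[OF that] by auto
  have Lsub: "M.submod L" unfolding M.submod_def using L_add L_s L_0 L_su by blast
  have g_add: "g y (w + w') = g y w + g y w'" if "w \<in> L" "w' \<in> L" for y w w'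
  proof -
    let ?T = "{b. w b \<noteq> 0} \<union> {b. w' b \<noteq> 0}"
    have fin: "finite ?T" using that Lfin by auto
    have "g y (w + w') = (\<Sum>b\<in>?T. (w + w') b * C b y)" "g y w = (\<Sum>b\<in>?T. w b * C b y)" "g y w' = (\<Sum>b\<in>?T. w' b * C b y)"
      by (rule g_sup[OF fin], simp)+
    then show ?thesis by (simp add: distrib_right sum.distrib)
  qed
  have g_s: "g y (s a w) = a * g y w" if "w \<in> L" for y a w
  proof -
    have "g y (s a w) = (\<Sum>b\<in>{b. w b \<noteq> 0}. s a w b * C b y)"
      by (rule g_sup) (use that Lfin in \<open>auto simp: s_def\<close>)
    then show ?thesis unfolding g by (simp add: s_def sum_distrib_left mult.assoc)
  qed
  have g_R: "g y w \<in> polyR S" if "w \<in> L" "y \<in> Y" for y w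
    unfolding g by (intro P.R_sum P.R_mult LR CR that) (use that LB in auto)
  have g_A: "g y w \<in> polyA S (\<delta> - dY y)" if "w \<in> L" "w \<in> G \<delta>" "y \<in> Y" for y w \<delta>
    unfolding g
  proof (rule P.A_sum)
    fix b assume "b \<in> {b. w b \<noteq> 0}"
    then have "w b * C b y \<in> polyA S ((\<delta> - deg b) + (deg b - dY y))"
      using that LB[OF that(1)] by (intro P.A_mult C) (auto simp: G_def)
    then show "w b * C b y \<in> polyA S (\<delta> - dY y)" by simp
  qed
  have KL: "K \<subseteq> L" unfolding K by blast
  have K_iff: "w \<in> K \<longleftrightarrow> w \<in> L \<and> (\<forall>y\<in>Y. \<forall>x\<in>S. n \<bullet> x = 0 \<longrightarrow> g y w x = 0)" for w unfolding K by blast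
  have K_add: "w + w' \<in> K" if "w \<in> K" "w' \<in> K" for w w'
    using that L_add unfolding K_iff by (simp add: g_add)
  have K_s: "s a w \<in> K" if "a \<in> polyR S" "w \<in> K" for a w
    using that L_s unfolding K_iff by (simp add: g_s)
  have g_0: "g y 0 = 0" for y unfolding g by simp
  have K_0: "0 \<in> K" unfolding K_iff using L_0 g_0 by simp
  have Ksub: "M.submod K" unfolding M.submod_def using K_add K_s K_0 L_su KL by blast
  \<comment> \<open>On the kernel \<open>g y w\<close> vanishes on the facet and is divisible by
    \<open>lin n\<close>. The quotient is unique since \<open>lin n\<close> can be cancelled; it
    serves as the coordinate of \<open>w\<close> belonging to \<open>y\<close>.\<close>
  define q where "q y w = (THE a. a \<in> polyR S \<and> lin n * a = g y w)" for y w
  have q: "q y w \<in> polyR S" "lin n * q y w = g y w" if "w \<in> K" "y \<in> Y" for y w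
  proof -
    have "\<exists>a\<in>polyR S. g y w = lin n * a"
      by (rule lin_divides[OF n g_R]) (use that KL K_iff in auto)
    then obtain a where a: "a \<in> polyR S" "lin n * a = g y w" by metis
    have "q y w = a" unfolding q_def
      by (rule the_equality) (use a lin_cancel[OF n] in auto)
    then show "q y w \<in> polyR S" "lin n * q y w = g y w" using a by auto
  qed
  have q_eq: "q y w = a" if "w \<in> K" "y \<in> Y" "a \<in> polyR S" "lin n * a = g y w" for a y w
    using lin_cancel[OF n q(1)[OF that(1,2)] that(3)] q(2)[OF that(1,2)] that(4) by simp
  have linR: "lin n \<in> polyR S" using P.A_R lin_polyA by blast
  define Yb where "Yb b = {y\<in>Y. C b y \<noteq> 0}" for b
  define ev :: "'m \<Rightarrow> 'm \<Rightarrow> 'a \<Rightarrow> real" where "ev b = (\<lambda>b'. if b' = b then ?u else 0)" for b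
  \<comment> \<open>The first kind is the standard basis vector corrected by the lift
    \<open>D\<close> so as to land in the kernel. The second kind lies in the kernel because
    \<open>lin n\<close> vanishes on the facet; this factor accounts for the degree
    \<open>dY y + 1\<close> below.\<close>
  define X where "X i = (case i of Inl b \<Rightarrow> ev b - (\<Sum>y\<in>Yb b. s (C b y) (D y)) | Inr y \<Rightarrow> s (lin n) (D y))" for i
  define d where "d i = (case i of Inl b \<Rightarrow> deg b | Inr y \<Rightarrow> dY y + 1)" for i
  define f where "f i w = (case i of Inl b \<Rightarrow> w b | Inr y \<Rightarrow> q y w)" for i w
  let ?I = "B <+> Y"
  have ev_L: "ev b \<in> L" if "b \<in> B" for b
    by (rule LI[of "{b}"]) (use that P.u_R P.R_0 in \<open>auto simp: ev_def\<close>)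
  have g_ev: "g y (ev b) = C b y" if "b \<in> B" "y \<in> Y" for b y
  proof -
    have "g y (ev b) = (\<Sum>b'\<in>{b}. ev b b' * C b' y)" by (rule g_sup) (auto simp: ev_def)
    then show ?thesis using u_n[OF CR[OF that]] by (simp add: ev_def)
  qed
  have g_minus: "g y (w - w') = g y w - g y w'" if "w \<in> L" "w' \<in> L" for y w w'
    using g_add[of "w - w'" w' y] M.submod_diff[OF Lsub that] that by simp
  have g_sum: "g y (sum h T) = (\<Sum>i\<in>T. g y (h i))" if "\<And>i. i \<in> T \<Longrightarrow> h i \<in> L" for y h and T :: "'j set"
    using that by (induct T rule: infinite_finite_induct) (auto simp: g_0 g_add M.submod_sum[OF Lsub])
  have finYb: "finite (Yb b)" if "b \<in> B" for b unfolding Yb_def using Cfin that .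
  have X_Inl: "X (Inl b) \<in> K \<and> X (Inl b) \<in> G (deg b)" if b: "b \<in> B" for b
  proof
    have sD: "s (C b y) (D y) \<in> L" if "y \<in> Yb b" for y using that b L_s CR D(1) unfolding Yb_def by blast
    have sumL: "(\<Sum>y\<in>Yb b. s (C b y) (D y)) \<in> L" using M.submod_sum[OF Lsub sD] .
    have XL: "X (Inl b) \<in> L" unfolding X_def using M.submod_diff[OF Lsub ev_L[OF b] sumL] by simp
    have "g y' (X (Inl b)) x = 0" if y': "y' \<in> Y" and x: "x \<in> S" "n \<bullet> x = 0" for y' x
    proof -
      have "g y' (X (Inl b)) = C b y' - (\<Sum>y\<in>Yb b. C b y * g y' (D y))"
        unfolding X_def using g_minus[OF ev_L[OF b] sumL] g_ev[OF b y'] g_sum[OF sD, of "Yb b"] D(1)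
        by (simp add: g_s Yb_def)
      then have "g y' (X (Inl b)) x = C b y' x - (\<Sum>y\<in>Yb b. C b y x * g y' (D y) x)"
        by (simp add: sum_fun_apply)
      also have "(\<Sum>y\<in>Yb b. C b y x * g y' (D y) x) = (\<Sum>y\<in>Yb b. if y' = y then C b y x else 0)"
        by (rule sum.cong) (use DC[OF _ y' x] in \<open>auto simp: Yb_def\<close>)
      also have "\<dots> = C b y' x" using finYb[OF b] y' by (auto simp: sum.delta' Yb_def)
      finally show ?thesis by simp
    qed
    then show "X (Inl b) \<in> K" using XL unfolding K_iff by blast
    have "ev b \<in> G (deg b)" unfolding G_def ev_def using P.u_A P.A_0 by auto
    moreover have "s (C b y) (D y) \<in> G (deg b)" if "y \<in> Yb b" for y
    proof -
      have "s (C b y) (D y) \<in> G ((deg b - dY y) + dY y)"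
        using that b C D(2) by (intro M.G_s) (auto simp: Yb_def G_def)
      then show ?thesis by simp
    qed
    ultimately show "X (Inl b) \<in> G (deg b)" unfolding X_def by (simp add: M.G_diff M.G_sum)
  qed
  have X_Inr: "X (Inr y) \<in> K \<and> X (Inr y) \<in> G (dY y + 1)" if y: "y \<in> Y" for y
  proof
    have "lin n x = 0" if "n \<bullet> x = 0" for x using that unfolding lin_def zext_def by simp
    then show "X (Inr y) \<in> K" unfolding X_def K_iff using L_s[OF linR D(1)[OF y]] D(1)[OF y] by (simp add: g_s)
    have "s (lin n) (D y) \<in> G (1 + dY y)"
      using D(2)[OF y] lin_polyA by (intro M.G_s) (auto simp: G_def)
    then show "X (Inr y) \<in> G (dY y + 1)" unfolding X_def by (simp add: add.commute)
  qed
  have f_Inr: "q y \<in> M.Fun K (dY y + 1)" if y: "y \<in> Y" for y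
    unfolding M.Fun_def
  proof (intro CollectI conjI ballI allI)
    fix w w' assume w: "w \<in> K"
    show "q y w \<in> polyR S" using q(1)[OF w y] .
    assume w': "w' \<in> K"
    show "q y (w + w') = q y w + q y w'"
      by (rule q_eq[OF K_add[OF w w'] y]) (use q[OF w y] q[OF w' y] g_add[OF subsetD[OF KL w] subsetD[OF KL w'], of y] P.R_add in \<open>auto simp: distrib_left\<close>)
  next
    fix a w assume a: "a \<in> polyR S" and w: "w \<in> K"
    have "lin n * (a * q y w) = g y (s a w)"
      using q(2)[OF w y] g_s w KL by (metis mult.left_commute subsetD)
    then show "q y (s a w) = a * q y w"
      by (intro q_eq[OF K_s[OF a w] y] P.R_mult a q(1)[OF w y])
  next
    fix \<delta> w assume w: "w \<in> K \<inter> G \<delta>"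
    have "lin n * q y w \<in> polyA S (\<delta> - dY y)" using q(2)[of w y] g_A[of w \<delta> y] w y KL by auto
    then have "q y w \<in> polyA S (\<delta> - dY y - 1)" by (intro lin_divides_homogeneous[OF n] q(1)) (use w y in auto)
    then show "q y w \<in> polyA S (\<delta> - (dY y + 1))" by (simp add: algebra_simps)
  qed
  have f_Inl: "(\<lambda>w. w b) \<in> M.Fun K (deg b)" for b
    unfolding M.Fun_def using LR KL by (auto simp: s_def G_def)
  \<comment> \<open>The corrections in \<open>X (Inl b)\<close> add up to the sum of
    \<open>g y k\<close> times \<open>D y\<close>. Writing \<open>g y k\<close> as
    \<open>lin n * q y k\<close> turns this sum into the contribution of the
    \<open>X (Inr y)\<close>, so the two cancel.\<close>
  have expand: "finite {i\<in>?I. f i k \<noteq> 0} \<and> k = (\<Sum>i\<in>{i\<in>?I. f i k \<noteq> 0}. s (f i k) (X i))" if k: "k \<in> K" for k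
  proof -
    have kL: "k \<in> L" using k KL by blast
    define Tb where "Tb = {b. k b \<noteq> 0}"
    define Ty where "Ty = (\<Union>b\<in>Tb. Yb b)"
    have TbB: "Tb \<subseteq> B" unfolding Tb_def using LB[OF kL] by blast
    have finTb: "finite Tb" unfolding Tb_def using Lfin[OF kL] .
    have finTy: "finite Ty" unfolding Ty_def using finTb finYb TbB by blast
    have TyY: "Ty \<subseteq> Y" unfolding Ty_def Yb_def by blast
    have gk: "g y k = (\<Sum>b\<in>Tb. k b * C b y)" for y unfolding g Tb_def ..
    have g_out: "g y k = 0" if "y \<in> Y" "y \<notin> Ty" for y
      unfolding gk using that by (intro sum.neutral) (auto simp: Ty_def Yb_def)
    have q_out: "q y k = 0" if "y \<in> Y" "y \<notin> Ty" for y
      by (rule q_eq[OF k that(1) P.R_0]) (simp add: g_out[OF that])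
    have sub: "{i\<in>?I. f i k \<noteq> 0} \<subseteq> Tb <+> Ty"
    proof
      fix i assume i: "i \<in> {i\<in>?I. f i k \<noteq> 0}"
      show "i \<in> Tb <+> Ty"
      proof (cases i)
        case (Inl b)
        then show ?thesis using i unfolding f_def Tb_def by auto
      next
        case (Inr y)
        then show ?thesis using i q_out[of y] unfolding f_def by auto
      qed
    qed
    have fin: "finite (Tb <+> Ty)" using finTb finTy by simp
    have "(\<Sum>i\<in>{i\<in>?I. f i k \<noteq> 0}. s (f i k) (X i)) = (\<Sum>i\<in>Tb <+> Ty. s (f i k) (X i))"
      by (rule sum.mono_neutral_left[OF fin sub]) (use TbB TyY in auto)
    also have "\<dots> = (\<Sum>b\<in>Tb. s (k b) (X (Inl b))) + (\<Sum>y\<in>Ty. s (q y k) (X (Inr y)))"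
      using finTb finTy by (simp add: sum.Plus f_def)
    also have "(\<Sum>b\<in>Tb. s (k b) (X (Inl b))) = (\<Sum>b\<in>Tb. s (k b) (ev b)) - (\<Sum>b\<in>Tb. \<Sum>y\<in>Yb b. s (k b) (s (C b y) (D y)))"
      unfolding X_def by (simp add: M.s_diff M.s_sum sum_subtractf)
    also have "(\<Sum>b\<in>Tb. \<Sum>y\<in>Yb b. s (k b) (s (C b y) (D y))) = (\<Sum>b\<in>Tb. \<Sum>y\<in>Ty. s (k b * C b y) (D y))"
    proof (rule sum.cong[OF refl])
      fix b assume b: "b \<in> Tb"
      have "(\<Sum>y\<in>Yb b. s (k b * C b y) (D y)) = (\<Sum>y\<in>Ty. s (k b * C b y) (D y))"
        by (rule sum.mono_neutral_left[OF finTy]) (use b TyY in \<open>auto simp: Ty_def Yb_def\<close>)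
      then show "(\<Sum>y\<in>Yb b. s (k b) (s (C b y) (D y))) = (\<Sum>y\<in>Ty. s (k b * C b y) (D y))"
        by (simp add: M.s_mult)
    qed
    also have "\<dots> = (\<Sum>y\<in>Ty. s (g y k) (D y))"
      unfolding gk M.s_sum_left by (rule sum.swap)
    also have "(\<Sum>y\<in>Ty. s (q y k) (X (Inr y))) = (\<Sum>y\<in>Ty. s (g y k) (D y))"
      by (rule sum.cong) (use q(2)[OF k] TyY in \<open>auto simp: X_def M.s_mult[symmetric] mult.commute\<close>)
    also have "(\<Sum>b\<in>Tb. s (k b) (ev b)) = k"
    proof
      fix b'
      have "(\<Sum>b\<in>Tb. s (k b) (ev b)) b' = (\<Sum>b\<in>Tb. s (k b) (ev b) b')" by (rule sum_fun_apply)
      also have "\<dots> = (\<Sum>b\<in>Tb. if b' = b then k b * ?u else 0)"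
        by (rule sum.cong) (auto simp: s_def ev_def)
      also have "\<dots> = (if b' \<in> Tb then k b' * ?u else 0)" using finTb by (simp add: sum.delta')
      also have "\<dots> = k b'" using u_n[OF LR[OF kL], of b'] by (simp add: Tb_def mult.commute)
      finally show "(\<Sum>b\<in>Tb. s (k b) (ev b)) b' = k b'" .
    qed
    also have "k - (\<Sum>y\<in>Ty. s (g y k) (D y)) + (\<Sum>y\<in>Ty. s (g y k) (D y)) = k" by (rule diff_add_cancel)
    finally have "(\<Sum>i\<in>{i\<in>?I. f i k \<noteq> 0}. s (f i k) (X i)) = k" .
    then have "k = (\<Sum>i\<in>{i\<in>?I. f i k \<noteq> 0}. s (f i k) (X i))" by (rule sym)
    then show ?thesis using finite_subset[OF sub fin] by (intro conjI)
  qed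
  have "M.frame K ?I d X f"
    unfolding M.frame_def
  proof (intro conjI ballI Ksub)
    fix i assume i: "i \<in> ?I"
    show "X i \<in> K" "X i \<in> G (d i)" using i X_Inl X_Inr unfolding d_def by (auto split: sum.splits)
    show "f i \<in> M.Fun K (d i)"
    proof (cases i)
      case (Inl b)
      then show ?thesis using f_Inl[of b] unfolding f_def d_def by simp
    next
      case (Inr y)
      then show ?thesis using f_Inr[of y] i unfolding f_def d_def by auto
    qed
  qed (use expand in blast)+
  then obtain U where U: "M.basis U K" using M.basis_of_frame by blast
  then have U': "U \<subseteq> K" "\<forall>w\<in>U. \<exists>e. w \<in> G e" "K \<subseteq> M.spn U" "M.indep U"
    unfolding M.basis_def by simp_all
  have "\<forall>w\<in>U. \<exists>\<delta>. \<forall>b. w b \<in> polyA S (\<delta> - deg b)"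
    using U'(2) unfolding G_def by simp
  moreover have "\<forall>p\<in>K. \<exists>T c. finite T \<and> T \<subseteq> U \<and> (\<forall>w\<in>T. c w \<in> polyR S) \<and> p = (\<Sum>w\<in>T. (\<lambda>b. c w * w b))"
  proof
    fix p assume "p \<in> K"
    then have "p \<in> M.spn U" using U'(3) by blast
    then show "\<exists>T c. finite T \<and> T \<subseteq> U \<and> (\<forall>w\<in>T. c w \<in> polyR S) \<and> p = (\<Sum>w\<in>T. (\<lambda>b. c w * w b))"
      unfolding M.spn_def s_def by (rule CollectD)
  qed
  moreover have "\<forall>T c. finite T \<longrightarrow> T \<subseteq> U \<longrightarrow> (\<forall>w\<in>T. c w \<in> polyR S) \<longrightarrow> (\<Sum>w\<in>T. (\<lambda>b. c w * w b)) = 0 \<longrightarrow> (\<forall>w\<in>T. c w = 0)"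
    using U'(4) unfolding M.indep_def s_def .
  ultimately show ?thesis using U'(1) by (intro exI[of _ U] conjI)
qed

end

section \<open>Finite sums, graded submodules and homogeneous components\<close>

lemma finsum_additive:
  fixes f :: "'m \<Rightarrow> 'b::ab_group_add" and M :: "('m, 'z) ring_scheme"
  assumes M: "abelian_monoid M" and add: "\<And>x y. x \<in> carrier M \<Longrightarrow> y \<in> carrier M \<Longrightarrow> f (x \<oplus>\<^bsub>M\<^esub> y) = f x + f y"
    and g: "finite T" "\<And>i. i \<in> T \<Longrightarrow> g i \<in> carrier M"
  shows "f (finsum M g T) = (\<Sum>i\<in>T. f (g i))"
proof -
  interpret abelian_monoid M by (rule M)
  have 0: "f \<zero>\<^bsub>M\<^esub> = 0" using add[of "\<zero>\<^bsub>M\<^esub>" "\<zero>\<^bsub>M\<^esub>"] by simp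
  from g show ?thesis
  proof (induct T rule: finite_induct)
    case (insert i T)
    then have "finsum M g T \<in> carrier M" "g i \<in> carrier M" by (auto intro!: finsum_closed)
    then show ?case using insert add by (simp add: finsum_insert Pi_def)
  qed (simp add: 0)
qed

lemma finsum_additive_hom:
  assumes M: "abelian_group M" and M': "abelian_group M'"
    and cl: "\<And>x. x \<in> carrier M \<Longrightarrow> h x \<in> carrier M'"
    and add: "\<And>x y. x \<in> carrier M \<Longrightarrow> y \<in> carrier M \<Longrightarrow> h (x \<oplus>\<^bsub>M\<^esub> y) = h x \<oplus>\<^bsub>M'\<^esub> h y"
    and g: "finite T" "\<And>i. i \<in> T \<Longrightarrow> g i \<in> carrier M"
  shows "h (finsum M g T) = finsum M' (\<lambda>i. h (g i)) T"
proof -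
  interpret M: abelian_group M by (rule M)
  interpret M': abelian_group M' by (rule M')
  have "h \<zero>\<^bsub>M\<^esub> \<oplus>\<^bsub>M'\<^esub> h \<zero>\<^bsub>M\<^esub> = h \<zero>\<^bsub>M\<^esub>" using add[of "\<zero>\<^bsub>M\<^esub>" "\<zero>\<^bsub>M\<^esub>"] by simp
  then have 0: "h \<zero>\<^bsub>M\<^esub> = \<zero>\<^bsub>M'\<^esub>" using cl[of "\<zero>\<^bsub>M\<^esub>"] M'.add.l_cancel_one by auto
  from g show ?thesis
  proof (induct T rule: finite_induct)
    case (insert i T)
    then have "finsum M g T \<in> carrier M" "g i \<in> carrier M" by (auto intro!: M.finsum_closed)
    then show ?case using insert add cl by (simp add: M.finsum_insert M'.finsum_insert Pi_def)
  qed (simp add: 0)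
qed

lemma finsum_in_subset:
  assumes M: "abelian_monoid M" and H: "H \<subseteq> carrier M" "\<zero>\<^bsub>M\<^esub> \<in> H" "\<And>x y. x \<in> H \<Longrightarrow> y \<in> H \<Longrightarrow> x \<oplus>\<^bsub>M\<^esub> y \<in> H"
    and g: "finite T" "\<And>i. i \<in> T \<Longrightarrow> g i \<in> H"
  shows "finsum M g T \<in> H"
proof -
  interpret abelian_monoid M by (rule M)
  from g show ?thesis
  proof (induct T rule: finite_induct)
    case (insert i T)
    then have "g \<in> T \<rightarrow> carrier M" "g i \<in> carrier M" using H(1) by auto
    then show ?case using insert H(3) by (simp add: finsum_insert)
  qed (simp add: H(2))
qed

lemma finsum_subrecord:
  fixes M M' :: "('m, 'z) ring_scheme"
  assumes M: "abelian_monoid M" "abelian_monoid M'" and eq: "add M' = add M" "zero M' = zero M" "carrier M' \<subseteq> carrier M"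
    and g: "\<And>i. i \<in> T \<Longrightarrow> g i \<in> carrier M'"
  shows "finsum M' g T = finsum M g T"
proof -
  interpret M: abelian_monoid M by (rule M)
  interpret M': abelian_monoid M' by (rule M)
  show ?thesis
    using g
  proof (induct T rule: infinite_finite_induct)
    case (insert i T)
    then have "g \<in> T \<rightarrow> carrier M'" "g i \<in> carrier M'" "g \<in> T \<rightarrow> carrier M" "g i \<in> carrier M" using eq(3) by auto
    then show ?case using insert by (simp add: M.finsum_insert M'.finsum_insert eq)
  qed (simp_all add: M.finsum_infinite M'.finsum_infinite eq)
qed

lemma finsum_restrict_nonzero:
  assumes M: "abelian_monoid M" and g: "finite T" "\<And>i. i \<in> T \<Longrightarrow> g i \<in> carrier M" and T': "T' \<subseteq> T" "\<And>i. i \<in> T - T' \<Longrightarrow> g i = \<zero>\<^bsub>M\<^esub>"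
  shows "finsum M g T' = finsum M g T"
proof -
  interpret abelian_monoid M by (rule M)
  show ?thesis by (rule add.finprod_mono_neutral_cong_left) (use g T' in auto)
qed

lemma graded_moduleD:
  assumes "graded_module R H M G"
  shows "Module.module R M" "cring R" "abelian_group M" "abelian_monoid M"
    "x \<in> G d \<Longrightarrow> x \<in> carrier M" "\<zero>\<^bsub>M\<^esub> \<in> G d" "x \<in> G d \<Longrightarrow> y \<in> G d \<Longrightarrow> x \<oplus>\<^bsub>M\<^esub> y \<in> G d"
    "x \<in> G d \<Longrightarrow> \<ominus>\<^bsub>M\<^esub> x \<in> G d"
    "a \<in> H i \<Longrightarrow> x \<in> G j \<Longrightarrow> a \<odot>\<^bsub>M\<^esub> x \<in> G (int i + j)"
proof -
  show m: "Module.module R M" using assms unfolding graded_module_def by blast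
  interpret m: Module.module R M by (rule m)
  show "cring R" "abelian_group M" "abelian_monoid M" by unfold_locales
  have s: "additive_subgroup (G d) M" using assms unfolding graded_module_def by blast
  interpret s: additive_subgroup "G d" M by (rule s)
  show "x \<in> G d \<Longrightarrow> x \<in> carrier M" using s.a_subset by blast
  show "\<zero>\<^bsub>M\<^esub> \<in> G d" "x \<in> G d \<Longrightarrow> y \<in> G d \<Longrightarrow> x \<oplus>\<^bsub>M\<^esub> y \<in> G d" by auto
  show "x \<in> G d \<Longrightarrow> \<ominus>\<^bsub>M\<^esub> x \<in> G d" using s.a_inv_closed m.abelian_group_axioms by blast
  show "a \<in> H i \<Longrightarrow> x \<in> G j \<Longrightarrow> a \<odot>\<^bsub>M\<^esub> x \<in> G (int i + j)" using assms unfolding graded_module_def by blast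
qed

lemma graded_exists:
  assumes gm: "graded_module R H M G" and x: "x \<in> carrier M"
  obtains T c where "finite T" "\<And>d. c d \<in> G d" "x = finsum M c T"
  using gm x unfolding graded_module_def by blast

text \<open>The definition of a graded module sums over the exact support of a family. Cutting both
  families off to zero outside \<open>T\<close> brings them into that form.\<close>

lemma graded_unique:
  assumes gm: "graded_module R H M G" and T: "finite T" and c: "\<And>d. d \<in> T \<Longrightarrow> c d \<in> G d" "\<And>d. d \<in> T \<Longrightarrow> c' d \<in> G d"
    and eq: "finsum M c T = finsum M c' T" and d: "d \<in> T"
  shows "c d = c' d"
proof -
  note gmD = graded_moduleD[OF gm]
  interpret abelian_monoid M by (rule gmD)
  define e where "e c = (\<lambda>d. if d \<in> T then c d else \<zero>\<^bsub>M\<^esub>)" for c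
  have e: "(\<forall>d. e c d \<in> G d) \<and> finite {d. e c d \<noteq> \<zero>\<^bsub>M\<^esub>} \<and> finsum M (e c) {d. e c d \<noteq> \<zero>\<^bsub>M\<^esub>} = finsum M c T"
    if c: "\<And>d. d \<in> T \<Longrightarrow> c d \<in> G d" for c
  proof (intro conjI)
    show "\<forall>d. e c d \<in> G d" unfolding e_def using c gmD(6) by auto
    have sub: "{d. e c d \<noteq> \<zero>\<^bsub>M\<^esub>} \<subseteq> T" unfolding e_def by auto
    then show "finite {d. e c d \<noteq> \<zero>\<^bsub>M\<^esub>}" using T finite_subset by blast
    have "finsum M (e c) {d. e c d \<noteq> \<zero>\<^bsub>M\<^esub>} = finsum M (e c) T"
      by (rule finsum_restrict_nonzero[OF gmD(4) T _ sub]) (use c gmD(5) in \<open>auto simp: e_def\<close>)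
    also have "\<dots> = finsum M c T"
      by (rule finsum_cong') (use c gmD(5) in \<open>auto simp: e_def\<close>)
    finally show "finsum M (e c) {d. e c d \<noteq> \<zero>\<^bsub>M\<^esub>} = finsum M c T" .
  qed
  have "finsum M c T \<in> carrier M" using c gmD(5) by (intro finsum_closed) blast
  then have "\<exists>!c'. (\<forall>d. c' d \<in> G d) \<and> finite {d. c' d \<noteq> \<zero>\<^bsub>M\<^esub>} \<and> finsum M c T = finsum M c' {d. c' d \<noteq> \<zero>\<^bsub>M\<^esub>}"
    using gm unfolding graded_module_def by blast
  then have "e c = e c'" using e[OF c(1)] e[OF c(2)] eq by metis
  then show ?thesis using d unfolding e_def by meson
qed

text \<open>The change of rings \<open>h\<close> covers the localized sheaf, on which functions on a
  subfan act through restriction to its front part. The assumption \<open>comp\<close> says that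
  \<open>K\<close> contains the homogeneous components of its elements.\<close>

lemma graded_submodule:
  fixes M :: "('r, 'm) module"
  assumes gm: "graded_module R' H' M G" and R: "cring R"
    and h: "\<And>a. a \<in> carrier R \<Longrightarrow> h a \<in> carrier R'" "h \<one>\<^bsub>R\<^esub> = \<one>\<^bsub>R'\<^esub>"
      "\<And>a b. a \<in> carrier R \<Longrightarrow> b \<in> carrier R \<Longrightarrow> h (a \<oplus>\<^bsub>R\<^esub> b) = h a \<oplus>\<^bsub>R'\<^esub> h b"
      "\<And>a b. a \<in> carrier R \<Longrightarrow> b \<in> carrier R \<Longrightarrow> h (a \<otimes>\<^bsub>R\<^esub> b) = h a \<otimes>\<^bsub>R'\<^esub> h b"
      "\<And>a i. a \<in> H i \<Longrightarrow> h a \<in> H' i"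
    and K: "K \<subseteq> carrier M" "\<zero>\<^bsub>M\<^esub> \<in> K" "\<And>x y. x \<in> K \<Longrightarrow> y \<in> K \<Longrightarrow> x \<oplus>\<^bsub>M\<^esub> y \<in> K"
      "\<And>a x. a \<in> carrier R' \<Longrightarrow> x \<in> K \<Longrightarrow> a \<odot>\<^bsub>M\<^esub> x \<in> K"
      "\<And>a x i. a \<in> H' i \<Longrightarrow> x \<in> K \<Longrightarrow> a \<odot>\<^bsub>M\<^esub> x \<in> K"
    and comp: "\<And>T c d. finite T \<Longrightarrow> (\<And>d. c d \<in> G d) \<Longrightarrow> finsum M c T \<in> K \<Longrightarrow> d \<in> T \<Longrightarrow> c d \<in> K"
  shows "graded_module R H (M\<lparr>carrier := K, smult := \<lambda>a x. h a \<odot>\<^bsub>M\<^esub> x\<rparr>) (\<lambda>d. G d \<inter> K)"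
proof -
  let ?M = "M\<lparr>carrier := K, smult := \<lambda>a x. h a \<odot>\<^bsub>M\<^esub> x\<rparr>"
  note gmD = graded_moduleD[OF gm]
  interpret M: Module.module R' M by (rule gmD)
  have Kc: "x \<in> K \<Longrightarrow> x \<in> carrier M" for x using K(1) by blast
  have minus: "\<ominus>\<^bsub>M\<^esub> x \<in> K" if "x \<in> K" for x
  proof -
    have "(\<ominus>\<^bsub>R'\<^esub> \<one>\<^bsub>R'\<^esub>) \<odot>\<^bsub>M\<^esub> x = \<ominus>\<^bsub>M\<^esub> x" using Kc[OF that] by (simp add: M.smult_l_minus)
    then show ?thesis using K(4)[of "\<ominus>\<^bsub>R'\<^esub> \<one>\<^bsub>R'\<^esub>" x] that by simp
  qed
  have grp: "abelian_group ?M"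
  proof (rule abelian_groupI)
    fix x assume x: "x \<in> carrier ?M"
    then show "\<exists>y\<in>carrier ?M. y \<oplus>\<^bsub>?M\<^esub> x = \<zero>\<^bsub>?M\<^esub>"
      using minus[of x] Kc[of x] by (intro bexI[of _ "\<ominus>\<^bsub>M\<^esub> x"]) (auto simp: M.M.l_neg)
  qed (use K(2,3) Kc in \<open>auto simp: M.M.a_ac\<close>)
  then interpret S: abelian_group ?M .
  have mon: "abelian_monoid ?M" by unfold_locales
  have mod: "Module.module R ?M"
    by (rule moduleI[OF R grp])
      (use h K(4) Kc M.smult_l_distr M.smult_r_distr M.smult_assoc1 in auto)
  have sub: "additive_subgroup (G d \<inter> K) ?M" for d
  proof (intro additive_subgroup.intro subgroup.intro)
    show "G d \<inter> K \<subseteq> carrier (add_monoid ?M)" by auto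
    show "x \<otimes>\<^bsub>add_monoid ?M\<^esub> y \<in> G d \<inter> K" if "x \<in> G d \<inter> K" "y \<in> G d \<inter> K" for x y
      using that K(3) gmD(7) by auto
    show "\<one>\<^bsub>add_monoid ?M\<^esub> \<in> G d \<inter> K" using K(2) gmD(6) by auto
    show "inv\<^bsub>add_monoid ?M\<^esub> x \<in> G d \<inter> K" if "x \<in> G d \<inter> K" for x
    proof -
      have "\<ominus>\<^bsub>?M\<^esub> x = \<ominus>\<^bsub>M\<^esub> x"
        by (rule S.minus_equality) (use that minus[of x] Kc[of x] in \<open>auto simp: M.M.l_neg\<close>)
      then show ?thesis using that minus gmD(8) unfolding a_inv_def by auto
    qed
  qed
  have "\<exists>!c. (\<forall>d. c d \<in> G d \<inter> K) \<and> finite {d. c d \<noteq> \<zero>\<^bsub>?M\<^esub>} \<and> x = finsum ?M c {d. c d \<noteq> \<zero>\<^bsub>?M\<^esub>}"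
    if x: "x \<in> carrier ?M" for x
  proof -
    have xM: "x \<in> carrier M" using x Kc by simp
    have ex: "\<exists>!c. (\<forall>d. c d \<in> G d) \<and> finite {d. c d \<noteq> \<zero>\<^bsub>M\<^esub>} \<and> x = finsum M c {d. c d \<noteq> \<zero>\<^bsub>M\<^esub>}"
      using gm xM unfolding graded_module_def by blast
    have eq: "finsum ?M c T = finsum M c T" if "\<And>d. c d \<in> K" for c and T :: "int set"
      by (rule finsum_subrecord[OF gmD(4) mon]) (use that K(1) in auto)
    obtain c where c: "\<forall>d. c d \<in> G d" "finite {d. c d \<noteq> \<zero>\<^bsub>M\<^esub>}" "x = finsum M c {d. c d \<noteq> \<zero>\<^bsub>M\<^esub>}"
      using ex by blast
    have cK: "c d \<in> K" for d
    proof (cases "c d = \<zero>\<^bsub>M\<^esub>")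
      case False
      then show ?thesis using comp[OF c(2), of c d] c x by simp
    qed (use K(2) in simp)
    show ?thesis
    proof (rule ex1I[of _ c])
      show "(\<forall>d. c d \<in> G d \<inter> K) \<and> finite {d. c d \<noteq> \<zero>\<^bsub>?M\<^esub>} \<and> x = finsum ?M c {d. c d \<noteq> \<zero>\<^bsub>?M\<^esub>}"
        using c cK eq[OF cK] by simp
      fix c' assume c': "(\<forall>d. c' d \<in> G d \<inter> K) \<and> finite {d. c' d \<noteq> \<zero>\<^bsub>?M\<^esub>} \<and> x = finsum ?M c' {d. c' d \<noteq> \<zero>\<^bsub>?M\<^esub>}"
      then have "c' d \<in> K" for d by blast
      from eq[OF this] c' have "(\<forall>d. c' d \<in> G d) \<and> finite {d. c' d \<noteq> \<zero>\<^bsub>M\<^esub>} \<and> x = finsum M c' {d. c' d \<noteq> \<zero>\<^bsub>M\<^esub>}" by simp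
      then show "c' = c" using ex c by blast
    qed
  qed
  moreover have "a \<odot>\<^bsub>?M\<^esub> x \<in> G (int i + j) \<inter> K" if "a \<in> H i" "x \<in> G j \<inter> K" for a x i j
    using that gmD(9)[OF h(5)[OF that(1)]] K(5)[OF h(5)[OF that(1)]] by simp
  ultimately show ?thesis unfolding graded_module_def using mod sub by blast
qed

text \<open>The images of the components are the components of 0, hence zero. This is how kernels
  satisfy the assumption \<open>comp\<close> of \<open>graded_submodule\<close>.\<close>

lemma graded_kernel_component:
  assumes gm: "graded_module R H M G" and gm': "graded_module R' H' M' G'"
    and p: "\<And>x. x \<in> carrier M \<Longrightarrow> p x \<in> carrier M'" "\<And>x d. x \<in> G d \<Longrightarrow> p x \<in> G' d"
      "\<And>x y. x \<in> carrier M \<Longrightarrow> y \<in> carrier M \<Longrightarrow> p (x \<oplus>\<^bsub>M\<^esub> y) = p x \<oplus>\<^bsub>M'\<^esub> p y"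
    and T: "finite T" "\<And>d. c d \<in> G d" "p (finsum M c T) = \<zero>\<^bsub>M'\<^esub>" "d \<in> T"
  shows "p (c d) = \<zero>\<^bsub>M'\<^esub>"
proof -
  note D = graded_moduleD[OF gm] and D' = graded_moduleD[OF gm']
  interpret M': abelian_group M' by (rule D')
  have "p (finsum M c T) = finsum M' (\<lambda>d. p (c d)) T"
    by (rule finsum_additive_hom[OF D(3) D'(3) p(1,3) T(1)]) (use T(2) D(5) in auto)
  moreover have "finsum M' (\<lambda>_. \<zero>\<^bsub>M'\<^esub>) T = \<zero>\<^bsub>M'\<^esub>" by (rule M'.finsum_zero)
  ultimately have "finsum M' (\<lambda>d. p (c d)) T = finsum M' (\<lambda>_. \<zero>\<^bsub>M'\<^esub>) T" using T(3) by metis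
  then show ?thesis
    using graded_unique[OF gm' T(1), of "\<lambda>d. p (c d)" "\<lambda>_. \<zero>\<^bsub>M'\<^esub>" d] p(2)[OF T(2)] D'(6) T(4) by blast
qed

text \<open>The degree \<open>d\<close> component of any preimage is a preimage, by uniqueness of
  components in the target.\<close>

lemma graded_lift:
  assumes gm: "graded_module R H M G" and gm': "graded_module R' H' M' G'"
    and p: "\<And>x. x \<in> carrier M \<Longrightarrow> p x \<in> carrier M'" "\<And>x d. x \<in> G d \<Longrightarrow> p x \<in> G' d"
      "\<And>x y. x \<in> carrier M \<Longrightarrow> y \<in> carrier M \<Longrightarrow> p (x \<oplus>\<^bsub>M\<^esub> y) = p x \<oplus>\<^bsub>M'\<^esub> p y"
    and x: "x \<in> carrier M" "p x \<in> G' d"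
  shows "\<exists>y\<in>G d. p y = p x"
proof -
  note D = graded_moduleD[OF gm] and D' = graded_moduleD[OF gm']
  interpret M: abelian_group M by (rule D)
  interpret M': abelian_group M' by (rule D')
  obtain T c where T: "finite T" "\<And>d. c d \<in> G d" "x = finsum M c T" using graded_exists[OF gm x(1)] by blast
  define c' where "c' e = (if e \<in> T then c e else \<zero>\<^bsub>M\<^esub>)" for e
  have c': "c' e \<in> G e" for e unfolding c'_def using T(2) D(6) by auto
  have "finsum M c T = finsum M c' T"
    by (rule M.finsum_cong') (use D(5)[OF c'] D(5)[OF T(2)] in \<open>auto simp: c'_def\<close>)
  \<comment> \<open>Degree \<open>d\<close> is added to the index set because the given
    decomposition of \<open>x\<close> need not mention it.\<close>
  also have "\<dots> = finsum M c' (insert d T)"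
    by (rule finsum_restrict_nonzero[OF D(4)]) (use T(1) D(5)[OF T(2)] D(5)[OF D(6)] in \<open>auto simp: c'_def\<close>)
  finally have x': "x = finsum M c' (insert d T)" using T(3) by simp
  have fin: "finite (insert d T)" using T(1) by simp
  have "p x = finsum M' (\<lambda>e. p (c' e)) (insert d T)"
    unfolding x' by (rule finsum_additive_hom[OF D(3) D'(3) p(1,3) fin]) (use c' D(5) in auto)
  moreover have "finsum M' (\<lambda>e. if e = d then p x else \<zero>\<^bsub>M'\<^esub>) (insert d T) = finsum M' (\<lambda>e. if e = d then p x else \<zero>\<^bsub>M'\<^esub>) {d}"
    by (rule finsum_restrict_nonzero[OF D'(4) fin, symmetric]) (use p(1)[OF x(1)] in auto)
  moreover have "\<dots> = p x" using p(1)[OF x(1)] by simp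
  ultimately have "finsum M' (\<lambda>e. p (c' e)) (insert d T) = finsum M' (\<lambda>e. if e = d then p x else \<zero>\<^bsub>M'\<^esub>) (insert d T)"
    by simp
  from graded_unique[OF gm' fin _ _ this, of d] have "p (c' d) = p x"
    using p(2)[OF c'] x(2) D'(6) by auto
  then show ?thesis using c' by blast
qed

section \<open>Stalk rings and coordinates on free stalks\<close>

abbreviation cring_of :: "'a::euclidean_space set \<Rightarrow> ('a \<Rightarrow> real) ring" where
  "cring_of S \<equiv> conewise_ring (cone_faces S)"

abbreviation chom_of :: "'a::euclidean_space set \<Rightarrow> nat \<Rightarrow> ('a \<Rightarrow> real) set" where
  "chom_of S \<equiv> conewise_homogeneous (cone_faces S)"

text \<open>The cone is one of its own faces, so a conewise polynomial on the fan of its faces is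
  given by a single polynomial.\<close>

lemma cring_of_carrier:
  assumes S: "pointed_polyhedral_cone S"
  shows "a \<in> carrier (cring_of S) \<longleftrightarrow> a \<in> extensional S \<and> zext S a \<in> polyR S"
    and "a \<in> chom_of S d \<longleftrightarrow> a \<in> extensional S \<and> zext S a \<in> polyA S (int d)"
proof -
  have faces: "S \<in> cone_faces S" "\<And>F. F \<in> cone_faces S \<Longrightarrow> F \<subseteq> S" using cone_faces_self[OF S] cone_faces_subset by blast+
  show "a \<in> carrier (cring_of S) \<longleftrightarrow> a \<in> extensional S \<and> zext S a \<in> polyR S"
  proof
    assume "a \<in> carrier (cring_of S)"
    then have a: "a \<in> extensional S" "\<exists>p. real_polynomial_function p \<and> (\<forall>x\<in>S. a x = p x)"
      using faces(1) unfolding conewise_ring_def conewise_poly_def Union_cone_faces[OF S] by auto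
    then show "a \<in> extensional S \<and> zext S a \<in> polyR S" unfolding polyR_def zext_def by auto
  next
    assume a: "a \<in> extensional S \<and> zext S a \<in> polyR S"
    then obtain p where "real_polynomial_function p" "\<forall>x\<in>S. a x = p x" unfolding polyR_def zext_def by auto
    then show "a \<in> carrier (cring_of S)"
      using a faces(2) unfolding conewise_ring_def conewise_poly_def Union_cone_faces[OF S] by fastforce
  qed
  show "a \<in> chom_of S d \<longleftrightarrow> a \<in> extensional S \<and> zext S a \<in> polyA S (int d)"
  proof
    assume "a \<in> chom_of S d"
    then have a: "a \<in> extensional S" "\<exists>p. hom_poly p d \<and> (\<forall>x\<in>S. a x = p x)"
      using faces(1) unfolding conewise_homogeneous_def Union_cone_faces[OF S] hom_poly_def by auto
    then show "a \<in> extensional S \<and> zext S a \<in> polyA S (int d)" unfolding polyA_def zext_def by auto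
  next
    assume a: "a \<in> extensional S \<and> zext S a \<in> polyA S (int d)"
    then obtain p where "hom_poly p d" "\<forall>x\<in>S. a x = p x" unfolding polyA_def zext_def by auto
    then show "a \<in> chom_of S d"
      using a faces(2) unfolding conewise_homogeneous_def Union_cone_faces[OF S] hom_poly_def by fastforce
  qed
qed

lemma cring_of_ops:
  assumes S: "pointed_polyhedral_cone S"
  shows "\<zero>\<^bsub>cring_of S\<^esub> = restrict (\<lambda>_. 0) S" "\<one>\<^bsub>cring_of S\<^esub> = restrict (\<lambda>_. 1) S"
    "a \<oplus>\<^bsub>cring_of S\<^esub> b = restrict (\<lambda>x. a x + b x) S" "a \<otimes>\<^bsub>cring_of S\<^esub> b = restrict (\<lambda>x. a x * b x) S"
  unfolding conewise_ring_def Union_cone_faces[OF S] by simp_all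

lemma zext_restrict_id [simp]: "zext S (restrict a S) = zext S a"
  unfolding zext_def by auto

lemma restrict_zext_id [simp]: "a \<in> extensional S \<Longrightarrow> restrict (zext S a) S = a"
  unfolding zext_def restrict_def extensional_def by auto

lemma zext_polyR_id: "f \<in> polyR S \<Longrightarrow> zext S f = f"
  unfolding polyR_def zext_def by auto

lemma restrict_in_cring_of:
  assumes "pointed_polyhedral_cone S" "f \<in> polyR S"
  shows "restrict f S \<in> carrier (cring_of S)"
  using assms cring_of_carrier(1)[OF assms(1), of "restrict f S"] zext_polyR_id[OF assms(2)] by simp

lemma zext_eq_0_iff:
  assumes "pointed_polyhedral_cone S" "a \<in> carrier (cring_of S)"
  shows "zext S a = 0 \<longleftrightarrow> a = \<zero>\<^bsub>cring_of S\<^esub>"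
proof -
  have "a \<in> extensional S" using assms cring_of_carrier(1) by blast
  then have "a = \<zero>\<^bsub>cring_of S\<^esub> \<longleftrightarrow> (\<forall>x\<in>S. a x = 0)"
    unfolding cring_of_ops[OF assms(1)] by (auto simp: extensional_def restrict_def fun_eq_iff)
  moreover have "zext S a = 0 \<longleftrightarrow> (\<forall>x\<in>S. a x = 0)" unfolding zext_def by (auto simp: fun_eq_iff)
  ultimately show ?thesis by blast
qed

text \<open>The free module on \<open>B\<close>, realised by finitely supported vectors indexed by
  the whole type of sections.\<close>

definition fin_vectors :: "'a::euclidean_space set \<Rightarrow> 'm set \<Rightarrow> ('m \<Rightarrow> 'a \<Rightarrow> real) set" where
  "fin_vectors S B = {w. finite {b. w b \<noteq> 0} \<and> (\<forall>b. w b \<noteq> 0 \<longrightarrow> b \<in> B) \<and> (\<forall>b. w b \<in> polyR S)}"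

text \<open>Graded freeness restated as an isomorphism \<open>co\<close> onto the free module on
  \<open>B\<close> with generators in degrees \<open>deg\<close>. In this form kernels and matrices
  can be handled with ordinary sums of functions.\<close>

locale coordinates =
  fixes S :: "'a::euclidean_space set" and M :: "('a \<Rightarrow> real, 'm) module" and G :: "int \<Rightarrow> 'm set"
    and B :: "'m set" and deg :: "'m \<Rightarrow> int" and co :: "'m \<Rightarrow> 'm \<Rightarrow> 'a \<Rightarrow> real"
  assumes S: "pointed_polyhedral_cone S"
    and gm: "graded_module (cring_of S) (chom_of S) M G"
    and B_deg: "b \<in> B \<Longrightarrow> b \<in> G (deg b)"
    and co_in: "x \<in> carrier M \<Longrightarrow> co x \<in> fin_vectors S B"
    and co_add: "x \<in> carrier M \<Longrightarrow> y \<in> carrier M \<Longrightarrow> co (x \<oplus>\<^bsub>M\<^esub> y) = co x + co y"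
    and co_smult: "a \<in> carrier (cring_of S) \<Longrightarrow> x \<in> carrier M \<Longrightarrow> co (a \<odot>\<^bsub>M\<^esub> x) = (\<lambda>b. zext S a * co x b)"
    and co_inj: "x \<in> carrier M \<Longrightarrow> y \<in> carrier M \<Longrightarrow> co x = co y \<Longrightarrow> x = y"
    and co_surj: "w \<in> fin_vectors S B \<Longrightarrow> \<exists>x\<in>carrier M. co x = w"
    and co_G: "x \<in> carrier M \<Longrightarrow> x \<in> G d \<longleftrightarrow> (\<forall>b. co x b \<in> polyA S (d - deg b))"
    and co_B: "b \<in> B \<Longrightarrow> co b = (\<lambda>b'. if b' = b then zext S (\<lambda>_. 1) else 0)"
    and co_expand: "x \<in> carrier M \<Longrightarrow> x = finsum M (\<lambda>b. restrict (co x b) S \<odot>\<^bsub>M\<^esub> b) {b. co x b \<noteq> 0}"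

lemma ex1_unique: "\<exists>!x. P x \<Longrightarrow> P a \<Longrightarrow> P b \<Longrightarrow> a = b"
  by blast

text \<open>The coordinate map is the inverse of the map \<open>lc\<close> forming linear
  combinations. Freeness supplies homogeneous basis elements but is silent on degrees of
  coefficients. That homogeneous elements have homogeneous coordinates is proved by splitting the
  coordinates according to total degree and using uniqueness of components in the module.\<close>

lemma obtain_coordinates:
  fixes M :: "('a::euclidean_space \<Rightarrow> real, 'm) module"
  assumes S: "pointed_polyhedral_cone S" and gm: "graded_module (cring_of S) (chom_of S) M G"
    and free: "graded_free (cring_of S) M G"
  obtains B deg co where "coordinates S M G B deg co"
proof -
  let ?R = "cring_of S"
  note D = graded_moduleD[OF gm]
  interpret P: connected_graded_ring "polyR S" "polyA S" "zext S (\<lambda>_. 1)"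
    using connected_graded_ring_poly pointed_polyhedral_coneD(4)[OF S] by blast
  interpret M: Module.module ?R M by (rule D(1))
  note ops = cring_of_ops[OF S]
  obtain B where BG: "B \<subseteq> (\<Union>d. G d)" and uniq: "\<forall>x\<in>carrier M. \<exists>!c. c \<in> B \<rightarrow>\<^sub>E carrier ?R \<and>
        finite {b \<in> B. c b \<noteq> \<zero>\<^bsub>?R\<^esub>} \<and> x = finsum M (\<lambda>b. c b \<odot>\<^bsub>M\<^esub> b) {b \<in> B. c b \<noteq> \<zero>\<^bsub>?R\<^esub>}"
    using free unfolding graded_free_def by blast
  then have "\<forall>b\<in>B. \<exists>d. b \<in> G d" by blast
  then obtain deg where deg: "\<And>b. b \<in> B \<Longrightarrow> b \<in> G (deg b)" by metis
  have BM: "b \<in> carrier M" if "b \<in> B" for b using D(5)[OF deg[OF that]] .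
  have rR: "restrict f S \<in> carrier ?R" if "f \<in> polyR S" for f using restrict_in_cring_of[OF S that] .
  have r0: "restrict (0 :: 'a \<Rightarrow> real) S = \<zero>\<^bsub>?R\<^esub>" unfolding ops by (auto simp: restrict_def)
  have r0_iff: "restrict f S = \<zero>\<^bsub>?R\<^esub> \<longleftrightarrow> f = 0" if "f \<in> polyR S" for f
    using zext_eq_0_iff[OF S rR[OF that]] zext_polyR_id[OF that] by simp
  have radd: "restrict (f + g) S = restrict f S \<oplus>\<^bsub>?R\<^esub> restrict g S" for f g unfolding ops by (auto simp: restrict_def)
  have rmult: "restrict (f * g) S = restrict f S \<otimes>\<^bsub>?R\<^esub> restrict g S" for f g unfolding ops by (auto simp: restrict_def)
  let ?L = "fin_vectors S B"
  have Lfin: "finite {b. w b \<noteq> 0}" and LB: "\<And>b. w b \<noteq> 0 \<Longrightarrow> b \<in> B" and LR: "\<And>b. w b \<in> polyR S" if "w \<in> ?L" for w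
    using that unfolding fin_vectors_def by auto
  have LI: "w \<in> ?L" if "finite T" "T \<subseteq> B" "\<And>b. b \<notin> T \<Longrightarrow> w b = 0" "\<And>b. w b \<in> polyR S" for w T
    unfolding fin_vectors_def using that finite_subset[of "{b. w b \<noteq> 0}" T] by auto
  define lc where "lc w = finsum M (\<lambda>b. restrict (w b) S \<odot>\<^bsub>M\<^esub> b) {b. w b \<noteq> 0}" for w
  have summand_closed: "restrict (w b) S \<odot>\<^bsub>M\<^esub> b \<in> carrier M" if "w \<in> ?L" "b \<in> B" for w b
    using rR[OF LR[OF that(1)]] BM[OF that(2)] by blast
  have lc_sup: "lc w = finsum M (\<lambda>b. restrict (w b) S \<odot>\<^bsub>M\<^esub> b) T" if "w \<in> ?L" "finite T" "T \<subseteq> B" "\<And>b. b \<notin> T \<Longrightarrow> w b = 0" for w T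
    unfolding lc_def
  proof (rule finsum_restrict_nonzero[OF D(4) that(2)])
    show "restrict (w b) S \<odot>\<^bsub>M\<^esub> b \<in> carrier M" if "b \<in> T" for b using summand_closed[OF \<open>w \<in> ?L\<close>] \<open>T \<subseteq> B\<close> that by blast
    show "{b. w b \<noteq> 0} \<subseteq> T" using that(4) by blast
    show "restrict (w b) S \<odot>\<^bsub>M\<^esub> b = \<zero>\<^bsub>M\<^esub>" if "b \<in> T - {b. w b \<noteq> 0}" for b
      using that \<open>T \<subseteq> B\<close> BM by (auto simp: r0)
  qed
  have lc_closed: "lc w \<in> carrier M" if "w \<in> ?L" for w
    unfolding lc_def by (rule M.M.finsum_closed) (use summand_closed[OF that] LB[OF that] in blast)
  have L_add: "w + w' \<in> ?L" if "w \<in> ?L" "w' \<in> ?L" for w w'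
    by (rule LI[of "{b. w b \<noteq> 0} \<union> {b. w' b \<noteq> 0}"]) (use that Lfin LB LR P.R_add in auto)
  have L_s: "(\<lambda>b. f * w b) \<in> ?L" if "f \<in> polyR S" "w \<in> ?L" for f w
    by (rule LI[of "{b. w b \<noteq> 0}"]) (use that Lfin LB LR P.R_mult in auto)
  have L_0: "0 \<in> ?L" by (rule LI[of "{}"]) (auto simp: P.R_0)
  have lc_add: "lc (w + w') = lc w \<oplus>\<^bsub>M\<^esub> lc w'" if w: "w \<in> ?L" "w' \<in> ?L" for w w'
  proof -
    let ?T = "{b. w b \<noteq> 0} \<union> {b. w' b \<noteq> 0}"
    have T: "finite ?T" "?T \<subseteq> B" using w Lfin LB by auto
    have "lc (w + w') = finsum M (\<lambda>b. restrict ((w + w') b) S \<odot>\<^bsub>M\<^esub> b) ?T"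
      by (rule lc_sup[OF L_add[OF w] T]) auto
    also have "\<dots> = finsum M (\<lambda>b. restrict (w b) S \<odot>\<^bsub>M\<^esub> b \<oplus>\<^bsub>M\<^esub> restrict (w' b) S \<odot>\<^bsub>M\<^esub> b) ?T"
    proof (rule M.M.finsum_cong')
      show "restrict ((w + w') b) S \<odot>\<^bsub>M\<^esub> b = restrict (w b) S \<odot>\<^bsub>M\<^esub> b \<oplus>\<^bsub>M\<^esub> restrict (w' b) S \<odot>\<^bsub>M\<^esub> b" if "b \<in> ?T" for b
        using M.smult_l_distr[OF rR[OF LR[OF w(1)]] rR[OF LR[OF w(2)]] BM, of b b] that T(2) radd by auto
    qed (use summand_closed w T(2) in auto)
    also have "\<dots> = finsum M (\<lambda>b. restrict (w b) S \<odot>\<^bsub>M\<^esub> b) ?T \<oplus>\<^bsub>M\<^esub> finsum M (\<lambda>b. restrict (w' b) S \<odot>\<^bsub>M\<^esub> b) ?T"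
      by (rule M.M.finsum_addf) (use summand_closed w T(2) in auto)
    also have "\<dots> = lc w \<oplus>\<^bsub>M\<^esub> lc w'"
      using lc_sup[OF w(1) T] lc_sup[OF w(2) T] by simp
    finally show ?thesis .
  qed
  have lc_s: "lc (\<lambda>b. f * w b) = restrict f S \<odot>\<^bsub>M\<^esub> lc w" if f: "f \<in> polyR S" and w: "w \<in> ?L" for f w
  proof -
    let ?T = "{b. w b \<noteq> 0}"
    have T: "finite ?T" "?T \<subseteq> B" using w Lfin LB by auto
    have "lc (\<lambda>b. f * w b) = finsum M (\<lambda>b. restrict (f * w b) S \<odot>\<^bsub>M\<^esub> b) ?T"
      by (rule lc_sup[OF L_s[OF f w] T]) auto
    also have "\<dots> = finsum M (\<lambda>b. restrict f S \<odot>\<^bsub>M\<^esub> (restrict (w b) S \<odot>\<^bsub>M\<^esub> b)) ?T"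
    proof (rule M.M.finsum_cong')
      show "restrict (f * w b) S \<odot>\<^bsub>M\<^esub> b = restrict f S \<odot>\<^bsub>M\<^esub> (restrict (w b) S \<odot>\<^bsub>M\<^esub> b)" if "b \<in> ?T" for b
        using M.smult_assoc1[OF rR[OF f] rR[OF LR[OF w]] BM, of b b] that T(2) rmult by auto
    qed (use summand_closed[OF w] rR[OF f] T(2) in auto)
    also have "\<dots> = restrict f S \<odot>\<^bsub>M\<^esub> lc w"
      unfolding lc_def by (rule M.finsum_smult_ldistr[symmetric, OF T(1) rR[OF f]]) (use summand_closed[OF w] T(2) in auto)
    finally show ?thesis .
  qed
  have lc_inj: "w = w'" if w: "w \<in> ?L" "w' \<in> ?L" and eq: "lc w = lc w'" for w w'
  proof -
    \<comment> \<open>The uniqueness in \<open>graded_free\<close> concerns extensional coefficient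
      functions on the basis, so vectors are first put into that shape.\<close>
    define e where "e w = restrict (\<lambda>b. restrict (w b) S) B" for w :: "'m \<Rightarrow> 'a \<Rightarrow> real"
    have e: "e w \<in> B \<rightarrow>\<^sub>E carrier ?R \<and> finite {b \<in> B. e w b \<noteq> \<zero>\<^bsub>?R\<^esub>} \<and>
        lc w = finsum M (\<lambda>b. e w b \<odot>\<^bsub>M\<^esub> b) {b \<in> B. e w b \<noteq> \<zero>\<^bsub>?R\<^esub>}" if w: "w \<in> ?L" for w
    proof -
      have "{b \<in> B. e w b \<noteq> \<zero>\<^bsub>?R\<^esub>} = {b. w b \<noteq> 0}"
        using LB[OF w] r0_iff[OF LR[OF w]] unfolding e_def by auto
      moreover have "e w \<in> B \<rightarrow>\<^sub>E carrier ?R" unfolding e_def using rR[OF LR[OF w]] by auto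
      moreover have "lc w = finsum M (\<lambda>b. e w b \<odot>\<^bsub>M\<^esub> b) {b. w b \<noteq> 0}"
        unfolding lc_def by (rule M.M.finsum_cong') (use summand_closed[OF w] LB[OF w] in \<open>auto simp: e_def\<close>)
      ultimately show ?thesis using Lfin[OF w] by simp
    qed
    note ex = bspec[OF uniq lc_closed[OF w(1)]]
    have "e w = e w'" by (rule ex1_unique[where P = "\<lambda>c. c \<in> B \<rightarrow>\<^sub>E carrier ?R \<and> finite {b \<in> B. c b \<noteq> \<zero>\<^bsub>?R\<^esub>} \<and>
        lc w = finsum M (\<lambda>b. c b \<odot>\<^bsub>M\<^esub> b) {b \<in> B. c b \<noteq> \<zero>\<^bsub>?R\<^esub>}", OF ex e[OF w(1)] e[OF w(2), folded eq]])
    then have "e w b = e w' b" for b by simp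
    then have "restrict (w b) S = restrict (w' b) S" if "b \<in> B" for b
      using that unfolding e_def by (metis restrict_apply')
    then have "w b = w' b" if "b \<in> B" for b
      using that zext_polyR_id[OF LR[OF w(1)]] zext_polyR_id[OF LR[OF w(2)]] zext_restrict_id by metis
    moreover have "w b = w' b" if "b \<notin> B" for b using that LB[OF w(1)] LB[OF w(2)] by metis
    ultimately show ?thesis by blast
  qed
  have lc_surj: "\<exists>w\<in>?L. lc w = x" if x: "x \<in> carrier M" for x
  proof -
    obtain c where c: "c \<in> B \<rightarrow>\<^sub>E carrier ?R" "finite {b \<in> B. c b \<noteq> \<zero>\<^bsub>?R\<^esub>}" "x = finsum M (\<lambda>b. c b \<odot>\<^bsub>M\<^esub> b) {b \<in> B. c b \<noteq> \<zero>\<^bsub>?R\<^esub>}"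
      using uniq x by blast
    define w where "w b = (if b \<in> B then zext S (c b) else 0)" for b
    have cR: "c b \<in> carrier ?R" if "b \<in> B" for b using c(1) that by blast
    have supp: "{b. w b \<noteq> 0} = {b \<in> B. c b \<noteq> \<zero>\<^bsub>?R\<^esub>}"
      unfolding w_def using zext_eq_0_iff[OF S cR] by auto
    have w: "w \<in> ?L"
    proof (rule LI[OF c(2)])
      show "w b = 0" if "b \<notin> {b \<in> B. c b \<noteq> \<zero>\<^bsub>?R\<^esub>}" for b using that supp by blast
      show "w b \<in> polyR S" for b using cR cring_of_carrier(1)[OF S] P.R_0 unfolding w_def by auto
    qed auto
    have "lc w = x" unfolding lc_def c(3) supp
    proof (rule M.M.finsum_cong')
      fix b assume b: "b \<in> {b \<in> B. c b \<noteq> \<zero>\<^bsub>?R\<^esub>}"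
      then have "c b \<in> extensional S" using cR cring_of_carrier(1)[OF S] by blast
      then show "restrict (w b) S \<odot>\<^bsub>M\<^esub> b = c b \<odot>\<^bsub>M\<^esub> b" using b unfolding w_def by simp
    qed (use cR BM in auto)
    then show ?thesis using w by blast
  qed
  define co where "co x = (THE w. w \<in> ?L \<and> lc w = x)" for x
  have co: "co x \<in> ?L \<and> lc (co x) = x" if x: "x \<in> carrier M" for x
  proof -
    obtain w where w: "w \<in> ?L" "lc w = x" using lc_surj[OF x] by blast
    have "co x = w" unfolding co_def by (rule the_equality) (use w lc_inj in auto)
    then show ?thesis using w by simp
  qed
  have co_lc: "co (lc w) = w" if "w \<in> ?L" for w using co[OF lc_closed[OF that]] lc_inj that by blast
  have lc_G: "lc w \<in> G d" if w: "w \<in> ?L" and h: "\<And>b. w b \<in> polyA S (d - deg b)" for w d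
    unfolding lc_def
  proof (rule finsum_in_subset[OF D(4) _ D(6) D(7) Lfin[OF w]])
    show "G d \<subseteq> carrier M" using D(5) by blast
    fix b assume b: "b \<in> {b. w b \<noteq> 0}"
    then have bB: "b \<in> B" using LB[OF w] by blast
    have nn: "0 \<le> d - deg b" using P.A_neg[OF _ h[of b]] b by force
    then have "restrict (w b) S \<in> chom_of S (nat (d - deg b))"
      using cring_of_carrier(2)[OF S, of "restrict (w b) S" "nat (d - deg b)"] h[of b] zext_polyR_id[OF LR[OF w, of b]] by simp
    from D(9)[OF this deg[OF bB]] show "restrict (w b) S \<odot>\<^bsub>M\<^esub> b \<in> G d" using nn by simp
  qed
  have co_hom: "co x b \<in> polyA S (d - deg b)" if x: "x \<in> G d" for x d b
  proof -
    have xM: "x \<in> carrier M" using D(5)[OF x] .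
    let ?w = "co x" and ?T = "{b. co x b \<noteq> 0}"
    have w: "?w \<in> ?L" "lc ?w = x" using co[OF xM] by auto
    have "\<forall>b. \<exists>h. (\<forall>e. h e \<in> polyA S (int e)) \<and> (\<exists>N. (\<forall>e>N. h e = 0) \<and> ?w b = (\<Sum>e\<le>N. h e))"
    proof
      fix b
      obtain N h where h: "\<forall>e. h e \<in> polyA S (int e)" "?w b = (\<Sum>e\<le>N. h e)" using polyR_decompose[OF LR[OF w(1), of b]] by blast
      show "\<exists>h. (\<forall>e. h e \<in> polyA S (int e)) \<and> (\<exists>N. (\<forall>e>N. h e = 0) \<and> ?w b = (\<Sum>e\<le>N. h e))"
        by (intro exI[of _ "\<lambda>e. if e \<le> N then h e else 0"] exI[of _ N] conjI) (use h P.A_0 in auto)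
    qed
    then obtain h where h: "\<And>b e. h b e \<in> polyA S (int e)" and "\<And>b. \<exists>N. (\<forall>e>N. h b e = 0) \<and> ?w b = (\<Sum>e\<le>N. h b e)" by metis
    then obtain N where N: "\<And>b e. e > N b \<Longrightarrow> h b e = 0" "\<And>b. ?w b = (\<Sum>e\<le>N b. h b e)" by metis
    \<comment> \<open>The part of \<open>co x\<close> of total degree \<open>k\<close>: the
      coefficient of \<open>b\<close> contributes its component of degree
      \<open>k - deg b\<close>.\<close>
    define wk where "wk k b = (if b \<in> ?T \<and> 0 \<le> k - deg b then h b (nat (k - deg b)) else 0)" for k b
    have finT: "finite ?T" and TB: "?T \<subseteq> B" using Lfin[OF w(1)] LB[OF w(1)] by auto
    have wk_hom: "wk k b \<in> polyA S (k - deg b)" for k b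
      unfolding wk_def using h[of b "nat (k - deg b)"] P.A_0 by auto
    have wk_L: "wk k \<in> ?L" for k
    proof (rule LI[OF finT TB])
      show "wk k b = 0" if "b \<notin> ?T" for b unfolding wk_def using that by simp
      show "wk k b \<in> polyR S" for b by (rule P.A_R[OF wk_hom])
    qed
    \<comment> \<open>All total degrees that can occur, together with \<open>d\<close>, so that the
      component in degree \<open>d\<close> can be compared even if it is zero.\<close>
    let ?D = "insert d (\<Union>b\<in>?T. (\<lambda>e. deg b + int e) ` {..N b})"
    have finD: "finite ?D" using finT by auto
    have sum_wk: "?w = (\<Sum>k\<in>?D. wk k)"
    proof
      fix b
      show "?w b = (\<Sum>k\<in>?D. wk k) b"
      proof (cases "b \<in> ?T")
        case False
        then have "\<And>k. wk k b = 0" unfolding wk_def by simp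
        then show ?thesis using False by (simp add: sum_fun_apply)
      next
        case True
        have "(\<Sum>k\<in>?D. wk k b) = (\<Sum>k\<in>(\<lambda>e. deg b + int e) ` {..N b}. wk k b)"
        proof (rule sum.mono_neutral_right[OF finD])
          show "(\<lambda>e. deg b + int e) ` {..N b} \<subseteq> ?D" using True by blast
          show "\<forall>k\<in>?D - (\<lambda>e. deg b + int e) ` {..N b}. wk k b = 0"
          proof
            fix k assume k: "k \<in> ?D - (\<lambda>e. deg b + int e) ` {..N b}"
            have "N b < nat (k - deg b)" if "0 \<le> k - deg b"
            proof (rule ccontr)
              assume "\<not> N b < nat (k - deg b)"
              then have "k \<in> (\<lambda>e. deg b + int e) ` {..N b}" using that by (intro image_eqI[of _ _ "nat (k - deg b)"]) auto
              then show False using k by blast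
            qed
            then show "wk k b = 0" unfolding wk_def using N(1) by simp
          qed
        qed
        also have "\<dots> = (\<Sum>e\<le>N b. wk (deg b + int e) b)"
          by (subst sum.reindex) (auto simp: inj_on_def)
        also have "\<dots> = ?w b" unfolding wk_def N(2)[of b] using True N(2)[of b] by simp
        finally show ?thesis by (simp add: sum_fun_apply)
      qed
    qed
    have lc_sum: "lc (\<Sum>k\<in>D. wk k) = finsum M (\<lambda>k. lc (wk k)) D \<and> (\<Sum>k\<in>D. wk k) \<in> ?L" if "finite D" for D
      using that
    proof (induct D rule: finite_induct)
      case empty
      have "lc 0 = \<zero>\<^bsub>M\<^esub>" unfolding lc_def by simp
      then show ?case unfolding sum.empty M.M.finsum_empty using L_0 by (intro conjI)
    next
      case (insert k D)
      have 1: "(\<Sum>k\<in>insert k D. wk k) = wk k + (\<Sum>k\<in>D. wk k)" by (rule sum.insert[OF insert(1,2)])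
      have 2: "finsum M (\<lambda>k. lc (wk k)) (insert k D) = lc (wk k) \<oplus>\<^bsub>M\<^esub> finsum M (\<lambda>k. lc (wk k)) D"
        by (rule M.M.finsum_insert[OF insert(1,2)]) (use lc_closed[OF wk_L] in auto)
      note IH = insert(3)[THEN conjunct1] insert(3)[THEN conjunct2]
      show ?case unfolding 1 2 using lc_add[OF wk_L IH(2)] L_add[OF wk_L IH(2)] IH(1) by metis
    qed
    have "x = finsum M (\<lambda>k. lc (wk k)) ?D" using lc_sum[OF finD] sum_wk w(2) by metis
    moreover have "x = finsum M (\<lambda>k. if k = d then x else \<zero>\<^bsub>M\<^esub>) ?D"
    proof -
      have "finsum M (\<lambda>k. if k = d then x else \<zero>\<^bsub>M\<^esub>) {d} = finsum M (\<lambda>k. if k = d then x else \<zero>\<^bsub>M\<^esub>) ?D"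
        by (rule finsum_restrict_nonzero[OF D(4) finD]) (use xM in auto)
      then show ?thesis using xM by simp
    qed
    ultimately have eq: "finsum M (\<lambda>k. lc (wk k)) ?D = finsum M (\<lambda>k. if k = d then x else \<zero>\<^bsub>M\<^esub>) ?D" by simp
    have "lc (wk d) = (if d = d then x else \<zero>\<^bsub>M\<^esub>)"
      by (rule graded_unique[OF gm finD _ _ eq]) (use lc_G[OF wk_L wk_hom] x D(6) in auto)
    then have "lc ?w = lc (wk d)" using w(2) by simp
    then have "?w = wk d" by (rule lc_inj[OF w(1) wk_L])
    then show ?thesis using wk_hom by metis
  qed
  have "coordinates S M G B deg co"
  proof
    show "pointed_polyhedral_cone S" "graded_module ?R (chom_of S) M G" by fact+
    show "b \<in> G (deg b)" if "b \<in> B" for b using deg[OF that] .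
    show "co x \<in> ?L" if "x \<in> carrier M" for x using co[OF that] by blast
    show "co (x \<oplus>\<^bsub>M\<^esub> y) = co x + co y" if "x \<in> carrier M" "y \<in> carrier M" for x y
      using co_lc[OF L_add] lc_add co that by metis
    show "co (a \<odot>\<^bsub>M\<^esub> x) = (\<lambda>b. zext S a * co x b)" if a: "a \<in> carrier ?R" and x: "x \<in> carrier M" for a x
    proof -
      have a': "zext S a \<in> polyR S" "restrict (zext S a) S = a" using a cring_of_carrier(1)[OF S] by auto
      have "lc (\<lambda>b. zext S a * co x b) = a \<odot>\<^bsub>M\<^esub> x" using lc_s[OF a'(1), of "co x"] co[OF x] a'(2) by simp
      then show ?thesis using co_lc[OF L_s[OF a'(1), of "co x"]] co[OF x] by simp
    qed
    show "x = y" if "x \<in> carrier M" "y \<in> carrier M" "co x = co y" for x y using co[OF that(1)] co[OF that(2)] that(3) by metis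
    show "\<exists>x\<in>carrier M. co x = w" if "w \<in> ?L" for w using co_lc[OF that] lc_closed[OF that] by blast
    show "x \<in> G d \<longleftrightarrow> (\<forall>b. co x b \<in> polyA S (d - deg b))" if x: "x \<in> carrier M" for x d
      using co_hom lc_G[of "co x" d] co[OF x] by metis
    show "co b = (\<lambda>b'. if b' = b then zext S (\<lambda>_. 1) else 0)" if b: "b \<in> B" for b
    proof -
      let ?e = "\<lambda>b'. if b' = b then zext S (\<lambda>_. 1) else 0"
      have e: "?e \<in> ?L" by (rule LI[of "{b}"]) (use b P.u_R P.R_0 in auto)
      have "lc ?e = finsum M (\<lambda>b'. restrict (?e b') S \<odot>\<^bsub>M\<^esub> b') {b}" by (rule lc_sup[OF e]) (use b in auto)
      also have "\<dots> = restrict (?e b) S \<odot>\<^bsub>M\<^esub> b"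
      proof -
        have "finsum M f {b} = f b" if "f b \<in> carrier M" for f using that by simp
        then show ?thesis using summand_closed[OF e b] .
      qed
      also have "restrict (?e b) S \<odot>\<^bsub>M\<^esub> b = b"
      proof -
        have "restrict (?e b) S = \<one>\<^bsub>?R\<^esub>" unfolding ops by (auto simp: zext_def restrict_def)
        then show ?thesis using BM[OF b] by simp
      qed
      finally have "lc ?e = b" .
      then show ?thesis using co_lc[OF e] by simp
    qed
    show "x = finsum M (\<lambda>b. restrict (co x b) S \<odot>\<^bsub>M\<^esub> b) {b. co x b \<noteq> 0}" if "x \<in> carrier M" for x
      using co[OF that] unfolding lc_def by simp
  qed
  then show ?thesis using that by blast
qed

context coordinates
begin

lemma co_sum:
  assumes "finite T" "\<And>i. i \<in> T \<Longrightarrow> g i \<in> carrier M"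
  shows "co (finsum M g T) = (\<Sum>i\<in>T. co (g i))"
  by (rule finsum_additive[OF graded_moduleD(4)[OF gm] co_add assms])

text \<open>The way back from coordinates: a homogeneous basis of vectors for the image of
  \<open>K\<close> is pulled back along \<open>co\<close>, which is injective on
  \<open>K\<close>.\<close>

lemma graded_free_subrecord:
  assumes K: "K \<subseteq> carrier M" "\<And>a x. a \<in> carrier (cring_of S) \<Longrightarrow> x \<in> K \<Longrightarrow> a \<odot>\<^bsub>M\<^esub> x \<in> K"
    and mon: "abelian_monoid (M\<lparr>carrier := K\<rparr>)"
    and U: "U \<subseteq> co ` K" "\<And>w. w \<in> U \<Longrightarrow> \<exists>d. \<forall>b. w b \<in> polyA S (d - deg b)"
      "\<And>x. x \<in> K \<Longrightarrow> \<exists>T c. finite T \<and> T \<subseteq> U \<and> (\<forall>w\<in>T. c w \<in> polyR S) \<and> co x = (\<Sum>w\<in>T. (\<lambda>b. c w * w b))"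
      "\<And>T c w. finite T \<Longrightarrow> T \<subseteq> U \<Longrightarrow> (\<And>w. w \<in> T \<Longrightarrow> c w \<in> polyR S) \<Longrightarrow> (\<Sum>w\<in>T. (\<lambda>b. c w * w b)) = 0 \<Longrightarrow> w \<in> T \<Longrightarrow> c w = 0"
  shows "graded_free (cring_of S) (M\<lparr>carrier := K\<rparr>) (\<lambda>d. G d \<inter> K)"
proof -
  let ?R = "cring_of S" and ?M = "M\<lparr>carrier := K\<rparr>"
  interpret P: connected_graded_ring "polyR S" "polyA S" "zext S (\<lambda>_. 1)"
    using connected_graded_ring_poly pointed_polyhedral_coneD(4)[OF S] by blast
  define B' where "B' = {x \<in> K. co x \<in> U}"
  have B'K: "B' \<subseteq> K" unfolding B'_def by blast
  have B'M: "b \<in> carrier M" if "b \<in> B'" for b using B'K K(1) that by blast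
  have inj: "inj_on co B'" by (rule inj_onI) (use co_inj B'M in blast)
  have U_im: "\<exists>b\<in>B'. co b = w" if "w \<in> U" for w using U(1) that unfolding B'_def by blast
  have zR: "zext S a \<in> polyR S" if "a \<in> carrier ?R" for a using cring_of_carrier(1)[OF S] that by blast
  have co_comb: "finsum ?M (\<lambda>b. c b \<odot>\<^bsub>M\<^esub> b) Z \<in> carrier M \<and> co (finsum ?M (\<lambda>b. c b \<odot>\<^bsub>M\<^esub> b) Z) = (\<Sum>b\<in>Z. (\<lambda>j. zext S (c b) * co b j))"
    if Z: "finite Z" "Z \<subseteq> B'" and c: "\<And>b. b \<in> Z \<Longrightarrow> c b \<in> carrier ?R" for Z c
  proof -
    have inK: "c b \<odot>\<^bsub>M\<^esub> b \<in> K" if "b \<in> Z" for b using K(2)[OF c[OF that]] Z(2) B'K that by blast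
    then have inM: "c b \<odot>\<^bsub>M\<^esub> b \<in> carrier M" if "b \<in> Z" for b using K(1) that by blast
    have eq: "finsum ?M (\<lambda>b. c b \<odot>\<^bsub>M\<^esub> b) Z = finsum M (\<lambda>b. c b \<odot>\<^bsub>M\<^esub> b) Z"
      by (rule finsum_subrecord[OF graded_moduleD(4)[OF gm] mon]) (use inK K(1) in auto)
    have "co (finsum M (\<lambda>b. c b \<odot>\<^bsub>M\<^esub> b) Z) = (\<Sum>b\<in>Z. co (c b \<odot>\<^bsub>M\<^esub> b))"
      by (rule co_sum[OF Z(1) inM])
    also have "\<dots> = (\<Sum>b\<in>Z. (\<lambda>j. zext S (c b) * co b j))"
      by (rule sum.cong[OF refl co_smult[OF c B'M]]) (use Z(2) in auto)
    finally show ?thesis unfolding eq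
      using abelian_monoid.finsum_closed[OF graded_moduleD(4)[OF gm], of "\<lambda>b. c b \<odot>\<^bsub>M\<^esub> b" Z] inM by blast
  qed
  have zero: "zext S (c b) = 0" if "c b = \<zero>\<^bsub>?R\<^esub>" for c :: "'m \<Rightarrow> 'a \<Rightarrow> real" and b
    using that zext_eq_0_iff[OF S, of "c b"] restrict_in_cring_of[OF S P.R_0] unfolding cring_of_ops[OF S] by (auto simp: zext_def fun_eq_iff)
  let ?E = "\<lambda>x c. c \<in> B' \<rightarrow>\<^sub>E carrier ?R \<and> finite {b \<in> B'. c b \<noteq> \<zero>\<^bsub>?R\<^esub>} \<and>
      x = finsum ?M (\<lambda>b. c b \<odot>\<^bsub>?M\<^esub> b) {b \<in> B'. c b \<noteq> \<zero>\<^bsub>?R\<^esub>}"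
  have ex1: "\<exists>!c. ?E x c" if x: "x \<in> K" for x
  proof -
    have xM: "x \<in> carrier M" using x K(1) by blast
    obtain T c0 where T: "finite T" "T \<subseteq> U" "\<forall>w\<in>T. c0 w \<in> polyR S" "co x = (\<Sum>w\<in>T. (\<lambda>b. c0 w * w b))"
      using U(3)[OF x] by blast
    \<comment> \<open>Basis elements outside the chosen finite set receive the zero of the ring;
      outside the basis the value is \<open>undefined\<close>, as extensionality demands.\<close>
    define c where "c b = (if b \<in> B' then (if co b \<in> T then restrict (c0 (co b)) S else \<zero>\<^bsub>?R\<^esub>) else undefined)" for b
    have r0: "restrict (0 :: 'a \<Rightarrow> real) S = \<zero>\<^bsub>?R\<^esub>" unfolding cring_of_ops[OF S] by (auto simp: restrict_def)
    have "\<zero>\<^bsub>?R\<^esub> \<in> carrier ?R" using restrict_in_cring_of[OF S P.R_0] unfolding r0 .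
    then have cR: "c \<in> B' \<rightarrow>\<^sub>E carrier ?R"
      unfolding c_def using restrict_in_cring_of[OF S] T(3) by auto
    let ?T' = "{b \<in> B'. co b \<in> T}" and ?Z = "{b \<in> B'. c b \<noteq> \<zero>\<^bsub>?R\<^esub>}"
    have "?T' = co -` T \<inter> B'" by blast
    then have finT': "finite ?T'" using finite_vimage_IntI[OF T(1) inj] by simp
    have ZT': "?Z \<subseteq> ?T'" unfolding c_def by auto
    have finZ: "finite ?Z" using finite_subset[OF ZT' finT'] .
    have img: "co ` ?T' = T" using U_im T(2) by blast
    have "(\<Sum>b\<in>?Z. (\<lambda>j. zext S (c b) * co b j)) = (\<Sum>b\<in>?T'. (\<lambda>j. zext S (c b) * co b j))"
      by (rule sum.mono_neutral_left[OF finT' ZT']) (use zero in \<open>auto simp: fun_eq_iff\<close>)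
    also have "\<dots> = (\<Sum>b\<in>?T'. (\<lambda>j. c0 (co b) * co b j))"
    proof (rule sum.cong[OF refl])
      fix b assume b: "b \<in> ?T'"
      then have "zext S (c b) = c0 (co b)" unfolding c_def using zext_polyR_id T(3) by auto
      then show "(\<lambda>j. zext S (c b) * co b j) = (\<lambda>j. c0 (co b) * co b j)" by simp
    qed
    also have "\<dots> = (\<Sum>w\<in>co ` ?T'. (\<lambda>j. c0 w * w j))"
      by (subst sum.reindex) (use inj in \<open>auto simp: inj_on_def\<close>)
    also have "\<dots> = co x" unfolding img T(4) ..
    finally have cx: "(\<Sum>b\<in>?Z. (\<lambda>j. zext S (c b) * co b j)) = co x" .
    have cZ: "c b \<in> carrier ?R" if "b \<in> ?Z" for b using cR that by blast
    have comb: "finsum ?M (\<lambda>b. c b \<odot>\<^bsub>M\<^esub> b) ?Z \<in> carrier M" "co (finsum ?M (\<lambda>b. c b \<odot>\<^bsub>M\<^esub> b) ?Z) = co x"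
      using co_comb[OF finZ _ cZ] cx by auto
    have Ec: "?E x c" using cR finZ co_inj[OF comb(1) xM comb(2)] by simp
    show ?thesis
    proof (rule ex1I[of _ c])
      show "?E x c" by (rule Ec)
      fix c' assume E': "?E x c'"
      let ?Z' = "{b \<in> B'. c' b \<noteq> \<zero>\<^bsub>?R\<^esub>}"
      let ?W = "?Z \<union> ?Z'"
      have finZ': "finite ?Z'" using E' by blast
      have finW: "finite ?W" using finZ finZ' by blast
      have c'R: "c' b \<in> carrier ?R" if "b \<in> B'" for b using E' that by blast
      have cR': "c b \<in> carrier ?R" if "b \<in> B'" for b using cR that by blast
      have x': "x = finsum ?M (\<lambda>b. c' b \<odot>\<^bsub>M\<^esub> b) ?Z'" using E' by simp
      have "co x = (\<Sum>b\<in>?Z'. (\<lambda>j. zext S (c' b) * co b j))"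
        unfolding x' using co_comb[OF finZ', of c'] c'R by blast
      also have "\<dots> = (\<Sum>b\<in>?W. (\<lambda>j. zext S (c' b) * co b j))"
        by (rule sum.mono_neutral_left[OF finW]) (use zero in \<open>auto simp: fun_eq_iff\<close>)
      finally have s1: "co x = (\<Sum>b\<in>?W. (\<lambda>j. zext S (c' b) * co b j))" .
      have s2: "co x = (\<Sum>b\<in>?W. (\<lambda>j. zext S (c b) * co b j))"
        unfolding cx[symmetric] by (rule sum.mono_neutral_left[OF finW]) (use zero in \<open>auto simp: fun_eq_iff\<close>)
      \<comment> \<open>Independence of \<open>U\<close> is a statement about vectors, so the
        difference of the two coefficient functions is re-indexed along \<open>co\<close> before it
        is applied.\<close>
      define iv where "iv = the_inv_into B' co"
      have iv: "iv (co b) = b" if "b \<in> B'" for b unfolding iv_def using the_inv_into_f_f[OF inj that] .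
      let ?d = "\<lambda>w. zext S (c' (iv w)) - zext S (c (iv w))"
      have "(\<Sum>w\<in>co ` ?W. (\<lambda>j. ?d w * w j)) = (\<Sum>b\<in>?W. (\<lambda>j. (zext S (c' b) - zext S (c b)) * co b j))"
        by (subst sum.reindex) (use inj iv in \<open>auto simp: inj_on_def intro!: sum.cong\<close>)
      also have "\<dots> = (\<Sum>b\<in>?W. (\<lambda>j. zext S (c' b) * co b j)) - (\<Sum>b\<in>?W. (\<lambda>j. zext S (c b) * co b j))"
        unfolding sum_subtractf[symmetric] by (rule sum.cong) (auto simp: fun_eq_iff algebra_simps)
      also have "\<dots> = 0" using s1 s2 by simp
      finally have z: "(\<Sum>w\<in>co ` ?W. (\<lambda>j. ?d w * w j)) = 0" .
      have WU: "co ` ?W \<subseteq> U" unfolding B'_def by blast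
      have dR: "?d w \<in> polyR S" if "w \<in> co ` ?W" for w
        using that iv zR[OF c'R] zR[OF cR'] P.R_diff by auto
      have "zext S (c' b) = zext S (c b)" if b: "b \<in> ?W" for b
      proof -
        have "?d (co b) = 0" by (rule U(4)[OF finite_imageI[OF finW] WU dR z]) (use b in auto)
        then show ?thesis using iv b by auto
      qed
      then have eqW: "c' b = c b" if "b \<in> ?W" for b
        using that restrict_zext_id cring_of_carrier(1)[OF S] c'R cR' by (metis (no_types, lifting) UnE mem_Collect_eq)
      have eqB: "c' b = c b" if bB: "b \<in> B'" for b
      proof (cases "b \<in> ?W")
        case True
        then show ?thesis by (rule eqW)
      next
        case False
        then have "c b = \<zero>\<^bsub>?R\<^esub>" "c' b = \<zero>\<^bsub>?R\<^esub>" using bB by auto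
        then show ?thesis by simp
      qed
      show "c' = c"
        by (rule PiE_ext[of _ B' "\<lambda>_. carrier ?R"]) (use E' cR eqB in auto)
    qed
  qed
  have "B' \<subseteq> (\<Union>d. G d \<inter> K)"
  proof
    fix b assume b: "b \<in> B'"
    then obtain d where "\<forall>j. co b j \<in> polyA S (d - deg j)" using U(2) unfolding B'_def by blast
    then have "b \<in> G d" using co_G[OF B'M[OF b]] by blast
    then show "b \<in> (\<Union>d. G d \<inter> K)" using b B'K by blast
  qed
  then show ?thesis unfolding graded_free_def using ex1 by (intro exI[of _ B']) simp
qed

end

text \<open>Lifting zero to zero keeps a lifted matrix finitely supported in each row.\<close>

lemma polyA_lift:
  assumes "T \<subseteq> S" "f \<in> polyA T d"
  shows "\<exists>g\<in>polyA S d. zext T g = f \<and> (f = 0 \<longrightarrow> g = 0)"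
proof (cases "f = 0")
  case True
  then show ?thesis using polyA_zero by (intro bexI[of _ 0]) (auto simp: zext_def fun_eq_iff)
next
  case False
  from assms(2) show ?thesis
  proof (cases rule: polyAE)
    case 1
    then show ?thesis using False zext_ops(4)[of T] by simp
  next
    case (2 p)
    then show ?thesis using polyA_mono_deg[OF 2(1,2), of S] False zext_restrict[OF assms(1)] by metis
  qed
qed

lemma module_record_eq: "M\<lparr>carrier := K, smult := \<lambda>a x. a \<odot>\<^bsub>M\<^esub> x\<rparr> = M\<lparr>carrier := K\<rparr>"
  by (cases M) simp

section \<open>Free kernels of surjections onto modules over a facet\<close>

context cone_normals
begin

text \<open>Once bases are chosen on both sides, lifting the matrix of \<open>p\<close> from the
  facet to \<open>S\<close> gives \<open>C\<close>, and homogeneous preimages of the basis of the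
  target give \<open>D\<close>. The kernel then has the coordinate description treated in
  \<open>kernel_free_coordinates\<close>.\<close>

lemma facet_kernel_free:
  fixes M M' :: "('a \<Rightarrow> real, 'm) module"
  assumes n: "n \<in> N" and \<rho>: "\<rho> = S \<inter> {x. n \<bullet> x = 0}"
    and gm: "graded_module (cring_of S) (chom_of S) M G" and free: "graded_free (cring_of S) M G"
    and gm': "graded_module (cring_of \<rho>) (chom_of \<rho>) M' G'" and free': "graded_free (cring_of \<rho>) M' G'"
    and p: "\<And>x. x \<in> carrier M \<Longrightarrow> p x \<in> carrier M'" "\<And>x d. x \<in> G d \<Longrightarrow> p x \<in> G' d"
      "\<And>x y. x \<in> carrier M \<Longrightarrow> y \<in> carrier M \<Longrightarrow> p (x \<oplus>\<^bsub>M\<^esub> y) = p x \<oplus>\<^bsub>M'\<^esub> p y"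
      "\<And>a x. a \<in> carrier (cring_of S) \<Longrightarrow> x \<in> carrier M \<Longrightarrow> p (a \<odot>\<^bsub>M\<^esub> x) = restrict a \<rho> \<odot>\<^bsub>M'\<^esub> p x"
      "\<And>y. y \<in> carrier M' \<Longrightarrow> \<exists>x\<in>carrier M. p x = y"
    and K: "K = {x \<in> carrier M. p x = \<zero>\<^bsub>M'\<^esub>}"
  shows "graded_module (cring_of S) (chom_of S) (M\<lparr>carrier := K\<rparr>) (\<lambda>d. G d \<inter> K)"
    and "graded_free (cring_of S) (M\<lparr>carrier := K\<rparr>) (\<lambda>d. G d \<inter> K)"
proof -
  have \<rho>F: "\<rho> \<in> cone_faces S" and \<rho>S: "\<rho> \<subseteq> S" using facet_mem[OF n] unfolding \<rho> by auto
  have ppc\<rho>: "pointed_polyhedral_cone \<rho>" using pointed_polyhedral_cone_face[OF ppc \<rho>F] .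
  note D = graded_moduleD[OF gm] and D' = graded_moduleD[OF gm']
  interpret M: Module.module "cring_of S" M by (rule D)
  interpret M': Module.module "cring_of \<rho>" M' by (rule D')
  have restr: "restrict a \<rho> \<in> carrier (cring_of \<rho>)" if "a \<in> carrier (cring_of S)" for a
  proof -
    have "zext S a \<in> polyR S" using that cring_of_carrier(1)[OF ppc] by blast
    then obtain q where q: "real_polynomial_function q" "zext S a = zext S q" by (rule polyRE)
    have "zext \<rho> (restrict a \<rho>) = zext \<rho> (zext S a)" unfolding zext_restrict[OF \<rho>S] by simp
    also have "\<dots> = zext \<rho> q" unfolding q(2) zext_restrict[OF \<rho>S] ..
    finally show ?thesis using cring_of_carrier(1)[OF ppc\<rho>] zext_polyR[OF q(1), of \<rho>] by simp
  qed
  have p0: "p \<zero>\<^bsub>M\<^esub> = \<zero>\<^bsub>M'\<^esub>"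
    using p(4)[of "\<zero>\<^bsub>cring_of S\<^esub>" "\<zero>\<^bsub>M\<^esub>"] p(3)[of "\<zero>\<^bsub>M\<^esub>" "\<zero>\<^bsub>M\<^esub>"] p(1)[of "\<zero>\<^bsub>M\<^esub>"] M'.M.add.l_cancel_one by simp
  have Kp: "x \<in> K \<longleftrightarrow> x \<in> carrier M \<and> p x = \<zero>\<^bsub>M'\<^esub>" for x unfolding K by blast
  have KM: "K \<subseteq> carrier M" unfolding K by blast
  have Ks: "a \<odot>\<^bsub>M\<^esub> x \<in> K" if "a \<in> carrier (cring_of S)" "x \<in> K" for a x
    using that p(4) restr unfolding Kp by simp
  have homR: "a \<in> carrier (cring_of S)" if "a \<in> chom_of S i" for a i
  proof -
    interpret P: connected_graded_ring "polyR S" "polyA S" "zext S (\<lambda>_. 1)"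
      using connected_graded_ring_poly S_props(4) by blast
    show ?thesis using that P.A_R cring_of_carrier[OF ppc] by blast
  qed
  have "graded_module (cring_of S) (chom_of S) (M\<lparr>carrier := K, smult := \<lambda>a x. a \<odot>\<^bsub>M\<^esub> x\<rparr>) (\<lambda>d. G d \<inter> K)"
  proof (rule graded_submodule[OF gm D(2)])
    show "\<zero>\<^bsub>M\<^esub> \<in> K" "\<And>x y. x \<in> K \<Longrightarrow> y \<in> K \<Longrightarrow> x \<oplus>\<^bsub>M\<^esub> y \<in> K" using p0 p(3) unfolding Kp by simp_all
    show "\<And>a x i. a \<in> chom_of S i \<Longrightarrow> x \<in> K \<Longrightarrow> a \<odot>\<^bsub>M\<^esub> x \<in> K" using Ks homR by blast
    fix T and c :: "int \<Rightarrow> 'm" and d assume T: "finite T" "\<And>d. c d \<in> G d" "finsum M c T \<in> K" "d \<in> T"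
    have "p (c d) = \<zero>\<^bsub>M'\<^esub>"
      by (rule graded_kernel_component[OF gm gm' p(1-3) T(1,2) _ T(4)]) (use T(3) Kp in blast)+
    then show "c d \<in> K" using D(5)[OF T(2)] unfolding Kp by blast
  qed (use KM Ks in auto)
  then show gmK: "graded_module (cring_of S) (chom_of S) (M\<lparr>carrier := K\<rparr>) (\<lambda>d. G d \<inter> K)"
    unfolding module_record_eq .
  obtain B deg co where "coordinates S M G B deg co" using obtain_coordinates[OF ppc gm free] by blast
  then interpret c: coordinates S M G B deg co .
  obtain Y dY co' where "coordinates \<rho> M' G' Y dY co'" using obtain_coordinates[OF ppc\<rho> gm' free'] by blast
  then interpret c': coordinates \<rho> M' G' Y dY co' .
  have BM: "b \<in> carrier M" if "b \<in> B" for b using D(5)[OF c.B_deg[OF that]] .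
  have YM: "y \<in> carrier M'" if "y \<in> Y" for y using D'(5)[OF c'.B_deg[OF that]] .
  have "\<exists>g. g \<in> polyA S (deg b - dY y) \<and> zext \<rho> g = co' (p b) y \<and> (co' (p b) y = 0 \<longrightarrow> g = 0)" if b: "b \<in> B" for b y
  proof -
    have "p b \<in> G' (deg b)" using p(2) c.B_deg[OF b] by blast
    then have "co' (p b) y \<in> polyA \<rho> (deg b - dY y)" using c'.co_G[OF p(1)[OF BM[OF b]]] by blast
    then show ?thesis using polyA_lift[OF \<rho>S] by blast
  qed
  then obtain C where C: "\<And>b y. b \<in> B \<Longrightarrow> C b y \<in> polyA S (deg b - dY y)"
    "\<And>b y. b \<in> B \<Longrightarrow> zext \<rho> (C b y) = co' (p b) y" "\<And>b y. b \<in> B \<Longrightarrow> co' (p b) y = 0 \<Longrightarrow> C b y = 0" by metis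
  have "\<exists>m. m \<in> G (dY y) \<and> p m = y" if y: "y \<in> Y" for y
  proof -
    obtain x where x: "x \<in> carrier M" "p x = y" using p(5)[OF YM[OF y]] by blast
    then show ?thesis using graded_lift[OF gm gm' p(1-3) x(1), of "dY y"] c'.B_deg[OF y] by auto
  qed
  then obtain m where m: "\<And>y. y \<in> Y \<Longrightarrow> m y \<in> G (dY y)" "\<And>y. y \<in> Y \<Longrightarrow> p (m y) = y" by metis
  have mM: "m y \<in> carrier M" if "y \<in> Y" for y using D(5)[OF m(1)[OF that]] .
  let ?L = "fin_vectors S B"
  define g where "g y w = (\<Sum>b\<in>{b. w b \<noteq> 0}. w b * C b y)" for y w
  \<comment> \<open>The lifted matrix computes \<open>p\<close> after restriction to the facet. So
    membership in the kernel becomes vanishing of all \<open>g y\<close> on the facet.\<close>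
  have g_co: "zext \<rho> (g y (co x)) = co' (p x) y" if x: "x \<in> carrier M" for x y
  proof -
    let ?T = "{b. co x b \<noteq> 0}"
    have T: "finite ?T" "\<And>b. b \<in> ?T \<Longrightarrow> b \<in> B" "\<And>b. co x b \<in> polyR S" using c.co_in[OF x] unfolding fin_vectors_def by auto
    have rin: "restrict (co x b) S \<in> carrier (cring_of S)" for b using restrict_in_cring_of[OF ppc T(3)] .
    have "co' (p x) y = co' (p (finsum M (\<lambda>b. restrict (co x b) S \<odot>\<^bsub>M\<^esub> b) ?T)) y"
      using c.co_expand[OF x] by simp
    also have "\<dots> = (\<Sum>b\<in>?T. co' (p (restrict (co x b) S \<odot>\<^bsub>M\<^esub> b)) y)"
    proof (rule finsum_additive[OF D(4) _ T(1), where f = "\<lambda>z. co' (p z) y"])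
      show "co' (p (z \<oplus>\<^bsub>M\<^esub> z')) y = co' (p z) y + co' (p z') y" if "z \<in> carrier M" "z' \<in> carrier M" for z z'
        using p(3)[OF that] c'.co_add[OF p(1)[OF that(1)] p(1)[OF that(2)]] by simp
      show "restrict (co x b) S \<odot>\<^bsub>M\<^esub> b \<in> carrier M" if "b \<in> ?T" for b
        using M.smult_closed[OF rin BM[OF T(2)[OF that]]] .
    qed
    also have "\<dots> = (\<Sum>b\<in>?T. zext \<rho> (co x b * C b y))"
    proof (rule sum.cong[OF refl])
      fix b assume "b \<in> ?T"
      then have b: "b \<in> B" using T(2) by blast
      have "restrict (restrict (co x b) S) \<rho> \<in> carrier (cring_of \<rho>)" using restr[OF rin] .
      from c'.co_smult[OF this p(1)[OF BM[OF b]]]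
      have "co' (p (restrict (co x b) S \<odot>\<^bsub>M\<^esub> b)) y = zext \<rho> (restrict (restrict (co x b) S) \<rho>) * zext \<rho> (C b y)"
        unfolding p(4)[OF rin BM[OF b]] C(2)[OF b] by simp
      also have "\<dots> = zext \<rho> (co x b * C b y)" using \<rho>S by (auto simp: zext_def fun_eq_iff)
      finally show "co' (p (restrict (co x b) S \<odot>\<^bsub>M\<^esub> b)) y = zext \<rho> (co x b * C b y)" .
    qed
    also have "\<dots> = zext \<rho> (g y (co x))"
      unfolding g_def zext_def by (auto simp: fun_eq_iff sum_fun_apply)
    finally show ?thesis by simp
  qed
  let ?K = "{w\<in>?L. \<forall>y\<in>Y. \<forall>x\<in>S. n \<bullet> x = 0 \<longrightarrow> g y w x = 0}"
  have zext0: "zext \<rho> f = 0 \<longleftrightarrow> (\<forall>x\<in>S. n \<bullet> x = 0 \<longrightarrow> f x = 0)" for f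
    unfolding zext_def \<rho> by (auto simp: fun_eq_iff)
  have co'0: "co' z = 0 \<longleftrightarrow> z = \<zero>\<^bsub>M'\<^esub>" if "z \<in> carrier M'" for z
  proof -
    have "co' \<zero>\<^bsub>M'\<^esub> = 0" using c'.co_add[of "\<zero>\<^bsub>M'\<^esub>" "\<zero>\<^bsub>M'\<^esub>"] by simp
    then show ?thesis using c'.co_inj[OF that, of "\<zero>\<^bsub>M'\<^esub>"] by auto
  qed
  have co_K: "co x \<in> ?K \<longleftrightarrow> x \<in> K" if x: "x \<in> carrier M" for x
  proof -
    have "co x \<in> ?K \<longleftrightarrow> (\<forall>y\<in>Y. zext \<rho> (g y (co x)) = 0)" unfolding zext0 using c.co_in[OF x] by simp
    also have "\<dots> \<longleftrightarrow> (\<forall>y\<in>Y. co' (p x) y = 0)" unfolding g_co[OF x] ..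
    also have "\<dots> \<longleftrightarrow> co' (p x) = 0"
    proof
      assume z: "\<forall>y\<in>Y. co' (p x) y = 0"
      have "co' (p x) y = 0" for y using z c'.co_in[OF p(1)[OF x]] unfolding fin_vectors_def by blast
      then show "co' (p x) = 0" by (intro ext) simp
    qed simp
    also have "\<dots> \<longleftrightarrow> x \<in> K" using co'0[OF p(1)[OF x]] Kp x by blast
    finally show ?thesis .
  qed
  have im: "?K \<subseteq> co ` K"
  proof
    fix w assume w: "w \<in> ?K"
    then obtain x where x: "x \<in> carrier M" "co x = w" using c.co_surj[of w] by blast
    then show "w \<in> co ` K" using co_K[OF x(1)] w by blast
  qed
  have "\<exists>U\<subseteq>?K. (\<forall>w\<in>U. \<exists>\<delta>. \<forall>b. w b \<in> polyA S (\<delta> - deg b)) \<and>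
     (\<forall>p\<in>?K. \<exists>T c. finite T \<and> T \<subseteq> U \<and> (\<forall>w\<in>T. c w \<in> polyR S) \<and> p = (\<Sum>w\<in>T. (\<lambda>b. c w * w b))) \<and>
     (\<forall>T c. finite T \<longrightarrow> T \<subseteq> U \<longrightarrow> (\<forall>w\<in>T. c w \<in> polyR S) \<longrightarrow> (\<Sum>w\<in>T. (\<lambda>b. c w * w b)) = 0 \<longrightarrow> (\<forall>w\<in>T. c w = 0))"
  proof (rule kernel_free_coordinates[where B = B and Y = Y and C = C and D = "\<lambda>y. co (m y)" and dY = dY and g = g, OF n])
    show "?L = {w. finite {b. w b \<noteq> 0} \<and> (\<forall>b. w b \<noteq> 0 \<longrightarrow> b \<in> B) \<and> (\<forall>b. w b \<in> polyR S)}" unfolding fin_vectors_def ..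
    show "C b y \<in> polyA S (deg b - dY y)" if "b \<in> B" "y \<in> Y" for b y using C(1)[OF that(1)] .
    show "finite {y \<in> Y. C b y \<noteq> 0}" if b: "b \<in> B" for b
    proof (rule finite_subset)
      show "{y \<in> Y. C b y \<noteq> 0} \<subseteq> {y. co' (p b) y \<noteq> 0}" using C(3)[OF b] by blast
      show "finite {y. co' (p b) y \<noteq> 0}" using c'.co_in[OF p(1)[OF BM[OF b]]] unfolding fin_vectors_def by blast
    qed
    show "co (m y) \<in> ?L" if "y \<in> Y" for y using c.co_in[OF mM[OF that]] .
    show "co (m y) b \<in> polyA S (dY y - deg b)" if "y \<in> Y" for y b using c.co_G[OF mM[OF that]] m(1)[OF that] by blast
    show "g = (\<lambda>y w. \<Sum>b\<in>{b. w b \<noteq> 0}. w b * C b y)" unfolding g_def ..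
    show "g y' (co (m y)) x = (if y' = y then 1 else 0)" if "y \<in> Y" "y' \<in> Y" "x \<in> S" "n \<bullet> x = 0" for y y' x
    proof -
      have x\<rho>: "x \<in> \<rho>" using that unfolding \<rho> by blast
      have "zext \<rho> (g y' (co (m y))) x = co' y y' x" using g_co[OF mM[OF that(1)], of y'] m(2)[OF that(1)] by simp
      then show ?thesis using x\<rho> c'.co_B[OF that(1)] by (simp add: zext_def)
    qed
    show "?K = {w \<in> ?L. \<forall>y\<in>Y. \<forall>x\<in>S. n \<bullet> x = 0 \<longrightarrow> g y w x = 0}" ..
  qed
  then obtain U where U: "U \<subseteq> ?K" "\<forall>w\<in>U. \<exists>\<delta>. \<forall>b. w b \<in> polyA S (\<delta> - deg b)"
     "\<forall>p\<in>?K. \<exists>T c. finite T \<and> T \<subseteq> U \<and> (\<forall>w\<in>T. c w \<in> polyR S) \<and> p = (\<Sum>w\<in>T. (\<lambda>b. c w * w b))"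
     "\<forall>T c. finite T \<longrightarrow> T \<subseteq> U \<longrightarrow> (\<forall>w\<in>T. c w \<in> polyR S) \<longrightarrow> (\<Sum>w\<in>T. (\<lambda>b. c w * w b)) = 0 \<longrightarrow> (\<forall>w\<in>T. c w = 0)"
    by (elim exE conjE)
  show "graded_free (cring_of S) (M\<lparr>carrier := K\<rparr>) (\<lambda>d. G d \<inter> K)"
  proof (rule c.graded_free_subrecord[OF KM Ks graded_moduleD(4)[OF gmK]])
    show "U \<subseteq> co ` K" using U(1) im by (rule subset_trans)
    show "\<exists>d. \<forall>b. w b \<in> polyA S (d - deg b)" if "w \<in> U" for w using U(2) that by (rule bspec)
    show "\<exists>T c. finite T \<and> T \<subseteq> U \<and> (\<forall>w\<in>T. c w \<in> polyR S) \<and> co x = (\<Sum>w\<in>T. (\<lambda>b. c w * w b))" if "x \<in> K" for x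
    proof -
      have "co x \<in> ?K" using co_K that KM by blast
      with U(3) show ?thesis by (rule bspec)
    qed
    show "c w = 0" if "finite T" "T \<subseteq> U" "\<And>w. w \<in> T \<Longrightarrow> c w \<in> polyR S" "(\<Sum>w\<in>T. (\<lambda>b. c w * w b)) = 0" "w \<in> T" for T c w
      using U(4)[rule_format, OF that(1,2) _ that(4,5)] that(3) by blast
  qed
qed

end

section \<open>Pure sheaves on the faces of a cone\<close>

lemma subfan_mono: "subfan \<Sigma> \<Delta>' \<Longrightarrow> \<Delta>' \<subseteq> \<Delta> \<Longrightarrow> subfan \<Sigma> \<Delta>"
  unfolding subfan_def by blast

lemma conewise_module_sub:
  assumes "conewise_module \<Delta> F" "\<Delta>' \<subseteq> \<Delta>"
  shows "conewise_module \<Delta>' F"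
proof -
  note sub = subfan_mono[OF _ assms(2)]
  note F = assms(1)[unfolded conewise_module_def]
  note F1 = F[THEN conjunct1] and F2 = F[THEN conjunct2, THEN conjunct1]
    and F3 = F[THEN conjunct2, THEN conjunct2, THEN conjunct1]
    and F4 = F[THEN conjunct2, THEN conjunct2, THEN conjunct2, THEN conjunct1]
    and F5 = F[THEN conjunct2, THEN conjunct2, THEN conjunct2, THEN conjunct2]
  show ?thesis
    unfolding conewise_module_def
    apply (intro conjI)
        apply (use F1 sub in blast)
       apply (intro allI impI)
       apply (elim conjE)
       apply (rule F2[rule_format])
       apply (use sub in blast)
      apply (use F3 sub in blast)
     apply (intro allI impI)
     apply (elim conjE)
     apply (rule F4[THEN spec, THEN spec, THEN spec, THEN mp])
     apply (use sub in blast)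
    apply (intro allI impI)
    apply (elim conjE)
    apply (rule F5[THEN spec, THEN spec, THEN mp])
    apply (use sub in blast)
    done
qed

locale pure_sheaf =
  fixes S :: "'a::euclidean_space set" and F :: "('a, 'm) fan_sheaf"
  assumes ppc: "pointed_polyhedral_cone S" and pure: "pure_module (cone_faces S) F"
begin

abbreviation "dc \<equiv> down_closed S"
abbreviation "\<Delta> \<equiv> cone_faces S"

lemma conewise_F: "conewise_module \<Delta> F" and locally_free_F: "locally_free \<Delta> F" and flabby_F: "flabby \<Delta> F"
  using pure unfolding pure_module_def by auto

lemma subfan_iff: "subfan \<Sigma> \<Delta> \<longleftrightarrow> dc \<Sigma>"
  using subfan_cone_faces[OF ppc] .

lemma dc_sub: "dc \<Sigma> \<Longrightarrow> \<Sigma> \<subseteq> \<Delta>"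
  unfolding down_closed_def by blast
lemma dc_down: "dc \<Sigma> \<Longrightarrow> \<tau> \<in> \<Sigma> \<Longrightarrow> \<rho> \<in> \<Delta> \<Longrightarrow> \<rho> \<subseteq> \<tau> \<Longrightarrow> \<rho> \<in> \<Sigma>"
  unfolding down_closed_def by blast
lemma dc_Int: "dc \<Sigma> \<Longrightarrow> dc \<Sigma>' \<Longrightarrow> dc (\<Sigma> \<inter> \<Sigma>')"
  unfolding down_closed_def by blast
lemma dc_Un: "dc \<Sigma> \<Longrightarrow> dc \<Sigma>' \<Longrightarrow> dc (\<Sigma> \<union> \<Sigma>')"
  unfolding down_closed_def by blast
lemma dc_empty: "dc {}"
  unfolding down_closed_def by blast
lemma dc_all: "dc \<Delta>"
  unfolding down_closed_def by blast
lemma dc_UN: "(\<And>i. i \<in> I \<Longrightarrow> dc (C i)) \<Longrightarrow> dc (\<Union>i\<in>I. C i)"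
  unfolding down_closed_def by blast
lemma dc_face: "\<tau> \<in> \<Delta> \<Longrightarrow> dc (cone_faces \<tau>)"
  using cone_faces_face[of \<tau> S] unfolding down_closed_def by blast

lemma graded_sections: "dc \<Sigma> \<Longrightarrow> graded_module (conewise_ring \<Sigma>) (conewise_homogeneous \<Sigma>) (sections F \<Sigma>) (degree_part F \<Sigma>)"
  using conewise_F[unfolded conewise_module_def, THEN conjunct1] subfan_iff by blast

lemma res_all:
  assumes "dc \<Sigma>" "dc \<Sigma>'" "\<Sigma>' \<subseteq> \<Sigma>"
  shows "s \<in> carrier (sections F \<Sigma>) \<Longrightarrow> res F \<Sigma> \<Sigma>' s \<in> carrier (sections F \<Sigma>')"
    "s \<in> carrier (sections F \<Sigma>) \<Longrightarrow> t \<in> carrier (sections F \<Sigma>) \<Longrightarrow>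
       res F \<Sigma> \<Sigma>' (s \<oplus>\<^bsub>sections F \<Sigma>\<^esub> t) = res F \<Sigma> \<Sigma>' s \<oplus>\<^bsub>sections F \<Sigma>'\<^esub> res F \<Sigma> \<Sigma>' t"
    "a \<in> carrier (conewise_ring \<Sigma>) \<Longrightarrow> s \<in> carrier (sections F \<Sigma>) \<Longrightarrow>
       res F \<Sigma> \<Sigma>' (a \<odot>\<^bsub>sections F \<Sigma>\<^esub> s) = restrict a (\<Union>\<Sigma>') \<odot>\<^bsub>sections F \<Sigma>'\<^esub> res F \<Sigma> \<Sigma>' s"
    "s \<in> degree_part F \<Sigma> d \<Longrightarrow> res F \<Sigma> \<Sigma>' s \<in> degree_part F \<Sigma>' d"
proof -
  have "subfan \<Sigma> \<Delta> \<and> subfan \<Sigma>' \<Delta> \<and> \<Sigma>' \<subseteq> \<Sigma>" using assms subfan_iff by blast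
  from conewise_F[unfolded conewise_module_def, THEN conjunct2, THEN conjunct1, rule_format, OF this]
  have *: "res F \<Sigma> \<Sigma>' \<in> carrier (sections F \<Sigma>) \<rightarrow> carrier (sections F \<Sigma>')"
    "\<forall>s\<in>carrier (sections F \<Sigma>). \<forall>t\<in>carrier (sections F \<Sigma>).
           res F \<Sigma> \<Sigma>' (s \<oplus>\<^bsub>sections F \<Sigma>\<^esub> t) =
             res F \<Sigma> \<Sigma>' s \<oplus>\<^bsub>sections F \<Sigma>'\<^esub> res F \<Sigma> \<Sigma>' t"
    "\<forall>a\<in>carrier (conewise_ring \<Sigma>). \<forall>s\<in>carrier (sections F \<Sigma>).
           res F \<Sigma> \<Sigma>' (a \<odot>\<^bsub>sections F \<Sigma>\<^esub> s) =
             restrict a (\<Union>\<Sigma>') \<odot>\<^bsub>sections F \<Sigma>'\<^esub> res F \<Sigma> \<Sigma>' s"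
    "\<forall>d. res F \<Sigma> \<Sigma>' ` degree_part F \<Sigma> d \<subseteq> degree_part F \<Sigma>' d" by simp_all
  show "s \<in> carrier (sections F \<Sigma>) \<Longrightarrow> res F \<Sigma> \<Sigma>' s \<in> carrier (sections F \<Sigma>')" using *(1) by blast
  show "s \<in> carrier (sections F \<Sigma>) \<Longrightarrow> t \<in> carrier (sections F \<Sigma>) \<Longrightarrow>
       res F \<Sigma> \<Sigma>' (s \<oplus>\<^bsub>sections F \<Sigma>\<^esub> t) = res F \<Sigma> \<Sigma>' s \<oplus>\<^bsub>sections F \<Sigma>'\<^esub> res F \<Sigma> \<Sigma>' t" using *(2) by blast
  show "a \<in> carrier (conewise_ring \<Sigma>) \<Longrightarrow> s \<in> carrier (sections F \<Sigma>) \<Longrightarrow>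
       res F \<Sigma> \<Sigma>' (a \<odot>\<^bsub>sections F \<Sigma>\<^esub> s) = restrict a (\<Union>\<Sigma>') \<odot>\<^bsub>sections F \<Sigma>'\<^esub> res F \<Sigma> \<Sigma>' s" using *(3) by blast
  show "s \<in> degree_part F \<Sigma> d \<Longrightarrow> res F \<Sigma> \<Sigma>' s \<in> degree_part F \<Sigma>' d" using *(4) by blast
qed

lemma res_id: "dc \<Sigma> \<Longrightarrow> s \<in> carrier (sections F \<Sigma>) \<Longrightarrow> res F \<Sigma> \<Sigma> s = s"
  using conewise_F[unfolded conewise_module_def, THEN conjunct2, THEN conjunct2, THEN conjunct1] subfan_iff by blast

lemma res_comp:
  assumes "dc \<Sigma>" "dc \<Sigma>'" "dc \<Sigma>''" "\<Sigma>'' \<subseteq> \<Sigma>'" "\<Sigma>' \<subseteq> \<Sigma>" "s \<in> carrier (sections F \<Sigma>)"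
  shows "res F \<Sigma>' \<Sigma>'' (res F \<Sigma> \<Sigma>' s) = res F \<Sigma> \<Sigma>'' s"
proof -
  have "subfan \<Sigma> \<Delta> \<and> subfan \<Sigma>' \<Delta> \<and> subfan \<Sigma>'' \<Delta> \<and> \<Sigma>'' \<subseteq> \<Sigma>' \<and> \<Sigma>' \<subseteq> \<Sigma>" using assms subfan_iff by blast
  from conewise_F[unfolded conewise_module_def, THEN conjunct2, THEN conjunct2, THEN conjunct2, THEN conjunct1, rule_format, OF this]
  show ?thesis using assms(6) by blast
qed

lemma glue:
  assumes "dc \<Sigma>" "dc \<Sigma>'" "s \<in> carrier (sections F \<Sigma>)" "s' \<in> carrier (sections F \<Sigma>')"
    "res F \<Sigma> (\<Sigma> \<inter> \<Sigma>') s = res F \<Sigma>' (\<Sigma> \<inter> \<Sigma>') s'"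
  shows "\<exists>!t. t \<in> carrier (sections F (\<Sigma> \<union> \<Sigma>')) \<and> res F (\<Sigma> \<union> \<Sigma>') \<Sigma> t = s \<and> res F (\<Sigma> \<union> \<Sigma>') \<Sigma>' t = s'"
proof -
  have "subfan \<Sigma> \<Delta> \<and> subfan \<Sigma>' \<Delta>" using assms subfan_iff by blast
  from conewise_F[unfolded conewise_module_def, THEN conjunct2, THEN conjunct2, THEN conjunct2, THEN conjunct2,
      THEN spec, THEN spec, THEN mp, OF this, THEN bspec, OF assms(3), THEN bspec, OF assms(4), THEN mp, OF assms(5)]
  show ?thesis .
qed

lemma sec_group: "dc \<Sigma> \<Longrightarrow> abelian_group (sections F \<Sigma>)"
  using graded_moduleD(3)[OF graded_sections] .

lemma zero_closed: "dc \<Sigma> \<Longrightarrow> \<zero>\<^bsub>sections F \<Sigma>\<^esub> \<in> carrier (sections F \<Sigma>)"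
  using abelian_monoid.zero_closed[OF graded_moduleD(4)[OF graded_sections]] .

lemma res_zero:
  assumes "dc \<Sigma>" "dc \<Sigma>'" "\<Sigma>' \<subseteq> \<Sigma>"
  shows "res F \<Sigma> \<Sigma>' \<zero>\<^bsub>sections F \<Sigma>\<^esub> = \<zero>\<^bsub>sections F \<Sigma>'\<^esub>"
proof -
  interpret M: abelian_group "sections F \<Sigma>" by (rule sec_group[OF assms(1)])
  interpret M': abelian_group "sections F \<Sigma>'" by (rule sec_group[OF assms(2)])
  have "res F \<Sigma> \<Sigma>' \<zero>\<^bsub>sections F \<Sigma>\<^esub> \<oplus>\<^bsub>sections F \<Sigma>'\<^esub> res F \<Sigma> \<Sigma>' \<zero>\<^bsub>sections F \<Sigma>\<^esub> = res F \<Sigma> \<Sigma>' \<zero>\<^bsub>sections F \<Sigma>\<^esub>"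
    using res_all(2)[OF assms, of "\<zero>\<^bsub>sections F \<Sigma>\<^esub>" "\<zero>\<^bsub>sections F \<Sigma>\<^esub>"] by simp
  then show ?thesis using res_all(1)[OF assms M.zero_closed] M'.add.l_cancel_one by auto
qed

text \<open>The ring on the empty fan has \<open>1 = 0\<close>, so its unital modules are
  zero.\<close>

lemma sections_empty: "s \<in> carrier (sections F {}) \<Longrightarrow> s = \<zero>\<^bsub>sections F {}\<^esub>"
proof -
  assume s: "s \<in> carrier (sections F {})"
  interpret M: Module.module "conewise_ring {}" "sections F {}" using graded_moduleD(1)[OF graded_sections[OF dc_empty]] .
  have "\<one>\<^bsub>conewise_ring {}\<^esub> = \<zero>\<^bsub>(conewise_ring {} :: ('a \<Rightarrow> real) ring)\<^esub>" unfolding conewise_ring_def by (simp add: restrict_def)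
  then show ?thesis using M.smult_one[OF s] M.smult_l_null[OF s] by simp
qed

text \<open>Both restrictions to \<open>C\<close> glue the same pair of sections on \<open>A\<close>
  and \<open>B\<close>; the uniqueness in the gluing axiom identifies them.\<close>

lemma agree_Un:
  assumes "dc \<Sigma>" "dc A" "dc B" "A \<union> B = C" "C \<subseteq> \<Sigma>" and st: "s \<in> carrier (sections F \<Sigma>)" "t \<in> carrier (sections F \<Sigma>)"
    and A: "res F \<Sigma> A s = res F \<Sigma> A t" and B: "res F \<Sigma> B s = res F \<Sigma> B t"
  shows "res F \<Sigma> C s = res F \<Sigma> C t"
proof -
  have C: "dc C" using assms(2,3,4) dc_Un by blast
  have sub: "A \<subseteq> \<Sigma>" "B \<subseteq> \<Sigma>" "A \<subseteq> C" "B \<subseteq> C" "A \<inter> B \<subseteq> A" "A \<inter> B \<subseteq> B" using assms(4,5) by auto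
  have I: "dc (A \<inter> B)" using dc_Int assms by blast
  let ?a = "res F \<Sigma> A s" and ?b = "res F \<Sigma> B s"
  have ab: "?a \<in> carrier (sections F A)" "?b \<in> carrier (sections F B)" using res_all(1)[OF assms(1)] assms sub st by blast+
  have "res F A (A \<inter> B) ?a = res F B (A \<inter> B) ?b"
    using res_comp[OF assms(1,2) I sub(5,1) st(1)] res_comp[OF assms(1,3) I sub(6,2) st(1)] by simp
  from glue[OF assms(2,3) ab this] have ex: "\<exists>!z. z \<in> carrier (sections F C) \<and> res F C A z = ?a \<and> res F C B z = ?b"
    unfolding assms(4) .
  have 1: "res F \<Sigma> C z \<in> carrier (sections F C) \<and> res F C A (res F \<Sigma> C z) = res F \<Sigma> A z \<and> res F C B (res F \<Sigma> C z) = res F \<Sigma> B z"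
    if "z \<in> carrier (sections F \<Sigma>)" for z
    using res_all(1)[OF assms(1) C assms(5) that] res_comp[OF assms(1) C assms(2) sub(3) assms(5) that]
      res_comp[OF assms(1) C assms(3) sub(4) assms(5) that] by blast
  show ?thesis using ex 1[OF st(1)] 1[OF st(2)] A B by (metis (no_types, lifting))
qed

lemma flabby_res:
  assumes "dc \<Sigma>" "y \<in> carrier (sections F \<Sigma>)"
  shows "\<exists>x\<in>carrier (sections F \<Delta>). res F \<Delta> \<Sigma> x = y"
proof -
  have "res F \<Delta> \<Sigma> ` carrier (sections F \<Delta>) = carrier (sections F \<Sigma>)" using flabby_F assms(1) subfan_iff unfolding flabby_def by blast
  then have "y \<in> res F \<Delta> \<Sigma> ` carrier (sections F \<Delta>)" using assms(2) by simp
  then show ?thesis by auto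
qed

text \<open>Gluing \<open>y\<close> with zero on \<open>B\<close> and extending by flabbiness. This
  yields both the surjectivity onto sections over a facet and the flabbiness of the localized
  sheaf.\<close>

lemma extend_by_zero:
  assumes "dc A" "dc B" "y \<in> carrier (sections F A)" "res F A (A \<inter> B) y = \<zero>\<^bsub>sections F (A \<inter> B)\<^esub>"
  shows "\<exists>x\<in>carrier (sections F \<Delta>). res F \<Delta> A x = y \<and> res F \<Delta> B x = \<zero>\<^bsub>sections F B\<^esub>"
proof -
  have I: "dc (A \<inter> B)" "A \<inter> B \<subseteq> B" and U: "dc (A \<union> B)" "A \<subseteq> A \<union> B" "B \<subseteq> A \<union> B" using dc_Int dc_Un assms by auto
  have "res F A (A \<inter> B) y = res F B (A \<inter> B) \<zero>\<^bsub>sections F B\<^esub>"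
    using res_zero[OF assms(2) I] assms(4) by simp
  from glue[OF assms(1,2,3) zero_closed[OF assms(2)] this] obtain t
    where t: "t \<in> carrier (sections F (A \<union> B))" "res F (A \<union> B) A t = y" "res F (A \<union> B) B t = \<zero>\<^bsub>sections F B\<^esub>" by blast
  obtain x where x: "x \<in> carrier (sections F \<Delta>)" "res F \<Delta> (A \<union> B) x = t" using flabby_res[OF U(1) t(1)] by blast
  have "res F \<Delta> A x = y" "res F \<Delta> B x = \<zero>\<^bsub>sections F B\<^esub>"
    using res_comp[OF dc_all U(1) assms(1) U(2) dc_sub[OF U(1)] x(1)] res_comp[OF dc_all U(1) assms(2) U(3) dc_sub[OF U(1)] x(1)]
    unfolding x(2) t(2,3) by simp_all
  then show ?thesis using x(1) by blast
qed

text \<open>Needed to apply the induction hypothesis to a facet. A section over a subfan of the face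
  is extended to the whole fan and then restricted to the face.\<close>

lemma pure_face:
  assumes "\<tau> \<in> \<Delta>"
  shows "pure_module (cone_faces \<tau>) F"
proof -
  have sub: "cone_faces \<tau> \<subseteq> \<Delta>" using dc_sub[OF dc_face[OF assms]] .
  have "locally_free (cone_faces \<tau>) F" using locally_free_F sub unfolding locally_free_def by blast
  moreover have "flabby (cone_faces \<tau>) F"
    unfolding flabby_def
  proof (intro allI impI)
    fix \<Sigma> assume "subfan \<Sigma> (cone_faces \<tau>)"
    then have d: "dc \<Sigma>" "\<Sigma> \<subseteq> cone_faces \<tau>" using subfan_mono[OF _ sub] subfan_iff unfolding subfan_def by blast+
    note f = dc_face[OF assms]
    show "res F (cone_faces \<tau>) \<Sigma> ` carrier (sections F (cone_faces \<tau>)) = carrier (sections F \<Sigma>)"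
    proof
      show "res F (cone_faces \<tau>) \<Sigma> ` carrier (sections F (cone_faces \<tau>)) \<subseteq> carrier (sections F \<Sigma>)"
        using res_all(1)[OF f d] by blast
      show "carrier (sections F \<Sigma>) \<subseteq> res F (cone_faces \<tau>) \<Sigma> ` carrier (sections F (cone_faces \<tau>))"
      proof
        fix y assume "y \<in> carrier (sections F \<Sigma>)"
        then obtain x where x: "x \<in> carrier (sections F \<Delta>)" "res F \<Delta> \<Sigma> x = y" using flabby_res[OF d(1)] by blast
        have "res F (cone_faces \<tau>) \<Sigma> (res F \<Delta> (cone_faces \<tau>) x) = y"
          using res_comp[OF dc_all f d(1,2) sub x(1)] x(2) by simp
        then show "y \<in> res F (cone_faces \<tau>) \<Sigma> ` carrier (sections F (cone_faces \<tau>))"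
          using res_all(1)[OF dc_all f sub x(1)] by blast
      qed
    qed
  qed
  ultimately show ?thesis unfolding pure_module_def using conewise_module_sub[OF conewise_F sub] by blast
qed

end

text \<open>The filtration \<open>L\<close> imposes vanishing on one more facet of the shelling at
  each stage. Passing from \<open>L i\<close> to \<open>L (Suc i)\<close> means taking the kernel of
  restriction to the next facet, whose image consists of the sections vanishing on its non-back
  faces for \<open>q i\<close>. These are free by induction on the dimension, so
  \<open>facet_kernel_free\<close> applies.\<close>

lemma relative_sections_free:
  fixes S :: "'a::euclidean_space set" and F :: "('a, 'm) fan_sheaf"
  assumes "pointed_polyhedral_cone S" "pure_module (cone_faces S) F" "v \<in> span S"
    and "K = relative_sections F (cone_faces S) (cone_faces S - back_faces S v)"
  shows "graded_module (cring_of S) (chom_of S) ((sections F (cone_faces S))\<lparr>carrier := K\<rparr>) (\<lambda>d. degree_part F (cone_faces S) d \<inter> K) \<and>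
    graded_free (cring_of S) ((sections F (cone_faces S))\<lparr>carrier := K\<rparr>) (\<lambda>d. degree_part F (cone_faces S) d \<inter> K)"
  using assms
proof (induct "dim S" arbitrary: S v K rule: less_induct)
  case less
  interpret pure_sheaf S F using less(2,3) by unfold_locales
  obtain N where "cone_normals S N" using obtain_cone_normals[OF less(2)] by blast
  then interpret c: cone_normals S N .
  note K_def = less(5)
  show ?case
  proof (rule c.line_shelling[OF less(4)])
    fix k :: nat and \<rho> q n
    assume nb: "\<Delta> - back_faces S v = (\<Union>i<k. cone_faces (\<rho> i))"
      and n: "\<And>i. i < k \<Longrightarrow> n i \<in> N \<and> \<rho> i = S \<inter> {x. n i \<bullet> x = 0}"
      and q: "\<And>i. i < k \<Longrightarrow> q i \<in> span (\<rho> i)"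
      and shell: "\<And>i. i < k \<Longrightarrow> cone_faces (\<rho> i) - back_faces (\<rho> i) (q i) = cone_faces (\<rho> i) \<inter> (\<Union>j<i. cone_faces (\<rho> j))"
    define M where "M = sections F \<Delta>"
    define G where "G = degree_part F \<Delta>"
    define \<Sigma> where "\<Sigma> i = (\<Union>j<i. cone_faces (\<rho> j))" for i :: nat
    define L where "L i = relative_sections F \<Delta> (\<Sigma> i)" for i
    have L_iff: "x \<in> L i \<longleftrightarrow> x \<in> carrier M \<and> res F \<Delta> (\<Sigma> i) x = \<zero>\<^bsub>sections F (\<Sigma> i)\<^esub>" for x i
      unfolding L_def M_def relative_sections_def by blast
    have \<rho>F: "\<rho> i \<in> \<Delta>" if "i < k" for i using n[OF that] c.facet_mem by metis
    have \<Sigma>: "dc (\<Sigma> i)" if "i \<le> k" for i unfolding \<Sigma>_def by (rule dc_UN) (use \<rho>F that in \<open>auto intro: dc_face\<close>)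
    have main: "graded_module (cring_of S) (chom_of S) (M\<lparr>carrier := L i\<rparr>) (\<lambda>d. G d \<inter> L i) \<and>
        graded_free (cring_of S) (M\<lparr>carrier := L i\<rparr>) (\<lambda>d. G d \<inter> L i)" if "i \<le> k" for i
      using that
    proof (induct i)
      \<comment> \<open>Vanishing on the empty fan is no condition, so the filtration starts at the
        stalk itself, which is free because the sheaf is pure.\<close>
      case 0
      have "L 0 = carrier M"
      proof -
        have "res F \<Delta> {} x = \<zero>\<^bsub>sections F {}\<^esub>" if "x \<in> carrier M" for x
          using sections_empty res_all(1)[OF dc_all dc_empty _ that[unfolded M_def]] by blast
        then show ?thesis using L_iff[of _ 0] unfolding \<Sigma>_def by auto
      qed
      moreover have "G d \<inter> carrier M = G d" for d
        using graded_moduleD(5)[OF graded_sections[OF dc_all]] unfolding G_def M_def by blast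
      moreover have "M\<lparr>carrier := carrier M\<rparr> = M" by simp
      moreover have "graded_free (cring_of S) M G"
        using locally_free_F cone_faces_self[OF ppc] unfolding locally_free_def M_def G_def by blast
      ultimately show ?case using graded_sections[OF dc_all] unfolding M_def G_def by simp
    next
      case (Suc i)
      then have i: "i < k" by simp
      let ?r = "\<rho> i" and ?E = "cone_faces (\<rho> i) - back_faces (\<rho> i) (q i)"
      let ?K' = "relative_sections F (cone_faces ?r) ?E" and ?M = "M\<lparr>carrier := L i\<rparr>"
      let ?M' = "(sections F (cone_faces ?r))\<lparr>carrier := ?K'\<rparr>"
      let ?p = "res F \<Delta> (cone_faces ?r)"
      have r: "dc (cone_faces ?r)" "cone_faces ?r \<subseteq> \<Delta>" using dc_face[OF \<rho>F[OF i]] dc_sub by blast+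
      have ppcr: "pointed_polyhedral_cone ?r" using pointed_polyhedral_cone_face[OF ppc \<rho>F[OF i]] .
      have si: "dc (\<Sigma> i)" "\<Sigma> i \<subseteq> \<Delta>" using \<Sigma> i dc_sub by auto
      have E: "?E = cone_faces ?r \<inter> \<Sigma> i" using shell[OF i] unfolding \<Sigma>_def .
      have dE: "dc ?E" "?E \<subseteq> cone_faces ?r" "?E \<subseteq> \<Sigma> i" unfolding E using dc_Int r si by auto
      have "dim ?r < dim S" using n[OF i] c.facet_dim by metis
      from less(1)[OF this ppcr pure_face[OF \<rho>F[OF i]] q[OF i] refl]
      have IH: "graded_module (cring_of ?r) (chom_of ?r) ?M' (\<lambda>d. degree_part F (cone_faces ?r) d \<inter> ?K')"
        "graded_free (cring_of ?r) ?M' (\<lambda>d. degree_part F (cone_faces ?r) d \<inter> ?K')" by blast+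
      have IH2: "graded_module (cring_of S) (chom_of S) ?M (\<lambda>d. G d \<inter> L i)" "graded_free (cring_of S) ?M (\<lambda>d. G d \<inter> L i)"
        using Suc by auto
      have p_in: "?p x \<in> ?K'" if x: "x \<in> L i" for x
      proof -
        have xM: "x \<in> carrier (sections F \<Delta>)" using x L_iff M_def by blast
        have "res F (cone_faces ?r) ?E (?p x) = res F \<Delta> ?E x" by (rule res_comp[OF dc_all r(1) dE(1,2) r(2) xM])
        also have "\<dots> = res F (\<Sigma> i) ?E (res F \<Delta> (\<Sigma> i) x)" by (rule res_comp[OF dc_all si(1) dE(1,3) si(2) xM, symmetric])
        also have "\<dots> = \<zero>\<^bsub>sections F ?E\<^esub>" using x L_iff res_zero[OF si(1) dE(1,3)] by simp
        finally show ?thesis unfolding relative_sections_def using res_all(1)[OF dc_all r xM] by blast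
      qed
      have LM: "L i \<subseteq> carrier (sections F \<Delta>)" using L_iff unfolding M_def by blast
      define K'' where "K'' = {x \<in> carrier ?M. ?p x = \<zero>\<^bsub>?M'\<^esub>}"
      have "graded_module (cring_of S) (chom_of S) (?M\<lparr>carrier := K''\<rparr>) (\<lambda>d. (G d \<inter> L i) \<inter> K'') \<and>
        graded_free (cring_of S) (?M\<lparr>carrier := K''\<rparr>) (\<lambda>d. (G d \<inter> L i) \<inter> K'')"
      proof -
        have 1: "?p x \<in> carrier ?M'" if "x \<in> carrier ?M" for x using p_in that by simp
        have 2: "?p x \<in> degree_part F (cone_faces ?r) d \<inter> ?K'" if "x \<in> G d \<inter> L i" for x d
          using p_in res_all(4)[OF dc_all r] that unfolding G_def by blast
        have 3: "?p (x \<oplus>\<^bsub>?M\<^esub> y) = ?p x \<oplus>\<^bsub>?M'\<^esub> ?p y" if "x \<in> carrier ?M" "y \<in> carrier ?M" for x y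
          using res_all(2)[OF dc_all r, of x y] that LM unfolding M_def by auto
        have 4: "?p (a \<odot>\<^bsub>?M\<^esub> x) = restrict a ?r \<odot>\<^bsub>?M'\<^esub> ?p x" if "a \<in> carrier (cring_of S)" "x \<in> carrier ?M" for a x
          using res_all(3)[OF dc_all r, of a x] that LM Union_cone_faces[OF ppcr] unfolding M_def by auto
        \<comment> \<open>By the shelling property such a section over the facet vanishes on its
          overlap with the earlier facets, so it extends to a section vanishing on all of
          them.\<close>
        have 5: "\<exists>x\<in>carrier ?M. ?p x = y" if y: "y \<in> carrier ?M'" for y
        proof -
          have y': "y \<in> carrier (sections F (cone_faces ?r))" "res F (cone_faces ?r) (cone_faces ?r \<inter> \<Sigma> i) y = \<zero>\<^bsub>sections F (cone_faces ?r \<inter> \<Sigma> i)\<^esub>"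
            using y unfolding relative_sections_def E by auto
          obtain x where "x \<in> carrier (sections F \<Delta>)" "?p x = y" "res F \<Delta> (\<Sigma> i) x = \<zero>\<^bsub>sections F (\<Sigma> i)\<^esub>"
            using extend_by_zero[OF r(1) si(1) y'] by blast
          then show ?thesis using L_iff[of x i] unfolding M_def by auto
        qed
        show ?thesis
          using c.facet_kernel_free[OF conjunct1[OF n[OF i]] conjunct2[OF n[OF i]] IH2 IH 1 2 3 4 5 K''_def]
          by blast
      qed
      moreover have "K'' = L (Suc i)"
      proof (rule Set.set_eqI)
        fix x
        have U: "\<Sigma> (Suc i) = \<Sigma> i \<union> cone_faces ?r" unfolding \<Sigma>_def by (auto simp: lessThan_Suc)
        have sS: "dc (\<Sigma> (Suc i))" "\<Sigma> (Suc i) \<subseteq> \<Delta>" using \<Sigma>[OF Suc(2)] dc_sub by blast+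
        have "x \<in> K'' \<longleftrightarrow> x \<in> carrier M \<and> res F \<Delta> (\<Sigma> i) x = \<zero>\<^bsub>sections F (\<Sigma> i)\<^esub> \<and> ?p x = \<zero>\<^bsub>sections F (cone_faces ?r)\<^esub>"
          unfolding K''_def using L_iff by auto
        also have "\<dots> \<longleftrightarrow> x \<in> carrier M \<and> res F \<Delta> (\<Sigma> (Suc i)) x = \<zero>\<^bsub>sections F (\<Sigma> (Suc i))\<^esub>"
        proof (intro conj_cong refl iffI)
          assume x: "x \<in> carrier M"
          note xM = x[unfolded M_def]
          { assume a: "res F \<Delta> (\<Sigma> i) x = \<zero>\<^bsub>sections F (\<Sigma> i)\<^esub> \<and> ?p x = \<zero>\<^bsub>sections F (cone_faces ?r)\<^esub>"
            have "res F \<Delta> (\<Sigma> (Suc i)) x = res F \<Delta> (\<Sigma> (Suc i)) \<zero>\<^bsub>sections F \<Delta>\<^esub>"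
              by (rule agree_Un[OF dc_all si(1) r(1) U[symmetric] sS(2) xM zero_closed[OF dc_all]])
                (use a res_zero[OF dc_all si] res_zero[OF dc_all r] in simp_all)
            then show "res F \<Delta> (\<Sigma> (Suc i)) x = \<zero>\<^bsub>sections F (\<Sigma> (Suc i))\<^esub>" using res_zero[OF dc_all sS] by simp }
          { assume a: "res F \<Delta> (\<Sigma> (Suc i)) x = \<zero>\<^bsub>sections F (\<Sigma> (Suc i))\<^esub>"
            have sub: "\<Sigma> i \<subseteq> \<Sigma> (Suc i)" "cone_faces ?r \<subseteq> \<Sigma> (Suc i)" using U by auto
            show "res F \<Delta> (\<Sigma> i) x = \<zero>\<^bsub>sections F (\<Sigma> i)\<^esub> \<and> ?p x = \<zero>\<^bsub>sections F (cone_faces ?r)\<^esub>"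
              using res_comp[OF dc_all sS(1) si(1) sub(1) sS(2) xM] res_comp[OF dc_all sS(1) r(1) sub(2) sS(2) xM]
                res_zero[OF sS(1) si(1) sub(1)] res_zero[OF sS(1) r(1) sub(2)] unfolding a by simp }
        qed
        also have "\<dots> \<longleftrightarrow> x \<in> L (Suc i)" using L_iff by blast
        finally show "x \<in> K'' \<longleftrightarrow> x \<in> L (Suc i)" .
      qed
      moreover have "(G d \<inter> L i) \<inter> K'' = G d \<inter> K''" for d unfolding K''_def by auto
      ultimately show ?case by simp
    qed
    have "L k = K" unfolding K_def L_def \<Sigma>_def nb ..
    then show ?thesis using main[of k] unfolding M_def G_def by simp
  qed
qed

section \<open>The localized sheaf\<close>

lemma graded_free_trivial:
  assumes "abelian_monoid M" "carrier M = {\<zero>\<^bsub>M\<^esub>}"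
  shows "graded_free R M G"
proof -
  interpret abelian_monoid M by (rule assms)
  show ?thesis
    unfolding graded_free_def by (intro exI[of _ "{}"]) (use assms(2) in auto)
qed

text \<open>In the localized sheaf scalars are first restricted to the front part. At the stalk in
  question this changes nothing for ring elements, but the operations differ on other functions, so
  the two records are not equal.\<close>

lemma graded_free_smult_cong:
  fixes M M' :: "('r, 'm) module"
  assumes gm: "graded_module R H M G" and free: "graded_free R M G"
    and eq: "carrier M' = carrier M" "add M' = add M" "zero M' = zero M"
    and sm: "\<And>a x. a \<in> carrier R \<Longrightarrow> x \<in> carrier M \<Longrightarrow> a \<odot>\<^bsub>M'\<^esub> x = a \<odot>\<^bsub>M\<^esub> x"
  shows "graded_free R M' G"
proof -
  note D = graded_moduleD[OF gm]
  interpret M: Module.module R M by (rule D)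
  obtain B where B: "B \<subseteq> (\<Union>d. G d)" "\<forall>x\<in>carrier M. \<exists>!c. c \<in> B \<rightarrow>\<^sub>E carrier R \<and>
        finite {b \<in> B. c b \<noteq> \<zero>\<^bsub>R\<^esub>} \<and> x = finsum M (\<lambda>b. c b \<odot>\<^bsub>M\<^esub> b) {b \<in> B. c b \<noteq> \<zero>\<^bsub>R\<^esub>}"
    using free unfolding graded_free_def by blast
  have BM: "b \<in> carrier M" if "b \<in> B" for b using B(1) D(5) that by blast
  have "finsum M' (\<lambda>b. c b \<odot>\<^bsub>M'\<^esub> b) {b \<in> B. c b \<noteq> \<zero>\<^bsub>R\<^esub>} = finsum M (\<lambda>b. c b \<odot>\<^bsub>M\<^esub> b) {b \<in> B. c b \<noteq> \<zero>\<^bsub>R\<^esub>}"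
    if c: "c \<in> B \<rightarrow>\<^sub>E carrier R" for c
  proof -
    have "finsum M' g T = finsum M g T" for g and T :: "'m set" unfolding finsum_def by (simp add: eq)
    moreover have "finsum M (\<lambda>b. c b \<odot>\<^bsub>M'\<^esub> b) {b \<in> B. c b \<noteq> \<zero>\<^bsub>R\<^esub>} = finsum M (\<lambda>b. c b \<odot>\<^bsub>M\<^esub> b) {b \<in> B. c b \<noteq> \<zero>\<^bsub>R\<^esub>}"
      by (rule M.M.finsum_cong') (use c BM sm in auto)
    ultimately show ?thesis by simp
  qed
  then have "(c \<in> B \<rightarrow>\<^sub>E carrier R \<and> finite {b \<in> B. c b \<noteq> \<zero>\<^bsub>R\<^esub>} \<and> x = finsum M' (\<lambda>b. c b \<odot>\<^bsub>M'\<^esub> b) {b \<in> B. c b \<noteq> \<zero>\<^bsub>R\<^esub>}) \<longleftrightarrow>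
    (c \<in> B \<rightarrow>\<^sub>E carrier R \<and> finite {b \<in> B. c b \<noteq> \<zero>\<^bsub>R\<^esub>} \<and> x = finsum M (\<lambda>b. c b \<odot>\<^bsub>M\<^esub> b) {b \<in> B. c b \<noteq> \<zero>\<^bsub>R\<^esub>})" for c x
    by auto
  then show ?thesis unfolding graded_free_def eq(1) using B by (intro exI[of _ B]) simp
qed

lemma conewise_restrict:
  assumes "\<Sigma>' \<subseteq> \<Sigma>"
  shows "a \<in> carrier (conewise_ring \<Sigma>) \<Longrightarrow> restrict a (\<Union>\<Sigma>') \<in> carrier (conewise_ring \<Sigma>')"
    "a \<in> conewise_homogeneous \<Sigma> d \<Longrightarrow> restrict a (\<Union>\<Sigma>') \<in> conewise_homogeneous \<Sigma>' d"
    "restrict \<one>\<^bsub>conewise_ring \<Sigma>\<^esub> (\<Union>\<Sigma>') = \<one>\<^bsub>conewise_ring \<Sigma>'\<^esub>"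
    "restrict (a \<oplus>\<^bsub>conewise_ring \<Sigma>\<^esub> b) (\<Union>\<Sigma>') = restrict a (\<Union>\<Sigma>') \<oplus>\<^bsub>conewise_ring \<Sigma>'\<^esub> restrict b (\<Union>\<Sigma>')"
    "restrict (a \<otimes>\<^bsub>conewise_ring \<Sigma>\<^esub> b) (\<Union>\<Sigma>') = restrict a (\<Union>\<Sigma>') \<otimes>\<^bsub>conewise_ring \<Sigma>'\<^esub> restrict b (\<Union>\<Sigma>')"
proof -
  have U: "\<And>x. x \<in> \<Union>\<Sigma>' \<Longrightarrow> x \<in> \<Union>\<Sigma>" using assms by blast
  show "restrict a (\<Union>\<Sigma>') \<in> carrier (conewise_ring \<Sigma>')" if a: "a \<in> carrier (conewise_ring \<Sigma>)"
  proof -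
    have "\<exists>p. real_polynomial_function p \<and> (\<forall>x\<in>\<tau>. restrict a (\<Union>\<Sigma>') x = p x)" if t: "\<tau> \<in> \<Sigma>'" for \<tau>
    proof -
      have "\<forall>\<tau>\<in>\<Sigma>. \<exists>p. real_polynomial_function p \<and> (\<forall>x\<in>\<tau>. a x = p x)"
        using a unfolding conewise_ring_def conewise_poly_def by simp
      then obtain p where "real_polynomial_function p" "\<forall>x\<in>\<tau>. a x = p x" using t assms by blast
      then show ?thesis using t by (intro exI[of _ p]) auto
    qed
    then show ?thesis unfolding conewise_ring_def conewise_poly_def by simp
  qed
  show "restrict a (\<Union>\<Sigma>') \<in> conewise_homogeneous \<Sigma>' d" if a: "a \<in> conewise_homogeneous \<Sigma> d"
  proof -
    have "\<exists>p. real_polynomial_function p \<and> (\<forall>c x. p (c *\<^sub>R x) = c ^ d * p x) \<and> (\<forall>x\<in>\<tau>. restrict a (\<Union>\<Sigma>') x = p x)" if t: "\<tau> \<in> \<Sigma>'" for \<tau>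
    proof -
      obtain p where "real_polynomial_function p" "\<forall>c x. p (c *\<^sub>R x) = c ^ d * p x" "\<forall>x\<in>\<tau>. a x = p x"
        using a t assms unfolding conewise_homogeneous_def by blast
      then show ?thesis using t by (intro exI[of _ p]) auto
    qed
    then show ?thesis unfolding conewise_homogeneous_def by simp
  qed
  show "restrict \<one>\<^bsub>conewise_ring \<Sigma>\<^esub> (\<Union>\<Sigma>') = \<one>\<^bsub>conewise_ring \<Sigma>'\<^esub>"
    "restrict (a \<oplus>\<^bsub>conewise_ring \<Sigma>\<^esub> b) (\<Union>\<Sigma>') = restrict a (\<Union>\<Sigma>') \<oplus>\<^bsub>conewise_ring \<Sigma>'\<^esub> restrict b (\<Union>\<Sigma>')"
    "restrict (a \<otimes>\<^bsub>conewise_ring \<Sigma>\<^esub> b) (\<Union>\<Sigma>') = restrict a (\<Union>\<Sigma>') \<otimes>\<^bsub>conewise_ring \<Sigma>'\<^esub> restrict b (\<Union>\<Sigma>')"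
    unfolding conewise_ring_def using U by (auto simp: restrict_def fun_eq_iff)
qed

section \<open>Front parts of subfans and their non-back faces\<close>

locale localized_sheaf = pure_sheaf S F for S :: "'a::euclidean_space set" and F :: "('a, 'm) fan_sheaf" +
  fixes v :: 'a
  assumes v: "v \<in> span S"
begin

abbreviation "P \<equiv> front_part S v"
abbreviation "Q \<equiv> strict_front_part S v"
abbreviation "rel \<Sigma> \<equiv> relative_sections F (P \<Sigma>) (Q \<Sigma>)"

lemma closure_iff: "X \<subseteq> \<Delta> \<Longrightarrow> \<tau> \<in> face_closure X \<longleftrightarrow> \<tau> \<in> \<Delta> \<and> (\<exists>\<rho>\<in>X. \<tau> \<subseteq> \<rho>)"
proof -
  assume X: "X \<subseteq> \<Delta>"
  have "cone_faces \<rho> = {\<tau> \<in> \<Delta>. \<tau> \<subseteq> \<rho>}" if "\<rho> \<in> X" for \<rho> using cone_faces_face[of \<rho> S] that X by blast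
  then show ?thesis unfolding face_closure_def by auto
qed

lemma faces_subset: "back_faces S v \<subseteq> \<Delta>" "front_faces S v \<subseteq> \<Delta>" "strict_front_faces S v \<subseteq> front_faces S v"
  unfolding strict_front_faces_def front_faces_def back_faces_def by auto

lemma P_iff: "\<tau> \<in> P \<Sigma> \<longleftrightarrow> \<tau> \<in> \<Delta> \<and> (\<exists>\<rho>\<in>\<Sigma>. \<rho> \<in> front_faces S v \<and> \<tau> \<subseteq> \<rho>)"
proof -
  have "\<Sigma> \<inter> front_faces S v \<subseteq> \<Delta>" using faces_subset(2) by blast
  from closure_iff[OF this, of \<tau>] show ?thesis unfolding front_part_def by (simp only: Bex_def Int_iff conj_assoc)
qed

lemma P_dc: "dc (P \<Sigma>)"
  unfolding down_closed_def
proof (intro conjI subsetI ballI impI)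
  show "\<tau> \<in> P \<Sigma> \<Longrightarrow> \<tau> \<in> \<Delta>" for \<tau> unfolding P_iff by blast
  show "\<tau> \<in> P \<Sigma> \<Longrightarrow> \<rho> \<in> \<Delta> \<Longrightarrow> \<rho> \<subseteq> \<tau> \<Longrightarrow> \<rho> \<in> P \<Sigma>" for \<tau> \<rho> unfolding P_iff by blast
qed

lemma P_sub: "dc \<Sigma> \<Longrightarrow> P \<Sigma> \<subseteq> \<Sigma>"
  using dc_down by (auto simp: P_iff)

lemma P_mono: "\<Sigma>' \<subseteq> \<Sigma> \<Longrightarrow> P \<Sigma>' \<subseteq> P \<Sigma>"
proof
  show "\<Sigma>' \<subseteq> \<Sigma> \<Longrightarrow> \<tau> \<in> P \<Sigma>' \<Longrightarrow> \<tau> \<in> P \<Sigma>" for \<tau> unfolding P_iff by blast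
qed

lemma P_Un: "P (\<Sigma> \<union> \<Sigma>') = P \<Sigma> \<union> P \<Sigma>'"
  by (auto simp: P_iff)

lemma back_up_face: "\<tau> \<in> back_faces S v \<Longrightarrow> \<rho> \<in> \<Delta> \<Longrightarrow> \<tau> \<subseteq> \<rho> \<Longrightarrow> \<rho> \<in> back_faces S v"
proof -
  obtain N where "cone_normals S N" using obtain_cone_normals[OF ppc] by blast
  then interpret c: cone_normals S N .
  show "\<tau> \<in> back_faces S v \<Longrightarrow> \<rho> \<in> \<Delta> \<Longrightarrow> \<tau> \<subseteq> \<rho> \<Longrightarrow> \<rho> \<in> back_faces S v" by (rule c.back_up[OF v])
qed

lemma front_up_face: "\<tau> \<in> front_faces S v \<Longrightarrow> \<rho> \<in> \<Delta> \<Longrightarrow> \<tau> \<subseteq> \<rho> \<Longrightarrow> \<rho> \<in> front_faces S v"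
proof -
  obtain N where "cone_normals S N" using obtain_cone_normals[OF ppc] by blast
  then interpret c: cone_normals S N .
  show "\<tau> \<in> front_faces S v \<Longrightarrow> \<rho> \<in> \<Delta> \<Longrightarrow> \<tau> \<subseteq> \<rho> \<Longrightarrow> \<rho> \<in> front_faces S v" by (rule c.front_up[OF v])
qed

lemma P_all: "P \<Delta> = \<Delta>"
proof -
  obtain N where "cone_normals S N" using obtain_cone_normals[OF ppc] by blast
  then interpret c: cone_normals S N .
  show ?thesis
  proof (rule Set.set_eqI)
    fix \<tau>
    show "\<tau> \<in> P \<Delta> \<longleftrightarrow> \<tau> \<in> \<Delta>"
      unfolding P_iff using c.S_front[OF v] cone_faces_self[OF ppc] cone_faces_subset[of \<tau> S] by blast
  qed
qed

lemma dc_Diff_back: "dc \<Sigma> \<Longrightarrow> dc (\<Sigma> - back_faces S v)"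
  unfolding down_closed_def using back_up_face by blast

text \<open>Faces of a cone that is not back are not back, which gives one inclusion. For the other,
  \<open>exit_face\<close> finds a strict front face above the given cone and inside a front face of
  the subfan, hence again in the subfan. Vanishing can thus be tested by a condition on cones that
  does not mention the subfan.\<close>

lemma Q_eq: assumes "dc \<Sigma>" shows "Q \<Sigma> = P \<Sigma> - back_faces S v"
proof -
  obtain N where "cone_normals S N" using obtain_cone_normals[OF ppc] by blast
  then interpret c: cone_normals S N .
  have Q: "\<tau> \<in> Q \<Sigma> \<longleftrightarrow> \<tau> \<in> \<Delta> \<and> (\<exists>\<rho>\<in>\<Sigma>. \<rho> \<in> strict_front_faces S v \<and> \<tau> \<subseteq> \<rho>)" for \<tau>
  proof -
    have "\<Sigma> \<inter> strict_front_faces S v \<subseteq> \<Delta>" using faces_subset(2,3) by blast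
    from closure_iff[OF this, of \<tau>] show ?thesis unfolding strict_front_part_def by (simp only: Bex_def Int_iff conj_assoc)
  qed
  have strict: "\<gamma> \<in> front_faces S v \<and> \<gamma> \<notin> back_faces S v" if "\<gamma> \<in> strict_front_faces S v" for \<gamma>
    using that unfolding strict_front_faces_def by blast
  show ?thesis
  proof (rule Set.set_eqI, rule iffI)
    fix \<tau> assume "\<tau> \<in> Q \<Sigma>"
    then obtain \<gamma> where g: "\<tau> \<in> \<Delta>" "\<gamma> \<in> \<Sigma>" "\<gamma> \<in> strict_front_faces S v" "\<tau> \<subseteq> \<gamma>" unfolding Q by blast
    note g' = strict[OF g(3)]
    have "\<gamma> \<in> \<Delta>" using g(2) dc_sub[OF assms] by blast
    then have "\<tau> \<notin> back_faces S v" using back_up_face[OF _ _ g(4)] g' by blast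
    then show "\<tau> \<in> P \<Sigma> - back_faces S v" unfolding Diff_iff P_iff using g g' by blast
  next
    fix \<tau> assume t: "\<tau> \<in> P \<Sigma> - back_faces S v"
    then obtain \<rho> where r: "\<tau> \<in> \<Delta>" "\<rho> \<in> \<Sigma>" "\<rho> \<in> front_faces S v" "\<tau> \<subseteq> \<rho>" unfolding Diff_iff P_iff by blast
    obtain \<gamma> where g: "\<gamma> \<in> strict_front_faces S v" "\<tau> \<subseteq> \<gamma>" "\<gamma> \<subseteq> \<rho>"
      using c.exit_face[OF v r(1,3,4)] t by blast
    have "\<gamma> \<in> \<Delta>" using g(1) faces_subset(2,3) by blast
    then have "\<gamma> \<in> \<Sigma>" using dc_down[OF assms r(2)] g(3) by blast
    then show "\<tau> \<in> Q \<Sigma>" unfolding Q using g r(1) by blast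
  qed
qed

lemma Q_dc: "dc \<Sigma> \<Longrightarrow> dc (Q \<Sigma>)" and Q_sub: "dc \<Sigma> \<Longrightarrow> Q \<Sigma> \<subseteq> P \<Sigma>"
  using Q_eq dc_Diff_back[OF P_dc] by auto

text \<open>The front part does not commute with intersections. By \<open>front_Int\<close> the
  discrepancy consists of cones that are not back faces, and there the relevant sections
  vanish.\<close>

lemma P_Int:
  assumes "dc \<Sigma>" "dc \<Sigma>'"
  shows "P (\<Sigma> \<inter> \<Sigma>') \<union> ((P \<Sigma> \<inter> P \<Sigma>') - back_faces S v) = P \<Sigma> \<inter> P \<Sigma>'"
proof
  obtain N where "cone_normals S N" using obtain_cone_normals[OF ppc] by blast
  then interpret c: cone_normals S N .
  show "P (\<Sigma> \<inter> \<Sigma>') \<union> ((P \<Sigma> \<inter> P \<Sigma>') - back_faces S v) \<subseteq> P \<Sigma> \<inter> P \<Sigma>'"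
    using P_mono[of "\<Sigma> \<inter> \<Sigma>'" \<Sigma>] P_mono[of "\<Sigma> \<inter> \<Sigma>'" \<Sigma>'] by simp blast
  show "P \<Sigma> \<inter> P \<Sigma>' \<subseteq> P (\<Sigma> \<inter> \<Sigma>') \<union> ((P \<Sigma> \<inter> P \<Sigma>') - back_faces S v)"
  proof
    fix \<tau> assume t: "\<tau> \<in> P \<Sigma> \<inter> P \<Sigma>'"
    show "\<tau> \<in> P (\<Sigma> \<inter> \<Sigma>') \<union> ((P \<Sigma> \<inter> P \<Sigma>') - back_faces S v)"
    proof (cases "\<tau> \<in> back_faces S v")
      case True
      obtain \<rho> \<rho>' where r: "\<rho> \<in> \<Sigma>" "\<rho> \<in> front_faces S v" "\<tau> \<subseteq> \<rho>" "\<rho>' \<in> \<Sigma>'" "\<rho>' \<in> front_faces S v" "\<tau> \<subseteq> \<rho>'"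
        using t unfolding Int_iff P_iff by blast
      have f: "\<rho> \<inter> \<rho>' \<in> front_faces S v" using c.front_Int[OF v True r(2,5,3,6)] .
      then have "\<rho> \<inter> \<rho>' \<in> \<Delta>" using faces_subset(2) by blast
      then have I: "\<rho> \<inter> \<rho>' \<in> \<Sigma> \<inter> \<Sigma>'" using dc_down[OF assms(1) r(1)] dc_down[OF assms(2) r(4)] by simp
      have "\<tau> \<in> \<Delta>" using t unfolding Int_iff P_iff by simp
      moreover have "\<tau> \<subseteq> \<rho> \<inter> \<rho>'" using r by simp
      ultimately have "\<tau> \<in> P (\<Sigma> \<inter> \<Sigma>')" unfolding P_iff using f I by blast
      then show ?thesis by simp
    qed (use t in blast)
  qed
qed

lemma rel_iff: "s \<in> rel \<Sigma> \<longleftrightarrow> s \<in> carrier (sections F (P \<Sigma>)) \<and> res F (P \<Sigma>) (Q \<Sigma>) s = \<zero>\<^bsub>sections F (Q \<Sigma>)\<^esub>"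
  unfolding relative_sections_def by blast

lemma rel_zero:
  assumes "dc \<Sigma>" "s \<in> rel \<Sigma>" "dc T" "T \<subseteq> Q \<Sigma>"
  shows "res F (P \<Sigma>) T s = \<zero>\<^bsub>sections F T\<^esub>"
proof -
  have s: "s \<in> carrier (sections F (P \<Sigma>))" "res F (P \<Sigma>) (Q \<Sigma>) s = \<zero>\<^bsub>sections F (Q \<Sigma>)\<^esub>" using assms(2) unfolding rel_iff by simp_all
  have "res F (P \<Sigma>) T s = res F (Q \<Sigma>) T (res F (P \<Sigma>) (Q \<Sigma>) s)"
    by (rule res_comp[OF P_dc Q_dc[OF assms(1)] assms(3,4) Q_sub[OF assms(1)] s(1), symmetric])
  then show ?thesis using s(2) res_zero[OF Q_dc[OF assms(1)] assms(3,4)] by simp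
qed

lemma rel_res:
  assumes "dc \<Sigma>" "dc \<Sigma>'" "\<Sigma>' \<subseteq> \<Sigma>" "s \<in> rel \<Sigma>"
  shows "res F (P \<Sigma>) (P \<Sigma>') s \<in> rel \<Sigma>'"
proof -
  have s: "s \<in> carrier (sections F (P \<Sigma>))" using assms(4) unfolding rel_iff by simp
  have QQ: "Q \<Sigma>' \<subseteq> Q \<Sigma>" unfolding Q_eq[OF assms(1)] Q_eq[OF assms(2)] using P_mono[OF assms(3)] by blast
  have "res F (P \<Sigma>') (Q \<Sigma>') (res F (P \<Sigma>) (P \<Sigma>') s) = res F (P \<Sigma>) (Q \<Sigma>') s"
    by (rule res_comp[OF P_dc P_dc Q_dc[OF assms(2)] Q_sub[OF assms(2)] P_mono[OF assms(3)] s])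
  also have "\<dots> = \<zero>\<^bsub>sections F (Q \<Sigma>')\<^esub>" by (rule rel_zero[OF assms(1,4) Q_dc[OF assms(2)] QQ])
  finally show ?thesis unfolding rel_iff using res_all(1)[OF P_dc P_dc P_mono[OF assms(3)] s] by blast
qed

abbreviation "Fv \<equiv> v_localization S v F"

lemma Fv_simps:
  "sections Fv \<Sigma> = (sections F (P \<Sigma>))\<lparr>carrier := rel \<Sigma>, smult := \<lambda>a s. restrict a (\<Union>(P \<Sigma>)) \<odot>\<^bsub>sections F (P \<Sigma>)\<^esub> s\<rparr>"
  "degree_part Fv \<Sigma> d = degree_part F (P \<Sigma>) d \<inter> rel \<Sigma>"
  "res Fv \<Sigma> \<Sigma>' = res F (P \<Sigma>) (P \<Sigma>')"
  unfolding v_localization_def by simp_all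

lemma rel_closed:
  assumes "dc \<Sigma>"
  shows "rel \<Sigma> \<subseteq> carrier (sections F (P \<Sigma>))" "\<zero>\<^bsub>sections F (P \<Sigma>)\<^esub> \<in> rel \<Sigma>"
    "x \<in> rel \<Sigma> \<Longrightarrow> y \<in> rel \<Sigma> \<Longrightarrow> x \<oplus>\<^bsub>sections F (P \<Sigma>)\<^esub> y \<in> rel \<Sigma>"
    "a \<in> carrier (conewise_ring (P \<Sigma>)) \<Longrightarrow> x \<in> rel \<Sigma> \<Longrightarrow> a \<odot>\<^bsub>sections F (P \<Sigma>)\<^esub> x \<in> rel \<Sigma>"
proof -
  note Q = Q_dc[OF assms] Q_sub[OF assms]
  interpret M: Module.module "conewise_ring (P \<Sigma>)" "sections F (P \<Sigma>)" using graded_moduleD(1)[OF graded_sections[OF P_dc]] .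
  interpret M': Module.module "conewise_ring (Q \<Sigma>)" "sections F (Q \<Sigma>)" using graded_moduleD(1)[OF graded_sections[OF Q(1)]] .
  show "rel \<Sigma> \<subseteq> carrier (sections F (P \<Sigma>))" by (auto simp: rel_iff)
  show "\<zero>\<^bsub>sections F (P \<Sigma>)\<^esub> \<in> rel \<Sigma>" unfolding rel_iff using res_zero[OF P_dc Q] by simp
  show "x \<in> rel \<Sigma> \<Longrightarrow> y \<in> rel \<Sigma> \<Longrightarrow> x \<oplus>\<^bsub>sections F (P \<Sigma>)\<^esub> y \<in> rel \<Sigma>"
    unfolding rel_iff using res_all(2)[OF P_dc Q, of x y] by simp
  show "a \<in> carrier (conewise_ring (P \<Sigma>)) \<Longrightarrow> x \<in> rel \<Sigma> \<Longrightarrow> a \<odot>\<^bsub>sections F (P \<Sigma>)\<^esub> x \<in> rel \<Sigma>"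
    unfolding rel_iff using res_all(3)[OF P_dc Q, of a x] conewise_restrict(1)[OF Q(2), of a] by simp
qed

lemma conewise_homogeneous_carrier: "a \<in> conewise_homogeneous \<Sigma> d \<Longrightarrow> a \<in> carrier (conewise_ring \<Sigma>)"
  unfolding conewise_homogeneous_def conewise_ring_def conewise_poly_def by auto

section \<open>Sheaf axioms and purity of the localized sheaf\<close>

lemma Fv_graded_module:
  assumes "dc \<Sigma>"
  shows "graded_module (conewise_ring \<Sigma>) (conewise_homogeneous \<Sigma>) (sections Fv \<Sigma>) (degree_part Fv \<Sigma>)"
proof -
  note cl = rel_closed[OF assms]
  have eta: "degree_part Fv \<Sigma> = (\<lambda>d. degree_part F (P \<Sigma>) d \<inter> rel \<Sigma>)" using Fv_simps(2) by blast
  show ?thesis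
    unfolding Fv_simps(1) eta
  proof (rule graded_submodule[OF graded_sections[OF P_dc] graded_moduleD(2)[OF graded_sections[OF assms]]])
    note PS = P_sub[OF assms]
    show "a \<in> carrier (conewise_ring \<Sigma>) \<Longrightarrow> restrict a (\<Union>(P \<Sigma>)) \<in> carrier (conewise_ring (P \<Sigma>))" for a by (rule conewise_restrict(1)[OF PS])
    show "restrict \<one>\<^bsub>conewise_ring \<Sigma>\<^esub> (\<Union>(P \<Sigma>)) = \<one>\<^bsub>conewise_ring (P \<Sigma>)\<^esub>" by (rule conewise_restrict(3)[OF PS])
    show "restrict (a \<oplus>\<^bsub>conewise_ring \<Sigma>\<^esub> b) (\<Union>(P \<Sigma>)) = restrict a (\<Union>(P \<Sigma>)) \<oplus>\<^bsub>conewise_ring (P \<Sigma>)\<^esub> restrict b (\<Union>(P \<Sigma>))" for a b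
      by (rule conewise_restrict(4)[OF PS])
    show "restrict (a \<otimes>\<^bsub>conewise_ring \<Sigma>\<^esub> b) (\<Union>(P \<Sigma>)) = restrict a (\<Union>(P \<Sigma>)) \<otimes>\<^bsub>conewise_ring (P \<Sigma>)\<^esub> restrict b (\<Union>(P \<Sigma>))" for a b
      by (rule conewise_restrict(5)[OF PS])
    show "a \<in> conewise_homogeneous \<Sigma> i \<Longrightarrow> restrict a (\<Union>(P \<Sigma>)) \<in> conewise_homogeneous (P \<Sigma>) i" for a i by (rule conewise_restrict(2)[OF PS])
    show "a \<in> conewise_homogeneous (P \<Sigma>) i \<Longrightarrow> x \<in> rel \<Sigma> \<Longrightarrow> a \<odot>\<^bsub>sections F (P \<Sigma>)\<^esub> x \<in> rel \<Sigma>" for a x i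
      using cl(4) conewise_homogeneous_carrier by blast
    fix T and c :: "int \<Rightarrow> 'm" and d
    assume T: "finite T" "\<And>d. c d \<in> degree_part F (P \<Sigma>) d" "finsum (sections F (P \<Sigma>)) c T \<in> rel \<Sigma>" "d \<in> T"
    note Q = Q_dc[OF assms] Q_sub[OF assms]
    have "res F (P \<Sigma>) (Q \<Sigma>) (c d) = \<zero>\<^bsub>sections F (Q \<Sigma>)\<^esub>"
      by (rule graded_kernel_component[OF graded_sections[OF P_dc] graded_sections[OF Q(1)] res_all(1,4,2)[OF P_dc Q] T(1,2)
            conjunct2[OF T(3)[unfolded rel_iff]] T(4)])
    then show "c d \<in> rel \<Sigma>" unfolding rel_iff using graded_moduleD(5)[OF graded_sections[OF P_dc] T(2)] by blast
  qed (use cl in auto)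
qed

text \<open>The hypothesis gives agreement only on the front part of the intersection. On the rest
  of the intersection of the front parts both sections are zero by \<open>P_Int\<close> and
  \<open>Q_eq\<close>, so the gluing axiom of \<open>F\<close> applies.\<close>

lemma Fv_glue:
  assumes d: "dc \<Sigma>" "dc \<Sigma>'" and s: "s \<in> rel \<Sigma>" "s' \<in> rel \<Sigma>'"
    and agree: "res F (P \<Sigma>) (P (\<Sigma> \<inter> \<Sigma>')) s = res F (P \<Sigma>') (P (\<Sigma> \<inter> \<Sigma>')) s'"
  shows "\<exists>!t. t \<in> rel (\<Sigma> \<union> \<Sigma>') \<and> res F (P (\<Sigma> \<union> \<Sigma>')) (P \<Sigma>) t = s \<and> res F (P (\<Sigma> \<union> \<Sigma>')) (P \<Sigma>') t = s'"
proof -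
  let ?I = "P \<Sigma> \<inter> P \<Sigma>'" and ?J = "P (\<Sigma> \<inter> \<Sigma>')"
  let ?N = "?I - back_faces S v"
  have sM: "s \<in> carrier (sections F (P \<Sigma>))" "s' \<in> carrier (sections F (P \<Sigma>'))" using s unfolding rel_iff by simp_all
  have I: "dc ?I" "?I \<subseteq> P \<Sigma>" "?I \<subseteq> P \<Sigma>'" using dc_Int[OF P_dc P_dc] by auto
  have N: "dc ?N" "?N \<subseteq> ?I" using dc_Diff_back[OF I(1)] by auto
  have J: "?J \<subseteq> ?I" using P_mono[of "\<Sigma> \<inter> \<Sigma>'" \<Sigma>] P_mono[of "\<Sigma> \<inter> \<Sigma>'" \<Sigma>'] by simp
  have JN: "?J \<union> ?N = ?I" by (rule P_Int[OF d])
  let ?a = "res F (P \<Sigma>) ?I s" and ?b = "res F (P \<Sigma>') ?I s'"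
  have ab: "?a \<in> carrier (sections F ?I)" "?b \<in> carrier (sections F ?I)"
    using res_all(1)[OF P_dc I(1,2) sM(1)] res_all(1)[OF P_dc I(1,3) sM(2)] by blast+
  have "res F ?I ?I ?a = res F ?I ?I ?b"
  proof (rule agree_Un[OF I(1) P_dc N(1) JN subset_refl ab])
    show "res F ?I ?J ?a = res F ?I ?J ?b"
      using res_comp[OF P_dc I(1) P_dc J I(2) sM(1)] res_comp[OF P_dc I(1) P_dc J I(3) sM(2)] agree by simp
    have "?N \<subseteq> Q \<Sigma>" "?N \<subseteq> Q \<Sigma>'" using Q_eq d by auto
    then show "res F ?I ?N ?a = res F ?I ?N ?b"
      using res_comp[OF P_dc I(1) N(1) N(2) I(2) sM(1)] res_comp[OF P_dc I(1) N(1) N(2) I(3) sM(2)]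
        rel_zero[OF d(1) s(1) N(1)] rel_zero[OF d(2) s(2) N(1)] by simp
  qed
  then have "?a = ?b" using res_id[OF I(1)] ab by simp
  from glue[OF P_dc P_dc sM this]
  have ex: "\<exists>!t. t \<in> carrier (sections F (P (\<Sigma> \<union> \<Sigma>'))) \<and> res F (P (\<Sigma> \<union> \<Sigma>')) (P \<Sigma>) t = s \<and> res F (P (\<Sigma> \<union> \<Sigma>')) (P \<Sigma>') t = s'"
    unfolding P_Un .
  let ?U = "\<Sigma> \<union> \<Sigma>'"
  have U: "dc ?U" "P \<Sigma> \<subseteq> P ?U" "P \<Sigma>' \<subseteq> P ?U" using dc_Un d P_Un by auto
  \<comment> \<open>Front parts commute with unions and non-back faces are determined cone by cone,
    so the vanishing loci of the two sections together form that of the glued one.\<close>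
  have in_rel: "t \<in> rel ?U" if t: "t \<in> carrier (sections F (P ?U))" "res F (P ?U) (P \<Sigma>) t = s" "res F (P ?U) (P \<Sigma>') t = s'" for t
  proof -
    have z: "res F (P ?U) (Q \<Sigma>) t = \<zero>\<^bsub>sections F (Q \<Sigma>)\<^esub>" "res F (P ?U) (Q \<Sigma>') t = \<zero>\<^bsub>sections F (Q \<Sigma>')\<^esub>"
      using res_comp[OF P_dc P_dc Q_dc[OF d(1)] Q_sub[OF d(1)] U(2) t(1)] res_comp[OF P_dc P_dc Q_dc[OF d(2)] Q_sub[OF d(2)] U(3) t(1)]
        s t(2,3) by (simp_all add: rel_iff)
    have QU: "Q \<Sigma> \<union> Q \<Sigma>' = Q ?U" unfolding Q_eq[OF U(1)] Q_eq[OF d(1)] Q_eq[OF d(2)] P_Un by blast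
    have sub: "Q \<Sigma> \<subseteq> P ?U" "Q \<Sigma>' \<subseteq> P ?U" using Q_sub d U by blast+
    have "res F (P ?U) (Q ?U) t = res F (P ?U) (Q ?U) \<zero>\<^bsub>sections F (P ?U)\<^esub>"
      by (rule agree_Un[OF P_dc Q_dc[OF d(1)] Q_dc[OF d(2)] QU Q_sub[OF U(1)] t(1) zero_closed[OF P_dc]])
        (use z res_zero[OF P_dc Q_dc[OF d(1)] sub(1)] res_zero[OF P_dc Q_dc[OF d(2)] sub(2)] in simp_all)
    then show ?thesis unfolding rel_iff using t(1) res_zero[OF P_dc Q_dc[OF U(1)] Q_sub[OF U(1)]] by simp
  qed
  have rel_sec: "t \<in> carrier (sections F (P ?U))" if "t \<in> rel ?U" for t using that unfolding rel_iff by simp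
  obtain t where t: "t \<in> carrier (sections F (P ?U))" "res F (P ?U) (P \<Sigma>) t = s" "res F (P ?U) (P \<Sigma>') t = s'"
    using ex by blast
  show ?thesis
  proof (rule ex1I[of _ t])
    show "t \<in> rel ?U \<and> res F (P ?U) (P \<Sigma>) t = s \<and> res F (P ?U) (P \<Sigma>') t = s'" using in_rel[OF t] t by simp
    fix t' assume "t' \<in> rel ?U \<and> res F (P ?U) (P \<Sigma>) t' = s \<and> res F (P ?U) (P \<Sigma>') t' = s'"
    then show "t' = t" using ex rel_sec[of t'] t by blast
  qed
qed

lemma Fv_conewise_module: "conewise_module \<Delta> Fv"
  unfolding conewise_module_def
proof (intro conjI)
  show "\<forall>\<Sigma>. subfan \<Sigma> \<Delta> \<longrightarrow> graded_module (conewise_ring \<Sigma>) (conewise_homogeneous \<Sigma>) (sections Fv \<Sigma>) (degree_part Fv \<Sigma>)"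
    using Fv_graded_module subfan_iff by blast
  show "\<forall>\<Sigma> \<Sigma>'. subfan \<Sigma> \<Delta> \<and> subfan \<Sigma>' \<Delta> \<and> \<Sigma>' \<subseteq> \<Sigma> \<longrightarrow>
        res Fv \<Sigma> \<Sigma>' \<in> carrier (sections Fv \<Sigma>) \<rightarrow> carrier (sections Fv \<Sigma>') \<and>
        (\<forall>s\<in>carrier (sections Fv \<Sigma>). \<forall>t\<in>carrier (sections Fv \<Sigma>).
           res Fv \<Sigma> \<Sigma>' (s \<oplus>\<^bsub>sections Fv \<Sigma>\<^esub> t) = res Fv \<Sigma> \<Sigma>' s \<oplus>\<^bsub>sections Fv \<Sigma>'\<^esub> res Fv \<Sigma> \<Sigma>' t) \<and>
        (\<forall>a\<in>carrier (conewise_ring \<Sigma>). \<forall>s\<in>carrier (sections Fv \<Sigma>).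
           res Fv \<Sigma> \<Sigma>' (a \<odot>\<^bsub>sections Fv \<Sigma>\<^esub> s) = restrict a (\<Union>\<Sigma>') \<odot>\<^bsub>sections Fv \<Sigma>'\<^esub> res Fv \<Sigma> \<Sigma>' s) \<and>
        (\<forall>d. res Fv \<Sigma> \<Sigma>' ` degree_part Fv \<Sigma> d \<subseteq> degree_part Fv \<Sigma>' d)"
  proof (intro allI impI)
    fix \<Sigma> \<Sigma>' assume a: "subfan \<Sigma> \<Delta> \<and> subfan \<Sigma>' \<Delta> \<and> \<Sigma>' \<subseteq> \<Sigma>"
    then have d: "dc \<Sigma>" "dc \<Sigma>'" "\<Sigma>' \<subseteq> \<Sigma>" using subfan_iff by auto
    note r = res_all[OF P_dc P_dc P_mono[OF d(3)]]
    have relM: "s \<in> carrier (sections F (P \<Sigma>))" if "s \<in> rel \<Sigma>" for s using that unfolding rel_iff by simp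
    have U: "\<Union>(P \<Sigma>') \<subseteq> \<Union>(P \<Sigma>)" "\<Union>(P \<Sigma>') \<subseteq> \<Union>\<Sigma>'" using P_mono[OF d(3)] P_sub[OF d(2)] by blast+
    have rr: "restrict (restrict a (\<Union>(P \<Sigma>))) (\<Union>(P \<Sigma>')) = restrict (restrict a (\<Union>\<Sigma>')) (\<Union>(P \<Sigma>'))" for a :: "'a \<Rightarrow> real"
      using U by (auto simp: restrict_def fun_eq_iff)
    show "res Fv \<Sigma> \<Sigma>' \<in> carrier (sections Fv \<Sigma>) \<rightarrow> carrier (sections Fv \<Sigma>') \<and>
        (\<forall>s\<in>carrier (sections Fv \<Sigma>). \<forall>t\<in>carrier (sections Fv \<Sigma>).
           res Fv \<Sigma> \<Sigma>' (s \<oplus>\<^bsub>sections Fv \<Sigma>\<^esub> t) = res Fv \<Sigma> \<Sigma>' s \<oplus>\<^bsub>sections Fv \<Sigma>'\<^esub> res Fv \<Sigma> \<Sigma>' t) \<and>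
        (\<forall>a\<in>carrier (conewise_ring \<Sigma>). \<forall>s\<in>carrier (sections Fv \<Sigma>).
           res Fv \<Sigma> \<Sigma>' (a \<odot>\<^bsub>sections Fv \<Sigma>\<^esub> s) = restrict a (\<Union>\<Sigma>') \<odot>\<^bsub>sections Fv \<Sigma>'\<^esub> res Fv \<Sigma> \<Sigma>' s) \<and>
        (\<forall>d. res Fv \<Sigma> \<Sigma>' ` degree_part Fv \<Sigma> d \<subseteq> degree_part Fv \<Sigma>' d)"
    proof (intro conjI ballI allI)
      show "res Fv \<Sigma> \<Sigma>' \<in> carrier (sections Fv \<Sigma>) \<rightarrow> carrier (sections Fv \<Sigma>')"
        unfolding Fv_simps using rel_res[OF d] by simp
      show "res Fv \<Sigma> \<Sigma>' (s \<oplus>\<^bsub>sections Fv \<Sigma>\<^esub> t) = res Fv \<Sigma> \<Sigma>' s \<oplus>\<^bsub>sections Fv \<Sigma>'\<^esub> res Fv \<Sigma> \<Sigma>' t"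
        if "s \<in> carrier (sections Fv \<Sigma>)" "t \<in> carrier (sections Fv \<Sigma>)" for s t
        using that r(2) relM unfolding Fv_simps by simp
      show "res Fv \<Sigma> \<Sigma>' (a \<odot>\<^bsub>sections Fv \<Sigma>\<^esub> s) = restrict a (\<Union>\<Sigma>') \<odot>\<^bsub>sections Fv \<Sigma>'\<^esub> res Fv \<Sigma> \<Sigma>' s"
        if "a \<in> carrier (conewise_ring \<Sigma>)" "s \<in> carrier (sections Fv \<Sigma>)" for a s
        using that r(3)[OF conewise_restrict(1)[OF P_sub[OF d(1)] that(1)]] relM rr unfolding Fv_simps by simp
      show "res Fv \<Sigma> \<Sigma>' ` degree_part Fv \<Sigma> e \<subseteq> degree_part Fv \<Sigma>' e" for e
        unfolding Fv_simps using r(4) rel_res[OF d] by blast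
    qed
  qed
  show "\<forall>\<Sigma>. subfan \<Sigma> \<Delta> \<longrightarrow> (\<forall>s\<in>carrier (sections Fv \<Sigma>). res Fv \<Sigma> \<Sigma> s = s)"
    unfolding Fv_simps using res_id[OF P_dc] by (simp add: rel_iff)
  show "\<forall>\<Sigma> \<Sigma>' \<Sigma>''. subfan \<Sigma> \<Delta> \<and> subfan \<Sigma>' \<Delta> \<and> subfan \<Sigma>'' \<Delta> \<and> \<Sigma>'' \<subseteq> \<Sigma>' \<and> \<Sigma>' \<subseteq> \<Sigma> \<longrightarrow>
        (\<forall>s\<in>carrier (sections Fv \<Sigma>). res Fv \<Sigma>' \<Sigma>'' (res Fv \<Sigma> \<Sigma>' s) = res Fv \<Sigma> \<Sigma>'' s)"
    unfolding Fv_simps using res_comp[OF P_dc P_dc P_dc P_mono P_mono] by (simp add: rel_iff)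
  show "\<forall>\<Sigma> \<Sigma>'. subfan \<Sigma> \<Delta> \<and> subfan \<Sigma>' \<Delta> \<longrightarrow>
        (\<forall>s\<in>carrier (sections Fv \<Sigma>). \<forall>s'\<in>carrier (sections Fv \<Sigma>').
           res Fv \<Sigma> (\<Sigma> \<inter> \<Sigma>') s = res Fv \<Sigma>' (\<Sigma> \<inter> \<Sigma>') s' \<longrightarrow>
           (\<exists>!t. t \<in> carrier (sections Fv (\<Sigma> \<union> \<Sigma>')) \<and> res Fv (\<Sigma> \<union> \<Sigma>') \<Sigma> t = s \<and> res Fv (\<Sigma> \<union> \<Sigma>') \<Sigma>' t = s'))"
    unfolding Fv_simps using Fv_glue subfan_iff by simp
qed

text \<open>The front part of the whole fan is the whole fan, and its non-back faces meet the front
  part of \<Sigma> exactly where \<open>s\<close> is required to vanish. So \<open>s\<close> extends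
  by zero to a section of the right kind.\<close>

lemma Fv_flabby: "flabby \<Delta> Fv"
  unfolding flabby_def
proof (intro allI impI)
  fix \<Sigma> assume "subfan \<Sigma> \<Delta>"
  then have d: "dc \<Sigma>" using subfan_iff by blast
  note sub = dc_sub[OF d]
  have "rel \<Sigma> \<subseteq> res F (P \<Delta>) (P \<Sigma>) ` rel \<Delta>"
  proof
    fix s assume s: "s \<in> rel \<Sigma>"
    have Qall: "Q \<Delta> = \<Delta> - back_faces S v" using Q_eq[OF dc_all] P_all by simp
    have I: "P \<Sigma> \<inter> Q \<Delta> = Q \<Sigma>" unfolding Qall Q_eq[OF d] using dc_sub[OF P_dc] by blast
    have "res F (P \<Sigma>) (P \<Sigma> \<inter> Q \<Delta>) s = \<zero>\<^bsub>sections F (P \<Sigma> \<inter> Q \<Delta>)\<^esub>" unfolding I using s unfolding rel_iff by simp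
    then obtain x where x: "x \<in> carrier (sections F \<Delta>)" "res F \<Delta> (P \<Sigma>) x = s" "res F \<Delta> (Q \<Delta>) x = \<zero>\<^bsub>sections F (Q \<Delta>)\<^esub>"
      using extend_by_zero[OF P_dc Q_dc[OF dc_all], of s] s unfolding rel_iff by blast
    then have "x \<in> rel \<Delta>" unfolding relative_sections_def P_all by simp
    then show "s \<in> res F (P \<Delta>) (P \<Sigma>) ` rel \<Delta>" unfolding P_all using x(2) by blast
  qed
  moreover have "res F (P \<Delta>) (P \<Sigma>) ` rel \<Delta> \<subseteq> rel \<Sigma>" using rel_res[OF dc_all d sub] by blast
  ultimately show "res Fv \<Delta> \<Sigma> ` carrier (sections Fv \<Delta>) = carrier (sections Fv \<Sigma>)" unfolding Fv_simps by simp
qed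

text \<open>If \<tau> is not a front face, its front part is empty. If it is front but not back,
  none of its faces is back and sections must vanish everywhere. In both cases the stalk is zero. If
  \<tau> is both, \<open>v\<close> lies in its span and the stalk is the module treated in
  \<open>relative_sections_free\<close>.\<close>

lemma Fv_locally_free: "locally_free \<Delta> Fv"
  unfolding locally_free_def
proof
  fix \<tau> assume t: "\<tau> \<in> \<Delta>"
  let ?c = "cone_faces \<tau>"
  note d = dc_face[OF t]
  have gmv: "graded_module (conewise_ring ?c) (conewise_homogeneous ?c) (sections Fv ?c) (degree_part Fv ?c)"
    by (rule Fv_graded_module[OF d])
  have ppct: "pointed_polyhedral_cone \<tau>" using pointed_polyhedral_cone_face[OF ppc t] .
  have tt: "\<tau> \<in> ?c" using cone_faces_self[OF ppct] .
  have cm: "\<gamma> \<in> ?c \<longleftrightarrow> \<gamma> \<in> \<Delta> \<and> \<gamma> \<subseteq> \<tau>" for \<gamma> unfolding cone_faces_face[OF t] by (rule mem_Collect_eq)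
  have triv: "graded_free (conewise_ring ?c) (sections Fv ?c) (degree_part Fv ?c)" if "\<And>s. s \<in> rel ?c \<Longrightarrow> s = \<zero>\<^bsub>sections F (P ?c)\<^esub>"
  proof (rule graded_free_trivial[OF graded_moduleD(4)[OF gmv]])
    have "rel ?c = {\<zero>\<^bsub>sections F (P ?c)\<^esub>}"
    proof (intro equalityI subsetI)
      show "s \<in> {\<zero>\<^bsub>sections F (P ?c)\<^esub>}" if "s \<in> rel ?c" for s using \<open>\<And>s. s \<in> rel ?c \<Longrightarrow> s = \<zero>\<^bsub>sections F (P ?c)\<^esub>\<close>[OF that] by simp
      show "s \<in> rel ?c" if "s \<in> {\<zero>\<^bsub>sections F (P ?c)\<^esub>}" for s using that rel_closed(2)[OF d] by simp
    qed
    then show "carrier (sections Fv ?c) = {\<zero>\<^bsub>sections Fv ?c\<^esub>}" unfolding Fv_simps by simp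
  qed
  show "graded_free (conewise_ring ?c) (sections Fv ?c) (degree_part Fv ?c)"
  proof (cases "\<tau> \<in> front_faces S v")
    case False
    have "\<gamma> \<notin> P ?c" for \<gamma>
    proof
      assume "\<gamma> \<in> P ?c"
      then obtain \<rho> where r: "\<rho> \<in> ?c" "\<rho> \<in> front_faces S v" unfolding P_iff by blast
      then have "\<rho> \<subseteq> \<tau>" using cm[of \<rho>] by simp
      then show False using front_up_face[OF r(2) t] False by simp
    qed
    then have "P ?c = {}" by blast
    then have "s = \<zero>\<^bsub>sections F (P ?c)\<^esub>" if "s \<in> rel ?c" for s using that sections_empty[of s] unfolding rel_iff by simp
    then show ?thesis by (rule triv)
  next
    case True
    have P: "P ?c = ?c"
    proof
      show "P ?c \<subseteq> ?c" by (rule P_sub[OF d])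
      show "?c \<subseteq> P ?c"
      proof
        fix \<gamma> assume "\<gamma> \<in> ?c"
        then have "\<gamma> \<in> \<Delta>" "\<gamma> \<subseteq> \<tau>" using cm[of \<gamma>] by simp_all
        then show "\<gamma> \<in> P ?c" unfolding P_iff using True tt by blast
      qed
    qed
    have Q: "Q ?c = ?c - back_faces S v" using Q_eq[OF d] P by simp
    show ?thesis
    proof (cases "\<tau> \<in> back_faces S v")
      case False
      then have "Q ?c = ?c" unfolding Q using back_up_face t cm by blast
      then have "s = \<zero>\<^bsub>sections F (P ?c)\<^esub>" if "s \<in> rel ?c" for s using that rel_iff[of s ?c] P res_id[OF d, of s] by simp
      then show ?thesis by (rule triv)
    next
      case bk: True
      obtain N where "cone_normals S N" using obtain_cone_normals[OF ppc] by blast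
      then interpret c: cone_normals S N .
      have vt: "v \<in> span \<tau>" by (rule c.direction_in_span[OF v bk True])
      \<comment> \<open>Since \<open>v\<close> is parallel to \<tau>, being a back face means the
        same for \<open>S\<close> and for \<tau> itself.\<close>
      have Q': "Q ?c = ?c - back_faces \<tau> v" unfolding Q c.back_faces_face[OF t vt] by blast
      have rel: "rel ?c = relative_sections F ?c (?c - back_faces \<tau> v)" unfolding P Q' ..
      let ?M = "(sections F ?c)\<lparr>carrier := rel ?c\<rparr>"
      have free: "graded_module (cring_of \<tau>) (chom_of \<tau>) ?M (\<lambda>d. degree_part F ?c d \<inter> rel ?c)"
        "graded_free (cring_of \<tau>) ?M (\<lambda>d. degree_part F ?c d \<inter> rel ?c)"
        using relative_sections_free[OF ppct pure_face[OF t] vt rel] by blast+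
      have eta: "degree_part Fv ?c = (\<lambda>d. degree_part F ?c d \<inter> rel ?c)" using Fv_simps(2)[of ?c] unfolding P by blast
      show ?thesis
        unfolding eta
      proof (rule graded_free_smult_cong[OF free])
        fix a x assume a: "a \<in> carrier (cring_of \<tau>)"
        then have "a \<in> extensional (\<Union>?c)" unfolding conewise_ring_def conewise_poly_def by simp
        then show "a \<odot>\<^bsub>sections Fv ?c\<^esub> x = a \<odot>\<^bsub>?M\<^esub> x" unfolding Fv_simps P by (simp add: extensional_restrict)
      qed (simp_all add: Fv_simps P)
    qed
  qed
qed

lemma Fv_pure: "pure_module \<Delta> Fv"
  unfolding pure_module_def using Fv_conewise_module Fv_locally_free Fv_flabby by blast

end

theorem theorem3p10:
  fixes V \<sigma> :: "'a::euclidean_space set" and v :: 'a and F :: "('a, 'm) fan_sheaf"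
  assumes "subspace V"
    and "pointed_polyhedral_cone \<sigma>"
    and "span \<sigma> = V"
    and "v \<in> V"
    and "pure_module (cone_faces \<sigma>) F"
  shows "pure_module (cone_faces \<sigma>) (v_localization \<sigma> v F)"
proof -
  interpret localized_sheaf \<sigma> F v using assms by unfold_locales auto
  show ?thesis by (rule Fv_pure)
qed

end
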